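(* Let $J\neq F_n^\infty$ be a WOT-closed two-sided ideal of $F_n^\infty$ and let $T=[T_1,\ldots,T_n]$, $T_i\in B(\mathcal H)$, be a pure row contraction such that $$f(T_1,\ldots,T_n)=0\quad\text{for any }f\in J.$$ Then the following statements hold: (i) The constrained Poisson kernel $K_{J,T}:\mathcal H\to\mathcal N_J\otimes\overline{\Delta_T\mathcal H}$ defined by $K_{J,T}:=(P_{\mathcal N_J}\otimes I)K_T$ is an isometry, $K_{J,T}\mathcal H$ is co-invariant under $B_i\otimes I_{\overline{\Delta_T\mathcal H}}$, $i=1,\dots,n$, and $$T_i=K_{J,T}^*(B_i\otimes I_{\overline{\Delta_T\mathcal H}})K_{J,T},\quad i=1,\ldots,n.\qquad( * )$$ (ii) $\text{dil-ind}(T)=\mathrm{rank}\,\Delta_T$. (iii) If $1\in\mathcal N_J$, then the dilation provided by $( * )$ is minimal, i.e. $\mathcal N_J\otimes\overline{\Delta_T\mathcal H}=\bigvee_{\alpha\in\mathbb F_n^+}(B_\alpha\otimes I_{\overline{\Delta_T\mathcal H}})K_{J,T}\mathcal H$. If, in addition, $1\in\mathcal N_J$ and $$\overline{\mathrm{span}}\{B_\alpha B_\beta^*:\ \alpha,\beta\in\mathbb F_n^+\}=C^*(B_1,\ldots,B_n),$$ then we have: (iv) The minimal dilation provided by $( * )$ is unique up to an isomorphism. (v) The minimal dilation $[B_1\otimes I_{\overline{\Delta_T\mathcal H}},\ldots,B_n\otimes I_{\overline{\Delta_T\mathcal H}}]$ is the maximal $J$-constrained piece of the standard noncommutative isometric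 dilation $[S_1\otimes I_{\overline{\Delta_T\mathcal H}},\ldots,S_n\otimes I_{\overline{\Delta_T\mathcal H}}]$ of $T$. (vi) A pure $J$-constrained row contraction has $\mathrm{rank}\,\Delta_T=m$, $m=1,2,\ldots,\infty$, if and only if it is unitarily equivalent to one obtained by compressing $[B_1\otimes I_{\mathbb C^m},\ldots,B_n\otimes I_{\mathbb C^m}]$ to a co-invariant subspace $\mathcal M\subset\mathcal N_J\otimes\mathbb C^m$ under $B_1\otimes I_{\mathbb C^m},\ldots,B_n\otimes I_{\mathbb C^m}$, with the property that $\dim P_0\mathcal M=m$, where $P_0$ is the orthogonal projection of $\mathcal N_J\otimes\mathbb C^m$ onto the subspace $1\otimes\mathbb C^m$.
   Context: Let $n\in\{1,2,\dots\}$ and let $F^2(H_n)=\bigoplus_{k\ge 0}H_n^{\otimes k}$ be the full Fock space of an $n$-dimensional complex Hilbert space $H_n$ with orthonormal basis $e_1,\dots,e_n$ (with $H_n^{\otimes 0}=\mathbb C1$); $S_i\varphi=e_i\otimes\varphi$ are the left creation operators. $F_n^\infty\subset B(F^2(H_n))$ is the WOT-closed algebra generated by $S_1,\dots,S_n$ and the identity. Put $\mathcal N_J=F^2(H_n)\ominus\overline{JF^2(H_n)}$, $B_i=P_{\mathcal N_J}S_i|_{\mathcal N_J}$. $C^*(B_1,\dots,B_n)$ is the $C^*$-algebra generated by $B_1,\dots,B_n$ and the identity. $\mathbb F_n^+$ is the unital free semigroup on $g_1,\dots,g_n$, $|\alpha|$ is the length of $\alpha$; $X_\alpha=X_{i_1}\cdots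 X_{i_k}$ and $e_\alpha=e_{i_1}\otimes\cdots\otimes e_{i_k}$ for $\alpha=g_{i_1}\cdots g_{i_k}$, with $X_{g_0}=I$ and $e_{g_0}=1$ for the neutral element $g_0$. $T$ is a row contraction if $\sum_iT_iT_i^*\le I$; it is pure if $\text{SOT-}\lim_{k}\sum_{|\alpha|=k}T_\alpha T_\alpha^*=0$; $\Delta_T=(I-\sum_iT_iT_i^* )^{1/2}$. For $f\in F_n^\infty$ with $f(1)=\sum_\alpha a_\alpha e_\alpha$ and $T$ pure, $f(T_1,\dots,T_n)=\text{SOT-}\lim_{r\to1}\sum_{k\ge0}\sum_{|\alpha|=k}r^{|\alpha|}a_\alpha T_\alpha$. A pure row contraction $T$ is called $J$-constrained if $f(T_1,\dots,T_n)=0$ for all $f\in J$. The Poisson kernel $K_T:\mathcal H\to F^2(H_n)\otimes\overline{\Delta_T\mathcal H}$ is $K_Th=\sum_{\alpha\in\mathbb F_n^+}e_\alpha\otimes\Delta_TT_\alpha^*h$. Co-invariant means invariant under the adjoints. The dilation index $\text{dil-ind}(T)$ is here the minimum of $\dim\mathcal D$ over all Hilbert spaces $\mathcal D$ such that $\mathcal H$ can be identified (isometrically) with a subspace of $\mathcal N_J\otimes\mathcal D$ co-invariant under $B_i\otimes I_{\mathcal D}$ with $T_i=P_{\mathcal H}(B_i\otimes I_{\mathcal D})|_{\mathcal H}$, $i=1,\dots,n$. A minimal dilation of $T$ (in (iv)) means an isometry $V:\mathcal H\to\mathcal N_J\otimes\mathcal D$ with $V\mathcal H$ co-invariant under $B_i\otimes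 I_{\mathcal D}$, $T_i=V^*(B_i\otimes I_{\mathcal D})V$, and $\mathcal N_J\otimes\mathcal D=\bigvee_\alpha(B_\alpha\otimes I_{\mathcal D})V\mathcal H$; uniqueness up to isomorphism means that for any such $V$ there is a unitary $U:\mathcal N_J\otimes\overline{\Delta_T\mathcal H}\to\mathcal N_J\otimes\mathcal D$ with $U(B_i\otimes I)=(B_i\otimes I_{\mathcal D})U$ for all $i$ and $UK_{J,T}=V$. In (v), the standard minimal isometric dilation of the pure row contraction $T$ is realized as $[S_1\otimes I,\dots,S_n\otimes I]$ on $F^2(H_n)\otimes\overline{\Delta_T\mathcal H}$, with $\mathcal H$ embedded by $K_T$. The maximal $J$-constrained piece of a pure row contraction $[X_1,\dots,X_n]$ is its compression to the closed span of all co-invariant subspaces $\mathcal M$ with $\varphi(P_{\mathcal M}X_1|_{\mathcal M},\dots,P_{\mathcal M}X_n|_{\mathcal M})=0$ for all $\varphi\in J$. In (vi), $m=\infty$ means countably infinite, $\mathbb C^\infty$ is a separable infinite-dimensional Hilbert space, and rank/dimension means the Hilbert space dimension of the closure of the range/subspace. *)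

theory Defs
  imports "HOL-Analysis.Analysis"
begin

section \<open>Complex Hilbert spaces\<close>

text \<open>The inner product is linear in the first argument.\<close>

class chilbert_space = banach +
  fixes scaleC :: "complex \<Rightarrow> 'a \<Rightarrow> 'a" (infixr "*\<^sub>C" 75)
    and cinner :: "'a \<Rightarrow> 'a \<Rightarrow> complex"
  assumes scaleC_add_right: "a *\<^sub>C (x + y) = a *\<^sub>C x + a *\<^sub>C y"
    and scaleC_add_left: "(a + b) *\<^sub>C x = a *\<^sub>C x + b *\<^sub>C x"
    and scaleC_scaleC: "a *\<^sub>C (b *\<^sub>C x) = (a * b) *\<^sub>C x"
    and scaleC_of_real: "complex_of_real r *\<^sub>C x = r *\<^sub>R x"
    and cinner_commute: "cinner x y = cnj (cinner y x)"
    and cinner_add_left: "cinner (x + y) z = cinner x z + cinner y z"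
    and cinner_scaleC_left: "cinner (a *\<^sub>C x) y = a * cinner x y"
    and cinner_self: "cinner x x = complex_of_real ((norm x)\<^sup>2)"

instantiation complex :: chilbert_space
begin

definition scaleC_complex :: "complex \<Rightarrow> complex \<Rightarrow> complex"
  where "scaleC_complex a x = a * x"

definition cinner_complex :: "complex \<Rightarrow> complex \<Rightarrow> complex"
  where "cinner_complex x y = x * cnj y"

instance
proof
  fix x y z a b :: complex and r :: real
  show "cinner x x = complex_of_real ((norm x)\<^sup>2)"
    unfolding cinner_complex_def by (rule complex_norm_square[symmetric])
qed (simp_all add: scaleC_complex_def cinner_complex_def distrib_left distrib_right
      scaleR_conv_of_real)

end

lemma scaleC_one [simp]: "1 *\<^sub>C x = (x :: 'a :: chilbert_space)"
  using scaleC_of_real[of 1 x] by simp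

lemma scaleC_zero_left [simp]: "0 *\<^sub>C x = (0 :: 'a :: chilbert_space)"
  using scaleC_of_real[of 0 x] by simp

lemma scaleC_zero_right [simp]: "a *\<^sub>C 0 = (0 :: 'a :: chilbert_space)"
  using scaleC_add_right[of a 0 0] by simp

lemma scaleC_minus_right: "a *\<^sub>C (- x) = - (a *\<^sub>C (x :: 'a :: chilbert_space))"
  using scaleC_add_right[of a x "- x"] by (simp add: eq_neg_iff_add_eq_0 add.commute)

lemma scaleC_minus_one: "(- 1) *\<^sub>C x = - (x :: 'a :: chilbert_space)"
  using scaleC_of_real[of "- 1" x] by simp

lemma cinner_zero_left [simp]: "cinner 0 y = (0 :: complex)"
  using cinner_add_left[of 0 0 y] by simp

lemma cinner_zero_right [simp]: "cinner y 0 = (0 :: complex)"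
  by (subst cinner_commute) simp

lemma cinner_add_right: "cinner z (x + y) = cinner z x + cinner z y"
  by (subst (1 2 3) cinner_commute) (simp add: cinner_add_left)

lemma cinner_scaleC_right: "cinner x (a *\<^sub>C y) = cnj a * cinner x y"
  by (subst (1 2) cinner_commute) (simp add: cinner_scaleC_left)

lemma norm_scaleC: "norm (a *\<^sub>C x) = cmod a * norm (x :: 'a :: chilbert_space)"
proof -
  have "complex_of_real ((norm (a *\<^sub>C x))\<^sup>2) = a * cnj a * complex_of_real ((norm x)\<^sup>2)"
    unfolding cinner_self[symmetric] cinner_scaleC_left cinner_scaleC_right
    by (simp only: mult.assoc) (rule mult.left_commute)
  also have "\<dots> = complex_of_real ((cmod a * norm x)\<^sup>2)"
    by (simp add: complex_norm_square[symmetric] power_mult_distrib)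
  finally have "(norm (a *\<^sub>C x))\<^sup>2 = (cmod a * norm x)\<^sup>2"
    by (simp only: of_real_eq_iff)
  then show ?thesis by simp
qed

lemma Re_cinner_le: "Re (cinner x y) \<le> norm x * norm (y :: 'a :: chilbert_space)"
proof -
  have "complex_of_real ((norm (x + y))\<^sup>2) = cinner (x + y) (x + y)"
    by (simp add: cinner_self)
  also have "\<dots> = cinner x x + cinner y y + (cinner x y + cnj (cinner x y))"
    by (simp add: cinner_add_left cinner_add_right cinner_commute[of y x])
  also have "\<dots> = complex_of_real ((norm x)\<^sup>2 + (norm y)\<^sup>2 + 2 * Re (cinner x y))"
    by (simp add: cinner_self complex_add_cnj)
  finally have "(norm (x + y))\<^sup>2 = (norm x)\<^sup>2 + (norm y)\<^sup>2 + 2 * Re (cinner x y)"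
    by (simp only: of_real_eq_iff)
  moreover have "(norm (x + y))\<^sup>2 \<le> (norm x + norm y)\<^sup>2"
    by (intro power_mono norm_triangle_ineq) auto
  ultimately show ?thesis by (simp add: power2_eq_square algebra_simps)
qed

lemma cmod_cinner_le: "cmod (cinner x y) \<le> norm x * norm (y :: 'a :: chilbert_space)"
proof (cases "cinner x y = 0")
  case False
  define a where "a = cnj (cinner x y) / complex_of_real (cmod (cinner x y))"
  have a: "cmod a = 1" using False by (simp add: a_def norm_divide)
  have "cinner (a *\<^sub>C x) y
      = (cinner x y * cnj (cinner x y)) / complex_of_real (cmod (cinner x y))"
    by (simp add: a_def cinner_scaleC_left)
  also have "\<dots> = complex_of_real (cmod (cinner x y))"
    unfolding complex_norm_square[symmetric] using False by (simp add: power2_eq_square)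
  finally have "cinner (a *\<^sub>C x) y = complex_of_real (cmod (cinner x y))" .
  then have "cmod (cinner x y) = Re (cinner (a *\<^sub>C x) y)" by simp
  also have "\<dots> \<le> norm (a *\<^sub>C x) * norm y" by (rule Re_cinner_le)
  finally show ?thesis by (simp add: norm_scaleC a)
qed simp

section \<open>Square-summable families\<close>

text \<open>\<open>('i, 'd) l2\<close> is the Hilbert space of square-summable families \<open>'i \<Rightarrow> 'd\<close>. It serves as the
  model of the Hilbert space tensor product of \<open>('i, complex) l2\<close> and \<open>'d\<close>; see the lemmas
  \<open>cinner_tens\<close> and \<open>ccspan_tens\<close> below.\<close>

definition sqsummable :: "('i \<Rightarrow> 'd :: chilbert_space) \<Rightarrow> bool"
  where "sqsummable f \<longleftrightarrow> (\<lambda>i. (norm (f i))\<^sup>2) summable_on UNIV"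

lemma sqsummable_bound:
  assumes "\<And>F. finite F \<Longrightarrow> (\<Sum>i\<in>F. (norm (f i))\<^sup>2) \<le> C"
  shows "sqsummable f" "infsum (\<lambda>i. (norm (f i))\<^sup>2) UNIV \<le> C"
proof -
  show *: "sqsummable f"
    unfolding sqsummable_def
    by (rule nonneg_bdd_above_summable_on) (auto intro!: bdd_aboveI[of _ C] assms)
  show "infsum (\<lambda>i. (norm (f i))\<^sup>2) UNIV \<le> C"
    using * unfolding sqsummable_def by (rule infsum_le_finite_sums) (use assms in auto)
qed

lemma sqsummable_finite_le:
  assumes "sqsummable f" "finite F"
  shows "(\<Sum>i\<in>F. (norm (f i))\<^sup>2) \<le> infsum (\<lambda>i. (norm (f i))\<^sup>2) UNIV"
  using assms unfolding sqsummable_def by (intro finite_sum_le_infsum) auto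

lemma sqsummable_L2_le:
  assumes "sqsummable f" "finite F"
  shows "L2_set (\<lambda>i. norm (f i)) F \<le> sqrt (infsum (\<lambda>i. (norm (f i))\<^sup>2) UNIV)"
  unfolding L2_set_def using sqsummable_finite_le[OF assms] by simp

lemma sqsummable_add_aux:
  assumes "sqsummable f" "sqsummable g"
  shows "sqsummable (\<lambda>i. f i + g i)"
    and "sqrt (infsum (\<lambda>i. (norm (f i + g i))\<^sup>2) UNIV)
      \<le> sqrt (infsum (\<lambda>i. (norm (f i))\<^sup>2) UNIV) + sqrt (infsum (\<lambda>i. (norm (g i))\<^sup>2) UNIV)"
      (is "_ \<le> ?A + ?B")
proof -
  have nn: "?A \<ge> 0" "?B \<ge> 0" by (auto intro!: infsum_nonneg)
  have *: "(\<Sum>i\<in>F. (norm (f i + g i))\<^sup>2) \<le> (?A + ?B)\<^sup>2" if "finite F" for F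
  proof -
    have "L2_set (\<lambda>i. norm (f i + g i)) F \<le> L2_set (\<lambda>i. norm (f i) + norm (g i)) F"
      by (intro L2_set_mono norm_triangle_ineq) auto
    also have "\<dots> \<le> L2_set (\<lambda>i. norm (f i)) F + L2_set (\<lambda>i. norm (g i)) F"
      by (rule L2_set_triangle_ineq)
    also have "\<dots> \<le> ?A + ?B"
      using sqsummable_L2_le[OF assms(1) that] sqsummable_L2_le[OF assms(2) that] by simp
    finally show ?thesis
      unfolding L2_set_def by (rule sqrt_le_D)
  qed
  show "sqsummable (\<lambda>i. f i + g i)" by (rule sqsummable_bound(1)[OF *])
  have "sqrt (infsum (\<lambda>i. (norm (f i + g i))\<^sup>2) UNIV) \<le> sqrt ((?A + ?B)\<^sup>2)"
    using sqsummable_bound(2)[OF *] by (simp only: real_sqrt_le_iff)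
  then show "sqrt (infsum (\<lambda>i. (norm (f i + g i))\<^sup>2) UNIV) \<le> ?A + ?B" using nn by simp
qed

lemma sqsummable_scaleC: "sqsummable f \<Longrightarrow> sqsummable (\<lambda>i. a *\<^sub>C f i)"
  unfolding sqsummable_def norm_scaleC power_mult_distrib by (rule summable_on_cmult_right)

lemma sqsummable_cinner:
  assumes "sqsummable f" "sqsummable g"
  shows "(\<lambda>i. cinner (f i) (g i)) summable_on UNIV"
proof (rule abs_summable_summable, rule Infinite_Sum.abs_summable_on_comparison_test')
  show "(\<lambda>i. (norm (f i))\<^sup>2 + (norm (g i))\<^sup>2) summable_on UNIV"
    using assms unfolding sqsummable_def by (rule summable_on_add)
next
  fix i
  have "cmod (cinner (f i) (g i)) \<le> norm (f i) * norm (g i)" by (rule cmod_cinner_le)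
  also have "\<dots> \<le> (norm (f i))\<^sup>2 + (norm (g i))\<^sup>2"
    using sum_squares_bound[of "norm (f i)" "norm (g i)"]
      mult_nonneg_nonneg[OF norm_ge_zero norm_ge_zero, of "f i" "g i"] by linarith
  finally show "norm (cinner (f i) (g i)) \<le> (norm (f i))\<^sup>2 + (norm (g i))\<^sup>2" .
qed

typedef (overloaded) ('i, 'd :: chilbert_space) l2 = "{f :: 'i \<Rightarrow> 'd. sqsummable f}"
  morphisms l2_nth Abs_l2
  by (rule exI[of _ "\<lambda>_. 0"]) (simp add: sqsummable_def)

setup_lifting type_definition_l2

lemma sqsummable_l2_nth: "sqsummable (l2_nth x)"
  using l2_nth by auto

instantiation l2 :: (type, chilbert_space) real_normed_vector
begin

lift_definition zero_l2 :: "('a, 'b) l2" is "\<lambda>_. 0" by (simp add: sqsummable_def)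
lift_definition plus_l2 :: "('a, 'b) l2 \<Rightarrow> ('a, 'b) l2 \<Rightarrow> ('a, 'b) l2"
  is "\<lambda>f g i. f i + g i" by (rule sqsummable_add_aux)
lift_definition uminus_l2 :: "('a, 'b) l2 \<Rightarrow> ('a, 'b) l2"
  is "\<lambda>f i. - f i" by (simp add: sqsummable_def)
lift_definition minus_l2 :: "('a, 'b) l2 \<Rightarrow> ('a, 'b) l2 \<Rightarrow> ('a, 'b) l2"
  is "\<lambda>f g i. f i - g i"
  using sqsummable_add_aux(1)[where g = "\<lambda>i. - g i" for g] by (simp add: sqsummable_def)
lift_definition norm_l2 :: "('a, 'b) l2 \<Rightarrow> real"
  is "\<lambda>f. sqrt (infsum (\<lambda>i. (norm (f i))\<^sup>2) UNIV)" .
lift_definition scaleR_l2 :: "real \<Rightarrow> ('a, 'b) l2 \<Rightarrow> ('a, 'b) l2"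
  is "\<lambda>r f i. r *\<^sub>R f i"
  unfolding scaleC_of_real[symmetric] by (rule sqsummable_scaleC)
definition dist_l2 :: "('a, 'b) l2 \<Rightarrow> ('a, 'b) l2 \<Rightarrow> real"
  where "dist_l2 x y = norm (x - y)"
definition sgn_l2 :: "('a, 'b) l2 \<Rightarrow> ('a, 'b) l2"
  where "sgn_l2 x = inverse (norm x) *\<^sub>R x"
definition uniformity_l2 :: "(('a, 'b) l2 \<times> ('a, 'b) l2) filter"
  where "uniformity_l2 = (INF e\<in>{0<..}. principal {(x, y). dist x y < e})"
definition open_l2 :: "('a, 'b) l2 set \<Rightarrow> bool"
  where "open_l2 U \<longleftrightarrow> (\<forall>x\<in>U. eventually (\<lambda>(x', y). x' = x \<longrightarrow> y \<in> U) uniformity)"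

instance
proof
  fix x y z :: "('a, 'b) l2" and r s :: real and U :: "('a, 'b) l2 set"
  show "x + y + z = x + (y + z)" by transfer (simp add: add.assoc)
  show "x + y = y + x" by transfer (simp add: add.commute)
  show "0 + x = x" by transfer simp
  show "- x + x = 0" by transfer simp
  show "x - y = x + - y" by transfer simp
  show "r *\<^sub>R (x + y) = r *\<^sub>R x + r *\<^sub>R y" by transfer (simp add: scaleR_add_right)
  show "(r + s) *\<^sub>R x = r *\<^sub>R x + s *\<^sub>R x" by transfer (simp add: scaleR_add_left)
  show "r *\<^sub>R s *\<^sub>R x = (r * s) *\<^sub>R x" by transfer simp
  show "1 *\<^sub>R x = x" by transfer simp
  show "dist x y = norm (x - y)" by (rule dist_l2_def)
  show "sgn x = inverse (norm x) *\<^sub>R x" by (rule sgn_l2_def)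
  show "uniformity = (INF e\<in>{0<..}. principal {(x, y :: ('a, 'b) l2). dist x y < e})"
    by (rule uniformity_l2_def)
  show "open U \<longleftrightarrow> (\<forall>x\<in>U. eventually (\<lambda>(x', y). x' = x \<longrightarrow> y \<in> U) uniformity)"
    by (rule open_l2_def)
  show "norm (x + y) \<le> norm x + norm y" by transfer (rule sqsummable_add_aux)
  show "norm (r *\<^sub>R x) = \<bar>r\<bar> * norm x"
  proof transfer
    fix r :: real and f :: "'a \<Rightarrow> 'b" assume "sqsummable f"
    then show "sqrt (infsum (\<lambda>i. (norm (r *\<^sub>R f i))\<^sup>2) UNIV)
        = \<bar>r\<bar> * sqrt (infsum (\<lambda>i. (norm (f i))\<^sup>2) UNIV)"
      by (simp add: power_mult_distrib infsum_cmult_right sqsummable_def real_sqrt_mult)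
  qed
  show "norm x = 0 \<longleftrightarrow> x = 0"
  proof transfer
    fix f :: "'a \<Rightarrow> 'b" assume f: "sqsummable f"
    show "sqrt (infsum (\<lambda>i. (norm (f i))\<^sup>2) UNIV) = 0 \<longleftrightarrow> f = (\<lambda>_. 0)"
    proof
      assume "sqrt (infsum (\<lambda>i. (norm (f i))\<^sup>2) UNIV) = 0"
      then have "(norm (f i))\<^sup>2 \<le> 0" for i
        using sqsummable_finite_le[OF f, of "{i}"] by simp
      then show "f = (\<lambda>_. 0)" by auto
    qed simp
  qed
qed

end

instantiation l2 :: (type, chilbert_space) chilbert_space
begin

lift_definition scaleC_l2 :: "complex \<Rightarrow> ('a, 'b) l2 \<Rightarrow> ('a, 'b) l2"
  is "\<lambda>a f i. a *\<^sub>C f i" by (rule sqsummable_scaleC)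
lift_definition cinner_l2 :: "('a, 'b) l2 \<Rightarrow> ('a, 'b) l2 \<Rightarrow> complex"
  is "\<lambda>f g. infsum (\<lambda>i. cinner (f i) (g i)) UNIV" .

instance
proof
  fix x y z :: "('a, 'b) l2" and a b :: complex and r :: real
  show "a *\<^sub>C (x + y) = a *\<^sub>C x + a *\<^sub>C y" by transfer (simp add: scaleC_add_right)
  show "(a + b) *\<^sub>C x = a *\<^sub>C x + b *\<^sub>C x" by transfer (simp add: scaleC_add_left)
  show "a *\<^sub>C b *\<^sub>C x = (a * b) *\<^sub>C x" by transfer (simp add: scaleC_scaleC)
  show "complex_of_real r *\<^sub>C x = r *\<^sub>R x" by transfer (simp add: scaleC_of_real)
  show "cinner x y = cnj (cinner y x)"
    by transfer (subst infsum_cnj[symmetric], subst cinner_commute, rule refl)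
  show "cinner (x + y) z = cinner x z + cinner y z"
    by transfer (auto simp: cinner_add_left intro!: infsum_add sqsummable_cinner)
  show "cinner (a *\<^sub>C x) y = a * cinner x y"
    by transfer (simp add: cinner_scaleC_left infsum_cmult_right sqsummable_cinner)
  show "cinner x x = complex_of_real ((norm x)\<^sup>2)"
  proof transfer
    fix f :: "'a \<Rightarrow> 'b" assume "sqsummable f"
    then have "(\<lambda>i. (norm (f i))\<^sup>2) summable_on UNIV" by (simp add: sqsummable_def)
    then have "infsum (\<lambda>i. complex_of_real ((norm (f i))\<^sup>2)) UNIV
        = complex_of_real (infsum (\<lambda>i. (norm (f i))\<^sup>2) UNIV)"
      by (intro infsumI has_sum_of_real has_sum_infsum)
    moreover have "infsum (\<lambda>i. (norm (f i))\<^sup>2) UNIV \<ge> 0" by (intro infsum_nonneg) auto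
    ultimately show "infsum (\<lambda>i. cinner (f i) (f i)) UNIV
        = complex_of_real ((sqrt (infsum (\<lambda>i. (norm (f i))\<^sup>2) UNIV))\<^sup>2)"
      by (simp only: cinner_self real_sqrt_pow2)
  qed
next
  fix X :: "nat \<Rightarrow> ('a, 'b) l2" assume C: "Cauchy X"
  have nth_le: "(\<Sum>i\<in>F. (norm (l2_nth x i))\<^sup>2) \<le> (norm x)\<^sup>2" if "finite F"
    for F and x :: "('a, 'b) l2"
  proof -
    have "(norm x)\<^sup>2 = infsum (\<lambda>i. (norm (l2_nth x i))\<^sup>2) UNIV"
      by (simp add: norm_l2.rep_eq infsum_nonneg)
    then show ?thesis using sqsummable_finite_le[OF sqsummable_l2_nth that, of x] by simp
  qed
  have Cd: "\<exists>N. \<forall>m\<ge>N. \<forall>n\<ge>N. norm (X m - X n) < e" if "e > 0" for e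
    using C that unfolding Cauchy_def dist_l2_def by blast
  have pt: "norm (l2_nth (X m) i - l2_nth (X n) i) \<le> norm (X m - X n)" for m n i
  proof -
    show ?thesis using nth_le[of "{i}" "X m - X n"]
      by (simp add: minus_l2.rep_eq power2_le_iff_abs_le)
  qed
  have "convergent (\<lambda>n. l2_nth (X n) i)" for i
  proof (rule Cauchy_convergent, unfold Cauchy_def dist_norm, intro allI impI)
    fix e :: real assume "e > 0"
    with Cd obtain N where "\<forall>m\<ge>N. \<forall>n\<ge>N. norm (X m - X n) < e" by blast
    then show "\<exists>M. \<forall>m\<ge>M. \<forall>n\<ge>M. norm (l2_nth (X m) i - l2_nth (X n) i) < e"
      using pt by (meson le_less_trans)
  qed
  then obtain g where g: "(\<lambda>n. l2_nth (X n) i) \<longlonglongrightarrow> g i" for i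
    unfolding convergent_def by metis
  have lim: "(\<Sum>i\<in>F. (norm (g i - l2_nth (X n) i))\<^sup>2) \<le> e\<^sup>2"
    if N: "\<forall>m\<ge>N. \<forall>n\<ge>N. norm (X m - X n) < e" and n: "n \<ge> N" and F: "finite F" for N n e F
  proof (rule LIMSEQ_le_const2)
    show "(\<lambda>m. \<Sum>i\<in>F. (norm (l2_nth (X m) i - l2_nth (X n) i))\<^sup>2)
        \<longlonglongrightarrow> (\<Sum>i\<in>F. (norm (g i - l2_nth (X n) i))\<^sup>2)"
      by (intro tendsto_intros g)
    have "(\<Sum>i\<in>F. (norm (l2_nth (X m) i - l2_nth (X n) i))\<^sup>2) \<le> e\<^sup>2" if "m \<ge> N" for m
    proof -
      have "(\<Sum>i\<in>F. (norm (l2_nth (X m) i - l2_nth (X n) i))\<^sup>2) \<le> (norm (X m - X n))\<^sup>2"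
        using nth_le[OF F, of "X m - X n"] by (simp add: minus_l2.rep_eq)
      also have "\<dots> \<le> e\<^sup>2"
        using N n that by (intro power_mono) (auto intro: less_imp_le)
      finally show ?thesis .
    qed
    then show "\<exists>M. \<forall>m\<ge>M. (\<Sum>i\<in>F. (norm (l2_nth (X m) i - l2_nth (X n) i))\<^sup>2) \<le> e\<^sup>2"
      by blast
  qed
  obtain N1 where N1: "\<forall>m\<ge>N1. \<forall>n\<ge>N1. norm (X m - X n) < 1" using Cd[of 1] by auto
  have "sqsummable (\<lambda>i. g i - l2_nth (X N1) i)"
    using lim[OF N1 order_refl] by (rule sqsummable_bound)
  from sqsummable_add_aux(1)[OF this sqsummable_l2_nth[of "X N1"]]
  have sg: "sqsummable g" by simp
  define L where "L = Abs_l2 g"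
  have L: "l2_nth L = g" unfolding L_def using sg by (simp add: Abs_l2_inverse)
  have "X \<longlonglongrightarrow> L"
  proof (rule metric_LIMSEQ_I)
    fix r :: real assume r: "r > 0"
    then obtain N where N: "\<forall>m\<ge>N. \<forall>n\<ge>N. norm (X m - X n) < r / 2" using Cd[of "r / 2"] by auto
    have "dist (X n) L < r" if "n \<ge> N" for n
    proof -
      have "infsum (\<lambda>i. (norm (g i - l2_nth (X n) i))\<^sup>2) UNIV \<le> (r / 2)\<^sup>2"
        using lim[OF N that] by (rule sqsummable_bound)
      then have "dist (X n) L \<le> sqrt ((r / 2)\<^sup>2)"
        unfolding dist_l2_def norm_l2.rep_eq minus_l2.rep_eq L
        by (subst norm_minus_commute) (simp only: real_sqrt_le_iff)
      also have "\<dots> < r" using r by simp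
      finally show ?thesis .
    qed
    then show "\<exists>N. \<forall>n\<ge>N. dist (X n) L < r" by blast
  qed
  then show "convergent X" by (rule convergentI)
qed

end

section \<open>Subspaces, projections and Hilbert space dimension\<close>

definition cspan :: "'a :: chilbert_space set \<Rightarrow> 'a set"
  where "cspan S = {(\<Sum>x\<in>F. c x *\<^sub>C x) |F c. finite F \<and> F \<subseteq> S}"

definition ccspan :: "'a :: chilbert_space set \<Rightarrow> 'a set"
  where "ccspan S = closure (cspan S)"

definition closed_csubspace :: "'a :: chilbert_space set \<Rightarrow> bool"
  where "closed_csubspace M \<longleftrightarrow>
    0 \<in> M \<and> (\<forall>x\<in>M. \<forall>y\<in>M. x + y \<in> M) \<and> (\<forall>c. \<forall>x\<in>M. c *\<^sub>C x \<in> M) \<and> closed M"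

definition ortho :: "'a :: chilbert_space set \<Rightarrow> 'a set"
  where "ortho S = {x. \<forall>y\<in>S. cinner x y = 0}"

definition proj :: "'a :: chilbert_space set \<Rightarrow> 'a \<Rightarrow> 'a"
  where "proj M x = (THE p. p \<in> M \<and> x - p \<in> ortho M)"

definition is_onb :: "'a :: chilbert_space set \<Rightarrow> 'a set \<Rightarrow> bool"
  where "is_onb M B \<longleftrightarrow>
    (\<forall>x\<in>B. norm x = 1) \<and> (\<forall>x\<in>B. \<forall>y\<in>B. x \<noteq> y \<longrightarrow> cinner x y = 0) \<and> ccspan B = M"

text \<open>The Hilbert space dimension is a cardinal, to be compared by \<open>ordLeq\<close> and \<open>ordIso\<close>.\<close>

definition hdim :: "'a :: chilbert_space set \<Rightarrow> 'a rel"
  where "hdim M = card_of (SOME B. is_onb M B)"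

section \<open>Bounded operators\<close>

definition bounded_clinear :: "('a :: chilbert_space \<Rightarrow> 'b :: chilbert_space) \<Rightarrow> bool"
  where "bounded_clinear A \<longleftrightarrow> bounded_linear A \<and> (\<forall>c x. A (c *\<^sub>C x) = c *\<^sub>C A x)"

definition cadj :: "('a :: chilbert_space \<Rightarrow> 'b :: chilbert_space) \<Rightarrow> 'b \<Rightarrow> 'a"
  where "cadj A = (THE B. bounded_clinear B \<and> (\<forall>x y. cinner (A x) y = cinner x (B y)))"

definition pos_op :: "('a :: chilbert_space \<Rightarrow> 'a) \<Rightarrow> bool"
  where "pos_op A \<longleftrightarrow> bounded_clinear A \<and> (\<forall>x. cinner (A x) x \<in> \<real> \<and> 0 \<le> Re (cinner (A x) x))"

definition op_sqrt :: "('a :: chilbert_space \<Rightarrow> 'a) \<Rightarrow> 'a \<Rightarrow> 'a"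
  where "op_sqrt A = (THE R. pos_op R \<and> R \<circ> R = A)"

definition isometry_on ::
    "'a :: chilbert_space set \<Rightarrow> ('a \<Rightarrow> 'b :: chilbert_space) \<Rightarrow> bool"
  where "isometry_on M V \<longleftrightarrow>
    (\<forall>x\<in>M. \<forall>y\<in>M. V (x + y) = V x + V y) \<and> (\<forall>c. \<forall>x\<in>M. V (c *\<^sub>C x) = c *\<^sub>C V x) \<and>
    (\<forall>x\<in>M. norm (V x) = norm x)"

definition unitary_between ::
    "'a :: chilbert_space set \<Rightarrow> 'b :: chilbert_space set \<Rightarrow> ('a \<Rightarrow> 'b) \<Rightarrow> bool"
  where "unitary_between M N U \<longleftrightarrow> isometry_on M U \<and> U ` M = N"

definition wot :: "('a :: chilbert_space \<Rightarrow> 'b :: chilbert_space) topology"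
  where "wot = pullback_topology {A. bounded_clinear A} (\<lambda>A (x, y). cinner (A x) y) euclidean"

definition op_algebra :: "('a :: chilbert_space \<Rightarrow> 'a) set \<Rightarrow> bool"
  where "op_algebra \<A> \<longleftrightarrow>
    (\<forall>A\<in>\<A>. bounded_clinear A) \<and> (\<lambda>_. 0) \<in> \<A> \<and>
    (\<forall>A\<in>\<A>. \<forall>B\<in>\<A>. (\<lambda>x. A x + B x) \<in> \<A>) \<and> (\<forall>c. \<forall>A\<in>\<A>. (\<lambda>x. c *\<^sub>C A x) \<in> \<A>) \<and>
    (\<forall>A\<in>\<A>. \<forall>B\<in>\<A>. A \<circ> B \<in> \<A>)"

definition op_norm_closure ::
    "('a :: chilbert_space \<Rightarrow> 'b :: chilbert_space) set \<Rightarrow> ('a \<Rightarrow> 'b) set"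
  where "op_norm_closure \<A> =
    {X. bounded_clinear X \<and> (\<forall>e>0. \<exists>A\<in>\<A>. onorm (\<lambda>x. X x - A x) < e)}"

definition op_cspan ::
    "('a :: chilbert_space \<Rightarrow> 'b :: chilbert_space) set \<Rightarrow> ('a \<Rightarrow> 'b) set"
  where "op_cspan \<G> = {(\<lambda>x. \<Sum>A\<in>F. c A *\<^sub>C A x) |F c. finite F \<and> F \<subseteq> \<G>}"

definition cstar_generated ::
    "('a :: chilbert_space \<Rightarrow> 'a) set \<Rightarrow> ('a \<Rightarrow> 'a) set"
  where "cstar_generated \<G> =
    \<Inter>{\<A>. op_algebra \<A> \<and> (\<forall>A\<in>\<A>. cadj A \<in> \<A>) \<and> op_norm_closure \<A> \<subseteq> \<A> \<and> \<G> \<subseteq> \<A>}"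

definition compress ::
    "'a :: chilbert_space set \<Rightarrow> ('n \<Rightarrow> 'a \<Rightarrow> 'a) \<Rightarrow> 'n \<Rightarrow> 'a \<Rightarrow> 'a"
  where "compress M X i x = proj M (X i x)"

definition coinvariant :: "'a :: chilbert_space set \<Rightarrow> ('n \<Rightarrow> 'a \<Rightarrow> 'a) \<Rightarrow> bool"
  where "coinvariant M X \<longleftrightarrow> (\<forall>i. \<forall>x\<in>M. cadj (X i) x \<in> M)"

text \<open>Elements of the free semigroup on \<open>'n\<close> are words of type \<open>'n list\<close>, so that \<open>n = CARD('n)\<close>;
  the neutral element is the empty word.\<close>

primrec opword :: "('n \<Rightarrow> 'a \<Rightarrow> 'a) \<Rightarrow> 'n list \<Rightarrow> 'a \<Rightarrow> 'a"
  where "opword X [] = id"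
  | "opword X (i # \<alpha>) = X i \<circ> opword X \<alpha>"

section \<open>Full Fock space and tensor products\<close>

text \<open>The vectors \<open>e\<^sub>\<alpha>\<close> form an orthonormal basis of the full Fock space, indexed by words; the Fock
  space is identified with the square-summable complex families on words in this way.\<close>

type_synonym 'n fock = "('n list, complex) l2"

lift_definition ket :: "'i \<Rightarrow> ('i, complex) l2" is "\<lambda>i j. if j = i then 1 else 0"
proof -
  fix i :: 'i
  have "(\<lambda>j. (cmod (if j = i then 1 else 0))\<^sup>2) summable_on {i}" by simp
  then show "sqsummable (\<lambda>j. if j = i then 1 else 0 :: complex)"
    unfolding sqsummable_def by (rule summable_on_cong_neutral[THEN iffD1, rotated -1]) auto
qed

text \<open>Left creation: the coefficient of \<open>e\<^sub>i \<otimes> \<phi>\<close> at \<open>i # \<beta>\<close> is that of \<open>\<phi>\<close> at \<open>\<beta>\<close>, and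
  all other coefficients vanish.\<close>

lift_definition creation :: "'n \<Rightarrow> 'n fock \<Rightarrow> 'n fock"
  is "\<lambda>i f \<alpha>. case \<alpha> of [] \<Rightarrow> 0 | j # \<beta> \<Rightarrow> if j = i then f \<beta> else 0"
proof -
  fix i :: 'n and f :: "'n list \<Rightarrow> complex" assume "sqsummable f"
  then have "((\<lambda>\<alpha>. (cmod (case \<alpha> of [] \<Rightarrow> 0 | j # \<beta> \<Rightarrow> if j = i then f \<beta> else 0))\<^sup>2) \<circ> (#) i)
      summable_on UNIV"
    by (simp add: sqsummable_def o_def)
  then have "(\<lambda>\<alpha>. (cmod (case \<alpha> of [] \<Rightarrow> 0 | j # \<beta> \<Rightarrow> if j = i then f \<beta> else 0))\<^sup>2)
      summable_on range ((#) i)"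
    by (subst summable_on_reindex) (auto simp: inj_on_def)
  then show "sqsummable (\<lambda>\<alpha>. case \<alpha> of [] \<Rightarrow> 0 | j # \<beta> \<Rightarrow> if j = i then f \<beta> else 0)"
    unfolding sqsummable_def
    by (rule summable_on_cong_neutral[THEN iffD1, rotated -1]) (auto split: list.splits if_splits)
qed

lift_definition tens ::
    "('i, complex) l2 \<Rightarrow> 'd :: chilbert_space \<Rightarrow> ('i, 'd) l2" (infixr "\<otimes>\<^sub>h" 70)
  is "\<lambda>f d i. f i *\<^sub>C d"
  by (auto simp: sqsummable_def norm_scaleC power_mult_distrib intro: summable_on_cmult_left)

lemma creation_ket: "creation i (ket \<alpha>) = ket (i # \<alpha>)"
  by transfer (auto simp: fun_eq_iff split: list.splits)

lemma cinner_tens: "cinner (x \<otimes>\<^sub>h c) (y \<otimes>\<^sub>h d) = cinner x y * cinner c d"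
proof -
  have "(\<lambda>i. cinner (l2_nth x i) (l2_nth y i)) summable_on UNIV"
    by (intro sqsummable_cinner sqsummable_l2_nth)
  moreover have "cinner (l2_nth x i *\<^sub>C c) (l2_nth y i *\<^sub>C d)
      = cinner (l2_nth x i) (l2_nth y i) * cinner c d" for i
    by (simp add: cinner_scaleC_left cinner_scaleC_right) (simp add: cinner_complex_def)
  ultimately show ?thesis
    by (simp add: cinner_l2.rep_eq tens.rep_eq infsum_cmult_left)
qed

lemma l2_nth_sum: "l2_nth (sum g F) j = (\<Sum>i\<in>F. l2_nth (g i) j)"
  by (induction F rule: infinite_finite_induct) (auto simp: zero_l2.rep_eq plus_l2.rep_eq)

lemma l2_nth_ket_tens: "l2_nth (ket i \<otimes>\<^sub>h d) j = (if j = i then d else 0)"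
  by (simp add: tens.rep_eq ket.rep_eq)

lemma has_sum_ket_tens: "((\<lambda>i. ket i \<otimes>\<^sub>h l2_nth x i) has_sum x) UNIV"
  unfolding has_sum_def
proof (rule tendstoI)
  fix e :: real assume e: "e > 0"
  let ?q = "\<lambda>i. (norm (l2_nth x i))\<^sup>2"
  have sm: "?q summable_on UNIV" using sqsummable_l2_nth[of x] by (simp add: sqsummable_def)
  then have "(sum ?q \<longlongrightarrow> infsum ?q UNIV) (finite_subsets_at_top UNIV)"
    using has_sum_infsum has_sum_def by blast
  then have "\<forall>\<^sub>F F in finite_subsets_at_top UNIV. dist (sum ?q F) (infsum ?q UNIV) < e\<^sup>2"
    using e by (intro tendstoD) auto
  moreover have "\<forall>\<^sub>F F :: 'a set in finite_subsets_at_top UNIV. finite F"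
    by (rule eventually_finite_subsets_at_top_weakI) auto
  ultimately show "\<forall>\<^sub>F F in finite_subsets_at_top UNIV.
      dist (\<Sum>i\<in>F. ket i \<otimes>\<^sub>h l2_nth x i) x < e"
  proof eventually_elim
    case (elim F)
    have nth: "l2_nth (x - (\<Sum>i\<in>F. ket i \<otimes>\<^sub>h l2_nth x i)) j = (if j \<in> F then 0 else l2_nth x j)"
      for j
      using elim(2) by (simp add: minus_l2.rep_eq l2_nth_sum l2_nth_ket_tens)
    have "(norm (x - (\<Sum>i\<in>F. ket i \<otimes>\<^sub>h l2_nth x i)))\<^sup>2
        = infsum (\<lambda>j. (norm (if j \<in> F then 0 else l2_nth x j))\<^sup>2) UNIV"
      by (simp add: norm_l2.rep_eq nth infsum_nonneg)
    also have "\<dots> = infsum ?q (- F)" by (rule infsum_cong_neutral) auto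
    also have "\<dots> = infsum ?q UNIV - infsum ?q F"
      unfolding Compl_eq_Diff_UNIV using elim(2) by (intro infsum_Diff sm) auto
    also have "\<dots> < e\<^sup>2" using elim by (simp add: dist_real_def)
    finally show ?case
      using e by (simp add: dist_norm norm_minus_commute power2_less_imp_less)
  qed
qed

lemma ccspan_tens: "ccspan {x \<otimes>\<^sub>h d |x d. True} = UNIV"
proof -
  have "x \<in> closure (cspan {x \<otimes>\<^sub>h d |x d. True})" for x :: "('i, 'd :: chilbert_space) l2"
  proof (rule Lim_in_closed_set)
    show "((\<lambda>F. \<Sum>i\<in>F. ket i \<otimes>\<^sub>h l2_nth x i) \<longlongrightarrow> x) (finite_subsets_at_top UNIV)"
      using has_sum_ket_tens[of x] unfolding has_sum_def .
    have "(\<Sum>i\<in>F. ket i \<otimes>\<^sub>h l2_nth x i) \<in> cspan {x \<otimes>\<^sub>h d |x d. True}" (is "?s \<in> _")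
      if F: "finite F" for F
    proof -
      let ?G = "(\<lambda>i. ket i \<otimes>\<^sub>h l2_nth x i) ` {i \<in> F. l2_nth x i \<noteq> 0}"
      have "inj_on (\<lambda>i. ket i \<otimes>\<^sub>h l2_nth x i) {i \<in> F. l2_nth x i \<noteq> 0}"
        by (rule inj_onI) (metis (mono_tags, lifting) l2_nth_ket_tens mem_Collect_eq)
      then have "(\<Sum>y\<in>?G. 1 *\<^sub>C y) = (\<Sum>i\<in>{i \<in> F. l2_nth x i \<noteq> 0}. ket i \<otimes>\<^sub>h l2_nth x i)"
        by (simp add: sum.reindex)
      also have "\<dots> = ?s"
        by (rule sum.mono_neutral_left) (use F in \<open>auto simp: l2_nth_inject[symmetric]
            l2_nth_ket_tens zero_l2.rep_eq fun_eq_iff\<close>)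
      finally show ?thesis
        unfolding cspan_def using F
        by (intro CollectI exI[of _ ?G] exI[of _ "\<lambda>_. 1"]) auto
    qed
    then show "\<forall>\<^sub>F F in finite_subsets_at_top UNIV.
        (\<Sum>i\<in>F. ket i \<otimes>\<^sub>h l2_nth x i) \<in> closure (cspan {x \<otimes>\<^sub>h d |x d. True})"
      by (intro eventually_finite_subsets_at_top_weakI subsetD[OF closure_subset]) auto
  qed auto
  then show ?thesis unfolding ccspan_def by blast
qed

text \<open>The tensor product of a closed subspace of \<open>('i, complex) l2\<close> and a closed subspace of \<open>'d\<close>.\<close>

definition htens ::
    "('i, complex) l2 set \<Rightarrow> 'd :: chilbert_space set \<Rightarrow> ('i, 'd) l2 set"
  where "htens M D = ccspan {x \<otimes>\<^sub>h d |x d. x \<in> M \<and> d \<in> D}"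

text \<open>The operator \<open>A \<otimes> I\<close>.\<close>

definition ampl ::
    "(('i, complex) l2 \<Rightarrow> ('i, complex) l2) \<Rightarrow> ('i, 'd :: chilbert_space) l2 \<Rightarrow> ('i, 'd) l2"
  where "ampl A = (THE X. bounded_clinear X \<and> (\<forall>x d. X (x \<otimes>\<^sub>h d) = A x \<otimes>\<^sub>h d))"

section \<open>The noncommutative analytic Toeplitz algebra and its ideals\<close>

definition Finf :: "('n fock \<Rightarrow> 'n fock) set"
  where "Finf = \<Inter>{\<A>. op_algebra \<A> \<and> closedin wot \<A> \<and> id \<in> \<A> \<and> range creation \<subseteq> \<A>}"

definition wot_closed_ideal :: "('n fock \<Rightarrow> 'n fock) set \<Rightarrow> bool"
  where "wot_closed_ideal J \<longleftrightarrow>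
    J \<subseteq> Finf \<and> (\<lambda>_. 0) \<in> J \<and>
    (\<forall>f\<in>J. \<forall>g\<in>J. (\<lambda>x. f x + g x) \<in> J) \<and> (\<forall>c. \<forall>f\<in>J. (\<lambda>x. c *\<^sub>C f x) \<in> J) \<and>
    (\<forall>f\<in>Finf. \<forall>g\<in>J. f \<circ> g \<in> J \<and> g \<circ> f \<in> J) \<and> closedin wot J"

definition NJ :: "('n fock \<Rightarrow> 'n fock) set \<Rightarrow> 'n fock set"
  where "NJ J = ortho (ccspan {f \<phi> |f \<phi>. f \<in> J})"

text \<open>Operators on \<open>NJ J\<close> are represented by their extensions to the Fock space that vanish on the
  orthogonal complement of \<open>NJ J\<close>. This identifies the bounded operators on \<open>NJ J\<close>, with their
  norm and adjoints, with a corner of those on the Fock space, whose unit is \<open>proj (NJ J)\<close>.\<close>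

definition Bop :: "('n fock \<Rightarrow> 'n fock) set \<Rightarrow> 'n \<Rightarrow> 'n fock \<Rightarrow> 'n fock"
  where "Bop J i = proj (NJ J) \<circ> creation i \<circ> proj (NJ J)"

definition Bword :: "('n fock \<Rightarrow> 'n fock) set \<Rightarrow> 'n list \<Rightarrow> 'n fock \<Rightarrow> 'n fock"
  where "Bword J \<alpha> = opword (Bop J) \<alpha> \<circ> proj (NJ J)"

definition cstar_B :: "('n fock \<Rightarrow> 'n fock) set \<Rightarrow> ('n fock \<Rightarrow> 'n fock) set"
  where "cstar_B J = cstar_generated (insert (proj (NJ J)) (range (Bop J)))"

definition span_BB :: "('n fock \<Rightarrow> 'n fock) set \<Rightarrow> ('n fock \<Rightarrow> 'n fock) set"
  where "span_BB J = op_norm_closure (op_cspan {Bword J \<alpha> \<circ> cadj (Bword J \<beta>) |\<alpha> \<beta>. True})"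

section \<open>Row contractions\<close>

definition defect_sq :: "('n :: finite \<Rightarrow> 'h :: chilbert_space \<Rightarrow> 'h) \<Rightarrow> 'h \<Rightarrow> 'h"
  where "defect_sq T x = x - (\<Sum>i\<in>UNIV. T i (cadj (T i) x))"

definition row_contraction :: "('n :: finite \<Rightarrow> 'h :: chilbert_space \<Rightarrow> 'h) \<Rightarrow> bool"
  where "row_contraction T \<longleftrightarrow> (\<forall>i. bounded_clinear (T i)) \<and> pos_op (defect_sq T)"

definition pure_row_contraction :: "('n :: finite \<Rightarrow> 'h :: chilbert_space \<Rightarrow> 'h) \<Rightarrow> bool"
  where "pure_row_contraction T \<longleftrightarrow> row_contraction T \<and>
    (\<forall>h. (\<lambda>k. \<Sum>\<alpha> | length \<alpha> = k. opword T \<alpha> (cadj (opword T \<alpha>) h)) \<longlonglongrightarrow> 0)"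

definition defect :: "('n :: finite \<Rightarrow> 'h :: chilbert_space \<Rightarrow> 'h) \<Rightarrow> 'h \<Rightarrow> 'h"
  where "defect T = op_sqrt (defect_sq T)"

definition defect_space :: "('n :: finite \<Rightarrow> 'h :: chilbert_space \<Rightarrow> 'h) \<Rightarrow> 'h set"
  where "defect_space T = closure (range (defect T))"

text \<open>\<open>fcalc f T\<close> is \<open>f(T\<^sub>1, \<dots>, T\<^sub>n)\<close>; the coefficient of \<open>f(1)\<close> at \<open>e\<^sub>\<alpha>\<close> is
  \<open>l2_nth (f (ket [])) \<alpha>\<close>. The limit in the strong operator topology is taken pointwise.\<close>

definition fcalc ::
    "('n :: finite fock \<Rightarrow> 'n fock) \<Rightarrow> ('n \<Rightarrow> 'h :: chilbert_space \<Rightarrow> 'h) \<Rightarrow> 'h \<Rightarrow> 'h"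
  where "fcalc f T h = Lim (at_left (1 :: real)) (\<lambda>r. \<Sum>k. \<Sum>\<alpha> | length \<alpha> = k.
    (complex_of_real r ^ length \<alpha> * l2_nth (f (ket [])) \<alpha>) *\<^sub>C opword T \<alpha> h)"

text \<open>The set \<open>M\<close> is the Hilbert space on which \<open>X\<close> acts.\<close>

definition constrained_on ::
    "'h :: chilbert_space set \<Rightarrow> ('n :: finite fock \<Rightarrow> 'n fock) set \<Rightarrow> ('n \<Rightarrow> 'h \<Rightarrow> 'h) \<Rightarrow> bool"
  where "constrained_on M J X \<longleftrightarrow> (\<forall>f\<in>J. \<forall>h\<in>M. fcalc f X h = 0)"

definition poisson_kernel ::
    "('n :: finite \<Rightarrow> 'h :: chilbert_space \<Rightarrow> 'h) \<Rightarrow> 'h \<Rightarrow> ('n list, 'h) l2"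
  where "poisson_kernel T h = (\<Sum>\<^sub>\<infinity>\<alpha>. ket \<alpha> \<otimes>\<^sub>h defect T (cadj (opword T \<alpha>) h))"

definition constrained_kernel ::
    "('n :: finite fock \<Rightarrow> 'n fock) set \<Rightarrow> ('n \<Rightarrow> 'h :: chilbert_space \<Rightarrow> 'h) \<Rightarrow> 'h \<Rightarrow> ('n list, 'h) l2"
  where "constrained_kernel J T h = ampl (proj (NJ J)) (poisson_kernel T h)"

section \<open>Constrained dilations\<close>

definition dilation ::
    "('n :: finite fock \<Rightarrow> 'n fock) set \<Rightarrow> ('n \<Rightarrow> 'h :: chilbert_space \<Rightarrow> 'h) \<Rightarrow>
      'd :: chilbert_space set \<Rightarrow> ('h \<Rightarrow> ('n list, 'd) l2) \<Rightarrow> bool"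
  where "dilation J T D V \<longleftrightarrow>
    isometry_on UNIV V \<and> range V \<subseteq> htens (NJ J) D \<and>
    coinvariant (range V) (\<lambda>i. ampl (Bop J i)) \<and>
    (\<forall>i h. T i h = cadj V (ampl (Bop J i) (V h)))"

definition minimal_for ::
    "('n :: finite fock \<Rightarrow> 'n fock) set \<Rightarrow> 'd :: chilbert_space set \<Rightarrow>
      ('h :: chilbert_space \<Rightarrow> ('n list, 'd) l2) \<Rightarrow> bool"
  where "minimal_for J D V \<longleftrightarrow>
    ccspan (\<Union>\<alpha>. ampl (Bword J \<alpha>) ` range V) = htens (NJ J) D"

text \<open>\<open>\<kappa>\<close> is the minimum of \<open>dim D\<close> over all Hilbert spaces \<open>D\<close> admitting a dilation. A definition
  cannot range over all types, so the type \<open>'d\<close> in which the lower bound is tested is a parameter; it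
  is to be left arbitrary, every Hilbert space being a closed subspace of some \<open>'d\<close>. Attainment is
  required inside the fixed type \<open>'h\<close>.\<close>

definition is_dil_ind ::
    "'d :: chilbert_space itself \<Rightarrow> ('n :: finite fock \<Rightarrow> 'n fock) set \<Rightarrow>
      ('n \<Rightarrow> 'h :: chilbert_space \<Rightarrow> 'h) \<Rightarrow> 'k rel \<Rightarrow> bool"
  where "is_dil_ind _ J T \<kappa> \<longleftrightarrow>
    (\<exists>D :: 'h set. closed_csubspace D \<and> (\<exists>V. dilation J T D V) \<and> (hdim D, \<kappa>) \<in> ordIso) \<and>
    (\<forall>D :: 'd set. closed_csubspace D \<and> (\<exists>V. dilation J T D V) \<longrightarrow> (\<kappa>, hdim D) \<in> ordLeq)"

text \<open>The space of the maximal constrained piece of \<open>X\<close>, where \<open>X\<close> acts on \<open>E\<close>.\<close>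

definition max_piece_space ::
    "'h :: chilbert_space set \<Rightarrow> ('n :: finite fock \<Rightarrow> 'n fock) set \<Rightarrow> ('n \<Rightarrow> 'h \<Rightarrow> 'h) \<Rightarrow> 'h set"
  where "max_piece_space E J X = ccspan (\<Union>{M. closed_csubspace M \<and> M \<subseteq> E \<and>
    coinvariant M X \<and> constrained_on M J (compress M X)})"

text \<open>\<open>Cm m\<close> is the Hilbert space of dimension \<open>m\<close>, inside the square-summable sequences.\<close>

definition Cm :: "enat \<Rightarrow> (nat, complex) l2 set"
  where "Cm m = {x. \<forall>i. m \<le> enat i \<longrightarrow> l2_nth x i = 0}"

definition has_hdim :: "'a :: chilbert_space set \<Rightarrow> enat \<Rightarrow> bool"
  where "has_hdim M m \<longleftrightarrow> (hdim M, card_of {i :: nat. enat i < m}) \<in> ordIso"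

end

theory Submission
  imports Defs
begin

text \<open>
  The Poisson kernel \<open>K\<close> intertwines the adjoints of \<open>T\<^sub>i\<close> and \<open>S\<^sub>i \<otimes> I\<close>, so its range is a
  co-invariant subspace of the amplified Fock space, and a co-invariant subspace on which the
  compressed functional calculus kills \<open>J\<close> lies in \<open>N\<^sub>J \<otimes> D\<close>. This gives both the dilation and the
  maximality of \<open>N\<^sub>J \<otimes> D\<close>. It rests on the strong convergence of the Abel means of \<open>f \<otimes> I\<close> to
  \<open>f \<otimes> I\<close> for \<open>f \<in> F\<^sup>\<infinity>\<close>: they are Schur multiples of \<open>f \<otimes> I\<close> by the positive
  definite kernel \<open>r\<^bsup>\<bar>i - j\<bar>\<^esup>\<close>, hence uniformly bounded.

  For any dilation \<open>V\<close>, the norm of \<open>\<Delta>\<^sub>T h\<close> is that of the vacuum component of \<open>V h\<close>, because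
  \<open>I - \<Sum> S\<^sub>i S\<^sub>i\<^sup>*\<close> is the projection onto the vacuum. Hence the defect space embeds
  isometrically into \<open>D\<close>; this settles the dilation index and the rank characterization.
  Uniqueness holds because \<open>V\<^sup>*(B\<^sub>\<alpha> B\<^sub>\<beta>\<^sup>* \<otimes> I)V = T\<^sub>\<alpha> T\<^sub>\<beta>\<^sup>*\<close> does not depend on \<open>V\<close>, and under the
  hypothesis on the \<open>C\<^sup>*\<close>-algebra these operators determine all \<open>V\<^sup>*(B\<^sub>\<beta>\<^sup>* B\<^sub>\<alpha> \<otimes> I)V\<close>, that is,
  the Gram matrix of the vectors \<open>(B\<^sub>\<alpha> \<otimes> I)V h\<close>.
\<close>

section \<open>Inner products, spans and projections\<close>

text \<open>An element of \<open>Finf\<close> is known only through the closure properties of the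
  algebra, not as a limit of explicit polynomials. What survives WOT closure is commutation with
  right creation, and this makes \<open>f \<otimes> I\<close> a finite convolution in every
  coordinate: its value at \<gamma> involves only the splittings of \<gamma> into prefix and suffix.
  The Abel mean is the same convolution damped by \<open>r ^ k\<close>. The coefficients of
  \<open>f\<close> control each mean for fixed r < 1 but give no bound as r tends to 1; this is the
  gap that the Schur multiplier closes. Tensor statements are tested on slices, the images under
  pairing the second factor with a fixed vector: on a slice, \<open>A \<otimes> I\<close> acts as A,
  and membership in N_J \<otimes> D splits into a condition on slices and one on coordinates. The
  unitaries between closed subspaces come from a single construction, which extends a correspondence
  between two families with equal Gram matrices. It yields the embedding of the defect space, the
  identification of spaces of equal dimension and the intertwiner of two minimal dilations.\<close>

interpretation cinner: bounded_bilinear "cinner :: 'a \<Rightarrow> 'a :: chilbert_space \<Rightarrow> complex"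
proof
  fix x x' y y' :: 'a and r :: real
  show "cinner (x + x') y = cinner x y + cinner x' y" by (rule cinner_add_left)
  show "cinner x (y + y') = cinner x y + cinner x y'" by (rule cinner_add_right)
  show "cinner (r *\<^sub>R x) y = r *\<^sub>R cinner x y"
    using cinner_scaleC_left[of "complex_of_real r" x y]
    by (simp add: scaleC_of_real scaleR_conv_of_real)
  show "cinner x (r *\<^sub>R y) = r *\<^sub>R cinner x y"
    using cinner_scaleC_right[of x "complex_of_real r" y]
    by (simp add: scaleC_of_real scaleR_conv_of_real)
  show "\<exists>K. \<forall>x y :: 'a. norm (cinner x y) \<le> norm x * norm y * K"
    by (rule exI[of _ 1]) (simp add: cmod_cinner_le)
qed

interpretation scaleC: bounded_bilinear "scaleC :: complex \<Rightarrow> 'a \<Rightarrow> 'a :: chilbert_space"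
proof
  fix x x' :: 'a and a a' :: complex and r :: real
  show "(a + a') *\<^sub>C x = a *\<^sub>C x + a' *\<^sub>C x" by (rule scaleC_add_left)
  show "a *\<^sub>C (x + x') = a *\<^sub>C x + a *\<^sub>C x'" by (rule scaleC_add_right)
  show "(r *\<^sub>R a) *\<^sub>C x = r *\<^sub>R (a *\<^sub>C x)"
    by (metis scaleC_of_real scaleC_scaleC scaleR_conv_of_real)
  show "a *\<^sub>C (r *\<^sub>R x) = r *\<^sub>R (a *\<^sub>C x)"
    by (simp add: scaleC_of_real[symmetric] scaleC_scaleC mult.commute)
  show "\<exists>K. \<forall>a (x :: 'a). norm (a *\<^sub>C x) \<le> norm a * norm x * K"
    by (rule exI[of _ 1]) (simp add: norm_scaleC)
qed

interpretation cvs: vector_space "scaleC :: complex \<Rightarrow> 'a \<Rightarrow> 'a :: chilbert_space"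
  by standard (simp_all add: scaleC_add_left scaleC_add_right scaleC_scaleC)

lemma norm_sq_cinner: "(norm (x :: 'a :: chilbert_space))\<^sup>2 = Re (cinner x x)"
  by (simp add: cinner_self)

lemma cinner_eq_0_self: "cinner x x = 0 \<longleftrightarrow> x = (0 :: 'a :: chilbert_space)"
  by (simp add: cinner_self)

lemma cinner_eq_0_commute: "cinner x y = 0 \<longleftrightarrow> cinner y x = 0"
  by (metis cinner_commute complex_cnj_zero)

lemma cinner_ext: "(\<And>z. cinner x z = cinner y z) \<Longrightarrow> x = (y :: 'a :: chilbert_space)"
  using cinner_eq_0_self[of "x - y"] by (simp add: cinner.diff_left)

lemma norm_sq_add:
  "(norm (x + y :: 'a :: chilbert_space))\<^sup>2 = (norm x)\<^sup>2 + (norm y)\<^sup>2 + 2 * Re (cinner x y)"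
proof -
  have "Re (cinner y x) = Re (cinner x y)" by (subst cinner_commute) simp
  then show ?thesis by (simp add: norm_sq_cinner cinner.add_left cinner.add_right)
qed

lemma norm_sq_diff:
  "(norm (x - y :: 'a :: chilbert_space))\<^sup>2 = (norm x)\<^sup>2 + (norm y)\<^sup>2 - 2 * Re (cinner x y)"
  using norm_sq_add[of x "- y"] by (simp add: cinner.minus_right)

lemma norm_sq_add_orth:
  "cinner x y = 0 \<Longrightarrow> (norm (x + y :: 'a :: chilbert_space))\<^sup>2 = (norm x)\<^sup>2 + (norm y)\<^sup>2"
  by (simp add: norm_sq_add)

lemma norm_sq_sum_orth:
  fixes g :: "'i \<Rightarrow> 'a :: chilbert_space"
  assumes "finite F" "\<And>i j. i \<in> F \<Longrightarrow> j \<in> F \<Longrightarrow> i \<noteq> j \<Longrightarrow> cinner (g i) (g j) = 0"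
  shows "(norm (sum g F))\<^sup>2 = (\<Sum>i\<in>F. (norm (g i))\<^sup>2)"
  using assms
proof (induction F rule: finite_induct)
  case (insert i F)
  have "cinner (g i) (sum g F) = 0"
    unfolding cinner.sum_right using insert by (intro sum.neutral) auto
  then show ?case using insert by (simp add: norm_sq_add_orth)
qed simp

section \<open>Bounded complex-linear maps\<close>

lemma bounded_clinearI:
  assumes "\<And>x y. A (x + y) = A x + A y" "\<And>c x. A (c *\<^sub>C x) = c *\<^sub>C A x"
    "\<And>x. norm (A x) \<le> K * norm x"
  shows "bounded_clinear A"
  unfolding bounded_clinear_def
proof (intro conjI allI)
  show "bounded_linear A"
    by (rule bounded_linear_intro[of _ K])
      (use assms in \<open>auto simp: scaleC_of_real[symmetric] mult.commute\<close>)
qed (rule assms)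

lemma bounded_clinear_bounded_linear: "bounded_clinear A \<Longrightarrow> bounded_linear A"
  by (simp add: bounded_clinear_def)

lemma bounded_clinear_scaleC: "bounded_clinear A \<Longrightarrow> A (c *\<^sub>C x) = c *\<^sub>C A x"
  by (simp add: bounded_clinear_def)

lemma bounded_clinear_add: "bounded_clinear A \<Longrightarrow> A (x + y) = A x + A y"
  by (simp add: bounded_clinear_def linear_add bounded_linear.linear)

lemma bounded_clinear_diff: "bounded_clinear A \<Longrightarrow> A (x - y) = A x - A y"
  by (simp add: bounded_clinear_def linear_diff bounded_linear.linear)

lemma bounded_clinear_0: "bounded_clinear A \<Longrightarrow> A 0 = 0"
  by (simp add: bounded_clinear_def linear_0 bounded_linear.linear)

lemma bounded_clinear_sum: "bounded_clinear A \<Longrightarrow> A (sum g F) = (\<Sum>i\<in>F. A (g i))"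
  by (simp add: bounded_clinear_def linear_sum bounded_linear.linear)

lemma bounded_clinear_tendsto:
  "bounded_clinear A \<Longrightarrow> (f \<longlongrightarrow> l) F \<Longrightarrow> ((\<lambda>x. A (f x)) \<longlongrightarrow> A l) F"
  by (rule bounded_linear.tendsto) (rule bounded_clinear_bounded_linear)

lemma bounded_clinear_continuous_on: "bounded_clinear A \<Longrightarrow> continuous_on S A"
  by (simp add: bounded_clinear_def linear_continuous_on)

lemma bounded_clinear_onorm: "bounded_clinear A \<Longrightarrow> norm (A x) \<le> onorm A * norm x"
  by (simp add: bounded_clinear_def onorm)

lemma bounded_clinear_compose:
  "bounded_clinear A \<Longrightarrow> bounded_clinear B \<Longrightarrow> bounded_clinear (A \<circ> B)"
  by (simp add: bounded_clinear_def o_def bounded_linear_compose)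

lemma bounded_clinear_compose2:
  "bounded_clinear A \<Longrightarrow> bounded_clinear B \<Longrightarrow> bounded_clinear (\<lambda>x. A (B x))"
  using bounded_clinear_compose[of A B] by (simp add: o_def)

lemma bounded_clinear_id: "bounded_clinear id" "bounded_clinear (\<lambda>x. x)"
  by (auto simp: bounded_clinear_def id_def)

lemma bounded_clinear_const_0: "bounded_clinear (\<lambda>_. 0)"
  by (simp add: bounded_clinear_def)

lemma bounded_clinear_plus:
  "bounded_clinear A \<Longrightarrow> bounded_clinear B \<Longrightarrow> bounded_clinear (\<lambda>x. A x + B x)"
  by (simp add: bounded_clinear_def bounded_linear_add scaleC_add_right)

lemma bounded_clinear_minus:
  "bounded_clinear A \<Longrightarrow> bounded_clinear B \<Longrightarrow> bounded_clinear (\<lambda>x. A x - B x)"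
  by (simp add: bounded_clinear_def bounded_linear_sub scaleC.diff_right)

lemma bounded_clinear_scale:
  "bounded_clinear A \<Longrightarrow> bounded_clinear (\<lambda>x. c *\<^sub>C A x)"
  unfolding bounded_clinear_def
  by (auto simp: scaleC_scaleC mult.commute intro: bounded_linear_compose[OF scaleC.bounded_linear_right])

lemma bounded_clinear_setsum:
  "(\<And>i. i \<in> I \<Longrightarrow> bounded_clinear (A i)) \<Longrightarrow> bounded_clinear (\<lambda>x. \<Sum>i\<in>I. A i x)"
  by (induction I rule: infinite_finite_induct)
    (auto intro: bounded_clinear_plus bounded_clinear_const_0)

lemma bounded_clinear_cinner: "bounded_clinear (\<lambda>x. cinner x y)"
  by (rule bounded_clinearI[of _ "norm y"])
    (auto simp: cinner_add_left cinner_scaleC_left scaleC_complex_def mult.commute cmod_cinner_le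
      intro: order_trans[OF cmod_cinner_le])

section \<open>Closed subspaces and closed spans\<close>

lemma cspan_eq_span: "cspan S = cvs.span S"
  unfolding cspan_def cvs.span_explicit by auto

lemma closed_csubspaceD:
  assumes "closed_csubspace M"
  shows "0 \<in> M" "x \<in> M \<Longrightarrow> y \<in> M \<Longrightarrow> x + y \<in> M" "x \<in> M \<Longrightarrow> c *\<^sub>C x \<in> M" "closed M"
    "x \<in> M \<Longrightarrow> r *\<^sub>R x \<in> M" "x \<in> M \<Longrightarrow> - x \<in> M" "x \<in> M \<Longrightarrow> y \<in> M \<Longrightarrow> x - y \<in> M"
proof -
  note * = assms[unfolded closed_csubspace_def]
  show "0 \<in> M" "x \<in> M \<Longrightarrow> y \<in> M \<Longrightarrow> x + y \<in> M" "x \<in> M \<Longrightarrow> c *\<^sub>C x \<in> M" "closed M"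
    using * by auto
  show "x \<in> M \<Longrightarrow> r *\<^sub>R x \<in> M" using * scaleC_of_real[of r x] by metis
  show minus: "x \<in> M \<Longrightarrow> - x \<in> M" for x using * scaleC_minus_one[of x] by metis
  show "x \<in> M \<Longrightarrow> y \<in> M \<Longrightarrow> x - y \<in> M"
    using * minus[of y] by (metis uminus_add_conv_diff add.commute)
qed

lemma closed_csubspace_sum:
  "closed_csubspace M \<Longrightarrow> (\<And>i. i \<in> F \<Longrightarrow> g i \<in> M) \<Longrightarrow> sum g F \<in> M"
  by (induction F rule: infinite_finite_induct) (auto simp: closed_csubspaceD)

lemma closed_csubspace_UNIV: "closed_csubspace UNIV"
  by (simp add: closed_csubspace_def)

lemma closed_csubspace_Int:
  "closed_csubspace M \<Longrightarrow> closed_csubspace N \<Longrightarrow> closed_csubspace (M \<inter> N)"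
  unfolding closed_csubspace_def by auto

lemma closed_csubspace_eq:
  assumes "bounded_clinear A" "bounded_clinear B"
  shows "closed_csubspace {x. A x = B x}"
  unfolding closed_csubspace_def
  using assms
  by (auto simp: bounded_clinear_add bounded_clinear_scaleC bounded_clinear_0
      intro: closed_Collect_eq bounded_clinear_continuous_on)

lemma closed_csubspace_vimage:
  assumes "bounded_clinear A" "closed_csubspace M"
  shows "closed_csubspace {x. A x \<in> M}"
  unfolding closed_csubspace_def
  using assms closed_vimage[of M A, OF closed_csubspaceD(4)[OF assms(2)] bounded_clinear_continuous_on[OF assms(1)]]
  by (auto simp: bounded_clinear_add bounded_clinear_scaleC bounded_clinear_0 closed_csubspaceD vimage_def)

lemma closed_csubspace_Collect_all:
  "(\<And>i. closed_csubspace {x. P i x}) \<Longrightarrow> closed_csubspace {x. \<forall>i. P i x}"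
  unfolding closed_csubspace_def by (auto intro: closed_Collect_all)

lemma closed_csubspace_closure_cspan: "closed_csubspace (closure (cspan S))"
  unfolding closed_csubspace_def
proof (intro conjI ballI allI)
  note cont = continuous_on_add[OF continuous_on_fst continuous_on_snd]
  show "0 \<in> closure (cspan S)"
    using closure_subset[of "cspan S"] by (auto simp: cspan_eq_span cvs.span_zero)
  fix x y :: 'a and c assume x: "x \<in> closure (cspan S)"
  from x obtain f where f: "\<And>n. f n \<in> cspan S" "f \<longlonglongrightarrow> x" unfolding closure_sequential by blast
  show "c *\<^sub>C x \<in> closure (cspan S)"
    unfolding closure_sequential
    by (rule exI[of _ "\<lambda>n. c *\<^sub>C f n"])
      (use f in \<open>auto simp: cspan_eq_span cvs.span_scale intro: scaleC.tendsto tendsto_const\<close>)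
  assume "y \<in> closure (cspan S)"
  then obtain g where g: "\<And>n. g n \<in> cspan S" "g \<longlonglongrightarrow> y" unfolding closure_sequential by blast
  show "x + y \<in> closure (cspan S)"
    unfolding closure_sequential
    by (rule exI[of _ "\<lambda>n. f n + g n"])
      (use f g in \<open>auto simp: cspan_eq_span cvs.span_add intro: tendsto_add\<close>)
qed simp

lemma closed_csubspace_ccspan: "closed_csubspace (ccspan S)"
  unfolding ccspan_def by (rule closed_csubspace_closure_cspan)

lemma ccspan_superset: "S \<subseteq> ccspan S"
  unfolding ccspan_def cspan_eq_span using cvs.span_superset closure_subset by blast

lemma cspan_minimal: "closed_csubspace M \<Longrightarrow> S \<subseteq> M \<Longrightarrow> cspan S \<subseteq> M"
  unfolding cspan_def by (auto intro!: closed_csubspace_sum closed_csubspaceD(3))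

lemma ccspan_minimal: "closed_csubspace M \<Longrightarrow> S \<subseteq> M \<Longrightarrow> ccspan S \<subseteq> M"
  unfolding ccspan_def by (meson cspan_minimal closure_minimal closed_csubspaceD(4))

lemma ccspan_eq_on:
  assumes "bounded_clinear A" "bounded_clinear B" "\<And>x. x \<in> S \<Longrightarrow> A x = B x" "x \<in> ccspan S"
  shows "A x = B x"
  using ccspan_minimal[OF closed_csubspace_eq[OF assms(1,2)], of S] assms(3,4) by auto

lemma closed_csubspace_ortho: "closed_csubspace (ortho S)"
proof -
  have "closed_csubspace {x. \<forall>y. (y \<in> S \<longrightarrow> cinner x y = 0)}"
  proof (rule closed_csubspace_Collect_all)
    fix y show "closed_csubspace {x. y \<in> S \<longrightarrow> cinner x y = 0}"
      using closed_csubspace_eq[OF bounded_clinear_cinner bounded_clinear_const_0, of y]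
        closed_csubspace_UNIV by (cases "y \<in> S") auto
  qed
  then show ?thesis by (simp add: ortho_def Ball_def)
qed

text \<open>Orthogonality is symmetric: if x is orthogonal to S, then S lies in the closed subspace
  \<open>ortho {x}\<close>, and so does its closed span.\<close>

lemma ortho_ccspan: "ortho (ccspan S) = ortho S"
proof
  show "ortho (ccspan S) \<subseteq> ortho S" using ccspan_superset by (auto simp: ortho_def)
  show "ortho S \<subseteq> ortho (ccspan S)"
  proof
    fix x assume x: "x \<in> ortho S"
    have "ccspan S \<subseteq> ortho {x}"
      by (rule ccspan_minimal[OF closed_csubspace_ortho])
        (use x in \<open>auto simp: ortho_def cinner_eq_0_commute\<close>)
    then show "x \<in> ortho (ccspan S)" by (auto simp: ortho_def cinner_eq_0_commute)
  qed
qed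

section \<open>Orthogonal projections and Riesz representation\<close>

text \<open>Midpoints of a minimizing sequence stay in M, so the parallelogram law makes the
  sequence Cauchy. Its limit is a nearest point, and comparing it with its neighbours in M forces
  the residual to be orthogonal to M.\<close>

lemma projection_exists:
  assumes M: "closed_csubspace M"
  shows "\<exists>p\<in>M. x - p \<in> ortho M"
proof -
  define d where "d = (INF y\<in>M. norm (x - y))"
  have bdd: "bdd_below ((\<lambda>y. norm (x - y)) ` M)" by (rule bdd_belowI[of _ 0]) auto
  have d: "d \<le> norm (x - y)" if "y \<in> M" for y
    unfolding d_def using bdd that by (rule cINF_lower)
  have d0: "d \<ge> 0" unfolding d_def using closed_csubspaceD(1)[OF M] by (intro cINF_greatest) auto
  have "\<exists>y\<in>M. norm (x - y) < d + 1 / real (Suc n)" for n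
    using cINF_less_iff[OF _ bdd, of "d + 1 / real (Suc n)"] closed_csubspaceD(1)[OF M]
    unfolding d_def by auto
  then obtain f where f: "\<And>n. f n \<in> M" "\<And>n. norm (x - f n) < d + 1 / real (Suc n)" by metis
  have par: "(norm (f n - f m))\<^sup>2 \<le> 2 * (norm (x - f n))\<^sup>2 + 2 * (norm (x - f m))\<^sup>2 - 4 * d\<^sup>2" for n m
  proof -
    have 1: "(norm ((x - f n) + (x - f m)))\<^sup>2 + (norm ((x - f n) - (x - f m)))\<^sup>2
      = 2 * (norm (x - f n))\<^sup>2 + 2 * (norm (x - f m))\<^sup>2"
      unfolding norm_sq_add[of "x - f n"] norm_sq_diff[of "x - f n" "x - f m"] by simp
    have 2: "(x - f n) + (x - f m) = 2 *\<^sub>R (x - (1/2) *\<^sub>R (f n + f m))"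
      by (simp add: algebra_simps scaleR_2)
    have "d \<le> norm (x - (1/2) *\<^sub>R (f n + f m))"
      by (intro d closed_csubspaceD[OF M] f)
    then have "(2 * d)\<^sup>2 \<le> (norm ((x - f n) + (x - f m)))\<^sup>2"
      unfolding 2 norm_scaleR using d0 by (intro power_mono) auto
    moreover have "norm ((x - f n) - (x - f m)) = norm (f n - f m)"
      using norm_minus_commute[of "f m" "f n"] by simp
    ultimately show ?thesis using 1 by (simp add: power_mult_distrib)
  qed
  have lim: "(\<lambda>n. norm (x - f n)) \<longlonglongrightarrow> d"
  proof (rule tendsto_sandwich)
    show "\<forall>\<^sub>F n in sequentially. d \<le> norm (x - f n)" using d f by auto
    show "\<forall>\<^sub>F n in sequentially. norm (x - f n) \<le> d + 1 / real (Suc n)"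
      by (intro always_eventually allI less_imp_le f(2))
    show "(\<lambda>n. d + 1 / real (Suc n)) \<longlonglongrightarrow> d"
      using tendsto_add[OF tendsto_const LIMSEQ_inverse_real_of_nat, of d]
      by (simp add: inverse_eq_divide)
  qed auto
  have "Cauchy f"
  proof (rule metric_CauchyI)
    fix e :: real assume e: "e > 0"
    have "(\<lambda>n. (norm (x - f n))\<^sup>2) \<longlonglongrightarrow> d\<^sup>2" by (rule tendsto_power[OF lim])
    then have "\<forall>\<^sub>F n in sequentially. (norm (x - f n))\<^sup>2 < d\<^sup>2 + e\<^sup>2 / 4"
      by (rule order_tendstoD) (use e in auto)
    then obtain N where N: "\<And>n. n \<ge> N \<Longrightarrow> (norm (x - f n))\<^sup>2 < d\<^sup>2 + e\<^sup>2 / 4"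
      unfolding eventually_sequentially by blast
    have "dist (f m) (f n) < e" if "m \<ge> N" "n \<ge> N" for m n
    proof -
      have "(norm (f m - f n))\<^sup>2 < e\<^sup>2" using par[of m n] N[OF that(1)] N[OF that(2)] by linarith
      then show ?thesis using e by (simp add: dist_norm power2_less_imp_less)
    qed
    then show "\<exists>N. \<forall>m\<ge>N. \<forall>n\<ge>N. dist (f m) (f n) < e" by blast
  qed
  then obtain p where p: "f \<longlonglongrightarrow> p" using Cauchy_convergent convergent_def by blast
  have pM: "p \<in> M" using closed_csubspaceD(4)[OF M] p f(1) closed_sequentially by blast
  have "(\<lambda>n. norm (x - f n)) \<longlonglongrightarrow> norm (x - p)"
    by (intro tendsto_norm tendsto_diff tendsto_const p)
  then have np: "norm (x - p) = d" using lim LIMSEQ_unique by blast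
  have "cinner (x - p) y = 0" if y: "y \<in> M" for y
  proof (cases "y = 0")
    case False
    define s where "s = (norm y)\<^sup>2"
    have s: "s > 0" unfolding s_def using False by simp
    \<comment> \<open>The optimal coefficient on the complex line through y: moving from p to p + c
      y lowers the squared distance by |c|^2 s, which minimality allows only for c = 0.\<close>
    define c where "c = cinner (x - p) y / complex_of_real s"
    have "d \<le> norm (x - (p + c *\<^sub>C y))" by (intro d closed_csubspaceD[OF M] pM y)
    then have "(norm (x - p))\<^sup>2 \<le> (norm ((x - p) - c *\<^sub>C y))\<^sup>2"
      unfolding np using d0 by (simp add: diff_diff_eq power_mono)
    also have "\<dots> = (norm (x - p))\<^sup>2 + (cmod c)\<^sup>2 * s - 2 * Re (cnj c * cinner (x - p) y)"
      unfolding norm_sq_diff norm_scaleC cinner_scaleC_right s_def by (simp add: power_mult_distrib)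
    also have "cinner (x - p) y = c * complex_of_real s" using s by (simp add: c_def)
    also have "cnj c * (c * complex_of_real s) = complex_of_real ((cmod c)\<^sup>2 * s)"
      unfolding of_real_mult complex_norm_square by (simp add: mult_ac)
    finally have "(cmod c)\<^sup>2 * s \<le> 0" by (simp add: mult.commute)
    then have "c = 0" using s by (simp add: mult_le_0_iff)
    then show ?thesis using s by (simp add: c_def)
  qed simp
  then show ?thesis using pM by (auto simp: ortho_def)
qed

lemma ortho_self: "x \<in> M \<Longrightarrow> x \<in> ortho M \<Longrightarrow> x = 0"
  using cinner_eq_0_self unfolding ortho_def by blast

lemma projection_unique:
  assumes M: "closed_csubspace M" and "p \<in> M" "x - p \<in> ortho M" "q \<in> M" "x - q \<in> ortho M"
  shows "p = q"
proof -
  have "(x - q) - (x - p) \<in> ortho M" using assms closed_csubspaceD(7)[OF closed_csubspace_ortho] by blast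
  then have "p - q \<in> ortho M" by simp
  moreover have "p - q \<in> M" using closed_csubspaceD(7)[OF M] assms by blast
  ultimately show ?thesis using ortho_self by fastforce
qed

lemma proj_props:
  assumes M: "closed_csubspace M"
  shows proj_in: "proj M x \<in> M" and proj_ortho: "x - proj M x \<in> ortho M"
proof -
  obtain p where p: "p \<in> M \<and> x - p \<in> ortho M" using projection_exists[OF M] by blast
  have "proj M x \<in> M \<and> x - proj M x \<in> ortho M"
    unfolding proj_def by (rule theI[of _ p]) (use p projection_unique[OF M] in blast)+
  then show "proj M x \<in> M" "x - proj M x \<in> ortho M" by auto
qed

lemma proj_eqI: "closed_csubspace M \<Longrightarrow> p \<in> M \<Longrightarrow> x - p \<in> ortho M \<Longrightarrow> proj M x = p"
  using projection_unique proj_in proj_ortho by blast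

lemma proj_id: "closed_csubspace M \<Longrightarrow> x \<in> M \<Longrightarrow> proj M x = x"
  by (rule proj_eqI) (auto simp: ortho_def)

lemma proj_eq_0: "closed_csubspace M \<Longrightarrow> x \<in> ortho M \<Longrightarrow> proj M x = 0"
  by (rule proj_eqI) (auto simp: closed_csubspaceD(1))

lemma norm_sq_proj:
  assumes "closed_csubspace M"
  shows "(norm x)\<^sup>2 = (norm (proj M x))\<^sup>2 + (norm (x - proj M x))\<^sup>2"
proof -
  have "cinner (proj M x) (x - proj M x) = 0"
    using proj_ortho[OF assms, of x] proj_in[OF assms, of x] by (simp add: ortho_def cinner_eq_0_commute)
  from norm_sq_add_orth[OF this] show ?thesis by simp
qed

lemma norm_proj_le: "closed_csubspace M \<Longrightarrow> norm (proj M x) \<le> norm x"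
  using norm_sq_proj[of M x] by (auto intro: power2_le_imp_le[of "norm (proj M x)" "norm x"])

lemma bounded_clinear_proj:
  assumes M: "closed_csubspace M" shows "bounded_clinear (proj M)"
proof (rule bounded_clinearI[of _ 1])
  note O = closed_csubspace_ortho[of M]
  fix x y c
  show "proj M (x + y) = proj M x + proj M y"
  proof (rule proj_eqI[OF M])
    show "x + y - (proj M x + proj M y) \<in> ortho M"
      using closed_csubspaceD(2)[OF O proj_ortho[OF M, of x] proj_ortho[OF M, of y]]
      unfolding add_diff_add .
  qed (intro closed_csubspaceD(2)[OF M] proj_in[OF M])
  show "proj M (c *\<^sub>C x) = c *\<^sub>C proj M x"
    using closed_csubspaceD(3)[OF O proj_ortho[OF M, of x], of c]
    by (intro proj_eqI[OF M] closed_csubspaceD(3)[OF M] proj_in[OF M]) (simp add: scaleC.diff_right)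
qed (simp add: norm_proj_le[OF M])

lemma cinner_proj:
  assumes M: "closed_csubspace M"
  shows "cinner (proj M x) y = cinner x (proj M y)"
proof -
  have "cinner (proj M x) (y - proj M y) = 0" "cinner (x - proj M x) (proj M y) = 0"
    using proj_ortho[OF M] proj_in[OF M] by (auto simp: ortho_def cinner_eq_0_commute)
  then show ?thesis by (simp add: cinner.diff_left cinner.diff_right)
qed

lemma cinner_proj_right: "closed_csubspace M \<Longrightarrow> x \<in> M \<Longrightarrow> cinner x (proj M y) = cinner x y"
  by (simp add: cinner_proj[symmetric] proj_id)

text \<open>The representing vector is a multiple of some w orthogonal to the kernel: subtracting
  the right multiple of w puts any x into the kernel, and pairing with w then reads off the value of
  the functional.\<close>

lemma riesz:
  assumes "bounded_clinear (\<phi> :: 'a :: chilbert_space \<Rightarrow> complex)"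
  shows "\<exists>z. \<forall>x. \<phi> x = cinner x z"
proof (cases "\<forall>x. \<phi> x = 0")
  case True then show ?thesis by (intro exI[of _ 0]) simp
next
  case False
  define M where "M = {x. \<phi> x = 0}"
  have M: "closed_csubspace M"
    unfolding M_def by (rule closed_csubspace_eq[OF assms bounded_clinear_const_0])
  obtain x0 where x0: "\<phi> x0 \<noteq> 0" using False by blast
  define w where "w = x0 - proj M x0"
  have w: "w \<in> ortho M" unfolding w_def by (rule proj_ortho[OF M])
  have "\<phi> (proj M x0) = 0" using proj_in[OF M] by (simp add: M_def)
  then have pw: "\<phi> w \<noteq> 0" using x0 by (simp add: w_def bounded_clinear_diff[OF assms])
  have w0: "cinner w w \<noteq> 0" using pw bounded_clinear_0[OF assms] by (auto simp: cinner_eq_0_self)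
  have "\<phi> x = cinner x ((cnj (\<phi> w / cinner w w)) *\<^sub>C w)" for x
  proof -
    have "\<phi> (x - (\<phi> x / \<phi> w) *\<^sub>C w) = \<phi> x - (\<phi> x / \<phi> w) * \<phi> w"
      by (simp only: bounded_clinear_diff[OF assms] bounded_clinear_scaleC[OF assms] scaleC_complex_def)
    then have "\<phi> (x - (\<phi> x / \<phi> w) *\<^sub>C w) = 0" using pw by simp
    then have "cinner w (x - (\<phi> x / \<phi> w) *\<^sub>C w) = 0" using w by (simp add: ortho_def M_def)
    then have "cinner x w = (\<phi> x / \<phi> w) * cinner w w"
      by (simp add: cinner_eq_0_commute[of w] cinner.diff_left cinner_scaleC_left)
    then show ?thesis using pw w0 by (simp add: cinner_scaleC_right)
  qed
  then show ?thesis by blast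
qed

section \<open>Adjoints\<close>

text \<open>Riesz supplies the adjoint one vector at a time. Its bound follows from |B x|^2 = <A (B
  x), x> after cancelling one factor |B x|.\<close>

lemma cadj_ex:
  assumes A: "bounded_clinear (A :: 'a :: chilbert_space \<Rightarrow> 'b :: chilbert_space)"
  shows "\<exists>B. bounded_clinear B \<and> (\<forall>x y. cinner (A x) y = cinner x (B y))"
proof -
  have "\<exists>z. \<forall>x. cinner (A x) y = cinner x z" for y
    by (rule riesz) (rule bounded_clinear_compose2[OF bounded_clinear_cinner A])
  then obtain B where B: "\<And>x y. cinner (A x) y = cinner x (B y)" by metis
  have Bl: "cinner (B y) x = cinner y (A x)" for x y by (metis B cinner_commute)
  have "bounded_clinear B"
  proof (rule bounded_clinearI[of _ "onorm A"])
    fix x y c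
    show "B (x + y) = B x + B y"
      by (rule cinner_ext) (simp add: cinner_add_left Bl)
    show "B (c *\<^sub>C x) = c *\<^sub>C B x"
      by (rule cinner_ext) (simp add: cinner_scaleC_left Bl)
    have "(norm (B x))\<^sup>2 = Re (cinner (A (B x)) x)" by (simp add: B norm_sq_cinner)
    also have "\<dots> \<le> norm (A (B x)) * norm x" by (rule Re_cinner_le)
    also have "\<dots> \<le> (onorm A * norm (B x)) * norm x"
      by (intro mult_right_mono bounded_clinear_onorm[OF A]) auto
    finally have "norm (B x) * norm (B x) \<le> norm (B x) * (onorm A * norm x)"
      by (simp add: power2_eq_square mult_ac)
    then show "norm (B x) \<le> onorm A * norm x"
      using onorm_pos_le[OF bounded_clinear_bounded_linear[OF A]]
      by (cases "norm (B x) = 0") (auto simp: mult_le_cancel_left)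
  qed
  with B show ?thesis by blast
qed

lemma cadj_props:
  assumes A: "bounded_clinear A"
  shows bounded_clinear_cadj: "bounded_clinear (cadj A)"
    and cinner_cadj: "cinner (A x) y = cinner x (cadj A y)"
proof -
  obtain B where B: "bounded_clinear B \<and> (\<forall>x y. cinner (A x) y = cinner x (B y))"
    using cadj_ex[OF A] by blast
  have "bounded_clinear (cadj A) \<and> (\<forall>x y. cinner (A x) y = cinner x (cadj A y))"
    unfolding cadj_def
  proof (rule theI[of _ B])
    show "bounded_clinear B \<and> (\<forall>x y. cinner (A x) y = cinner x (B y))" by (rule B)
    fix C assume C: "bounded_clinear C \<and> (\<forall>x y. cinner (A x) y = cinner x (C y))"
    show "C = B"
      by (rule ext, rule cinner_ext) (metis B C cinner_commute)
  qed
  then show "bounded_clinear (cadj A)" "cinner (A x) y = cinner x (cadj A y)" by auto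
qed

lemma cinner_cadj_left: "bounded_clinear A \<Longrightarrow> cinner (cadj A x) y = cinner x (A y)"
  by (metis cinner_cadj cinner_commute)

lemma cadj_eqI:
  assumes "bounded_clinear A" "\<And>x y. cinner (A x) y = cinner x (B y)"
  shows "cadj A = B"
  by (rule ext, rule cinner_ext) (metis assms cinner_cadj cinner_commute)

lemma cadj_compose:
  "bounded_clinear A \<Longrightarrow> bounded_clinear B \<Longrightarrow> cadj (A \<circ> B) = cadj B \<circ> cadj A"
  by (rule cadj_eqI) (auto simp: bounded_clinear_compose cinner_cadj)

lemma cadj_id: "cadj id = id" "cadj (\<lambda>x. x) = (\<lambda>x. x)"
  by (rule cadj_eqI; simp add: bounded_clinear_id)+

lemma cadj_proj: "closed_csubspace M \<Longrightarrow> cadj (proj M) = proj M"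
  by (rule cadj_eqI) (auto simp: bounded_clinear_proj cinner_proj)

lemma isometry_UNIV_bounded_clinear: "isometry_on UNIV V \<Longrightarrow> bounded_clinear V"
  by (rule bounded_clinearI[of _ 1]) (auto simp: isometry_on_def)

text \<open>Polarization: norms of sums give the real parts, and replacing y by its multiple by the
  imaginary unit gives the imaginary parts.\<close>

lemma isometric_cinner:
  assumes "closed_csubspace M" "isometry_on M V" "x \<in> M" "y \<in> M"
  shows "cinner (V x) (V y) = cinner x y"
proof -
  note M = closed_csubspaceD[OF assms(1)]
  have re: "Re (cinner (V u) (V v)) = Re (cinner u v)" if "u \<in> M" "v \<in> M" for u v
  proof -
    have "V (u + v) = V u + V v" "norm (V (u + v)) = norm (u + v)"
        "norm (V u) = norm u" "norm (V v) = norm v"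
      using assms(2) that M(2)[OF that] unfolding isometry_on_def by blast+
    then show ?thesis using norm_sq_add[of "V u" "V v"] norm_sq_add[of u v] by simp
  qed
  have "V (\<i> *\<^sub>C y) = \<i> *\<^sub>C V y" using assms by (simp add: isometry_on_def)
  then have "Re (cnj \<i> * cinner (V x) (V y)) = Re (cnj \<i> * cinner x y)"
    using re[OF assms(3) M(3)[OF assms(4)], of \<i>] by (simp only: cinner_scaleC_right)
  then show ?thesis using re[OF assms(3,4)] by (simp add: complex_eq_iff)
qed

lemma isometry_cinner: "isometry_on UNIV V \<Longrightarrow> cinner (V x) (V y) = cinner x y"
  using isometric_cinner[OF closed_csubspace_UNIV] by blast

lemma isometry_cadj: "isometry_on UNIV V \<Longrightarrow> cadj V (V x) = x"
  by (rule cinner_ext)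
    (simp add: cinner_cadj_left isometry_UNIV_bounded_clinear isometry_cinner)

section \<open>Positive operators and square roots\<close>

lemma pos_op_bounded: "pos_op A \<Longrightarrow> bounded_clinear A"
  by (simp add: pos_op_def)

lemma pos_op_Re: "pos_op A \<Longrightarrow> 0 \<le> Re (cinner (A x) x)"
  by (simp add: pos_op_def)

text \<open>A quadratic form that is real on x + y and on x + i y determines its off-diagonal values
  up to conjugate symmetry.\<close>

lemma pos_op_selfadjoint:
  assumes "pos_op A" shows "cinner (A x) y = cinner x (A y)"
proof -
  note A = pos_op_bounded[OF assms]
  have im: "Im (cinner (A u) u) = 0" for u
    using assms by (auto simp: pos_op_def complex_is_Real_iff)
  have "Im (cinner (A (x + y)) (x + y)) = Im (cinner (A x) y) + Im (cinner (A y) x)"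
    by (simp add: bounded_clinear_add[OF A] cinner.add_left cinner.add_right im)
  moreover have "Im (cinner (A (x + \<i> *\<^sub>C y)) (x + \<i> *\<^sub>C y))
      = Im (cnj \<i> * cinner (A x) y) + Im (\<i> * cinner (A y) x)"
    by (simp add: bounded_clinear_add[OF A] bounded_clinear_scaleC[OF A] cinner.add_left
        cinner.add_right cinner_scaleC_left cinner_scaleC_right im)
  ultimately have "cinner (A x) y = cnj (cinner (A y) x)"
    by (simp add: im complex_eq_iff)
  then show ?thesis by (simp add: cinner_commute[of x])
qed

text \<open>Perturbing x in the direction y = A x gives the form value 2 t s + t^2 K, with no
  constant term; it can stay nonnegative for all real t only if s = |A x|^2 vanishes.\<close>

lemma pos_op_zero:
  assumes "pos_op A" "Re (cinner (A x) x) = 0"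
  shows "A x = 0"
proof -
  note A = pos_op_bounded[OF assms(1)]
  define y where "y = A x"
  define s where "s = (norm y)\<^sup>2"
  define K where "K = Re (cinner (A y) y)"
  have quad: "0 \<le> 2 * t * s + t\<^sup>2 * K" for t :: real
  proof -
    have 1: "Re (cinner (A x) y) = s" "Re (cinner (A y) x) = s"
      by (simp_all add: s_def norm_sq_cinner y_def pos_op_selfadjoint[OF assms(1)])
    have "0 \<le> Re (cinner (A (x + complex_of_real t *\<^sub>C y)) (x + complex_of_real t *\<^sub>C y))"
      by (rule pos_op_Re[OF assms(1)])
    also have "\<dots> = 2 * t * s + t\<^sup>2 * K"
      using assms(2) 1 by (simp add: bounded_clinear_add[OF A] bounded_clinear_scaleC[OF A] cinner.add_left
        cinner.add_right cinner_scaleC_left cinner_scaleC_right K_def power2_eq_square algebra_simps)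
    finally show ?thesis .
  qed
  have K: "K \<ge> 0" unfolding K_def by (rule pos_op_Re[OF assms(1)])
  show "A x = 0"
  proof (rule ccontr)
    assume "A x \<noteq> 0"
    then have s: "s > 0" by (simp add: s_def y_def)
    \<comment> \<open>At t = -u the quadratic becomes -u^2 (K + 2). The denominator K + 1 stays
      positive also when K = 0.\<close>
    define u where "u = s / (K + 1)"
    have u: "u > 0" "s = u * (K + 1)" using s K by (auto simp: u_def)
    have "2 * (- u) * s + (- u)\<^sup>2 * K = - (u * u * (K + 2))"
      by (simp add: u(2) algebra_simps power2_eq_square)
    moreover have "u * u * (K + 2) > 0" using u K by (intro mult_pos_pos) auto
    ultimately show False using quad[of "- u"] by linarith
  qed
qed

text \<open>The Taylor coefficients of sqrt(1 - t). Inserting B = I - A for t produces a square root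
  of A.\<close>

definition sqrt_coeff :: "nat \<Rightarrow> real"
  where "sqrt_coeff k = (1/2 gchoose k) * (- 1) ^ k"

lemma sqrt_coeff_0: "sqrt_coeff 0 = 1"
  by (simp add: sqrt_coeff_def)

lemma sqrt_coeff_Suc: "sqrt_coeff (Suc k) \<le> 0"
proof -
  have "sqrt_coeff (Suc k) = pochhammer (- (1/2)) (Suc k) / fact (Suc k)"
    unfolding sqrt_coeff_def gbinomial_pochhammer
    by (simp add: power_mult_distrib[symmetric])
  also have "\<dots> = - (1/2) * pochhammer (1/2) k / fact (Suc k)"
    by (simp add: pochhammer_rec)
  also have "\<dots> \<le> 0" by (simp add: pochhammer_nonneg)
  finally show ?thesis .
qed

text \<open>The partial sums are the Taylor coefficients of sqrt(1 - t) / (1 - t) = (1 - t)^(-1/2),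
  all of which are positive.\<close>

lemma sqrt_coeff_sum_nonneg: "0 \<le> (\<Sum>k\<le>n. sqrt_coeff k)"
proof -
  have "(\<Sum>k\<le>n. sqrt_coeff k) = (- 1) ^ n * (1/2 - 1 gchoose n)"
    unfolding sqrt_coeff_def by (rule gbinomial_sum_lower_neg)
  also have "\<dots> = pochhammer (1/2) n / fact n"
    unfolding gbinomial_pochhammer by (simp add: power_mult_distrib[symmetric])
  also have "\<dots> \<ge> 0" by (simp add: pochhammer_nonneg)
  finally show ?thesis .
qed

text \<open>Only the zeroth coefficient is positive, so nonnegative partial sums bound the total of
  the others. This gives absolute convergence at t = 1, as required for a contraction of norm
  1.\<close>

lemma sqrt_coeff_abs_sum: "(\<Sum>k<n. \<bar>sqrt_coeff (Suc k)\<bar>) \<le> 1"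
proof -
  have "(\<Sum>k\<le>n. sqrt_coeff k) = 1 - (\<Sum>k<n. \<bar>sqrt_coeff (Suc k)\<bar>)"
    unfolding sum.atMost_shift by (simp add: sqrt_coeff_0 sqrt_coeff_Suc abs_of_nonpos sum_negf)
  then show ?thesis using sqrt_coeff_sum_nonneg[of n] by simp
qed

lemma sqrt_coeff_summable: "summable (\<lambda>k. \<bar>sqrt_coeff k\<bar>)"
proof -
  have "summable (\<lambda>k. \<bar>sqrt_coeff (Suc k)\<bar>)"
    by (rule summableI_nonneg_bounded[of _ 1]) (auto simp: sqrt_coeff_abs_sum)
  then show ?thesis by (subst summable_Suc_iff[symmetric])
qed

text \<open>Vandermonde's identity: the square of the series of sqrt(1 - t) is 1 - t.\<close>

lemma sqrt_coeff_convolution: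
  "(\<Sum>i\<le>n. sqrt_coeff i * sqrt_coeff (n - i)) = (if n = 0 then 1 else if n = 1 then - 1 else 0)"
proof -
  have "(\<Sum>i\<le>n. sqrt_coeff i * sqrt_coeff (n - i))
      = (\<Sum>i\<le>n. ((1/2 gchoose i) * (1/2 gchoose (n - i))) * (- 1) ^ n)"
    by (intro sum.cong refl) (auto simp: sqrt_coeff_def power_add[symmetric] mult_ac)
  also have "\<dots> = (1 gchoose n) * (- 1) ^ n"
    using gbinomial_Vandermonde[of "1/2 :: real" "1/2" n]
    by (simp add: sum_distrib_right[symmetric] atLeast0AtMost)
  also have "(1 gchoose n) = real (1 choose n)"
    using binomial_gbinomial[of 1 n, where ?'a = real] by simp
  finally show ?thesis by (auto simp: binomial_eq_0)
qed

lemma sqrt_coeff_summable_on: "(\<lambda>k. \<bar>sqrt_coeff k\<bar>) summable_on UNIV"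
  using norm_summable_imp_summable_on[of "\<lambda>k. \<bar>sqrt_coeff k\<bar>"] sqrt_coeff_summable by simp

definition sqrt_series :: "('a :: chilbert_space \<Rightarrow> 'a) \<Rightarrow> 'a \<Rightarrow> 'a"
  where "sqrt_series B x = infsum (\<lambda>k. sqrt_coeff k *\<^sub>R (B ^^ k) x) UNIV"

context
  fixes B :: "'a :: chilbert_space \<Rightarrow> 'a"
  assumes B: "bounded_clinear B" and B_le: "\<And>x. norm (B x) \<le> norm x"
begin

lemma contraction_pow_bounded: "bounded_clinear (B ^^ k)"
  by (induction k) (simp_all only: funpow.simps bounded_clinear_compose B bounded_clinear_id)

lemma contraction_pow_le: "norm ((B ^^ k) x) \<le> norm x"
  by (induction k) (auto intro: order_trans[OF B_le])

lemma sqrt_series_abs_summable: "(\<lambda>k. sqrt_coeff k *\<^sub>R (B ^^ k) x) abs_summable_on UNIV"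
proof (rule Infinite_Sum.abs_summable_on_comparison_test')
  show "(\<lambda>k. \<bar>sqrt_coeff k\<bar> * norm x) summable_on UNIV"
    by (rule summable_on_cmult_left[OF sqrt_coeff_summable_on])
qed (auto intro: mult_left_mono contraction_pow_le)

lemma sqrt_series_has_sum: "((\<lambda>k. sqrt_coeff k *\<^sub>R (B ^^ k) x) has_sum sqrt_series B x) UNIV"
  unfolding sqrt_series_def
  by (rule has_sum_infsum[OF abs_summable_summable[OF sqrt_series_abs_summable]])

lemma sqrt_series_sums: "(\<lambda>k. sqrt_coeff k *\<^sub>R (B ^^ k) x) sums sqrt_series B x"
  by (rule has_sum_imp_sums) (rule sqrt_series_has_sum)

lemma sqrt_series_bounded_clinear: "bounded_clinear (sqrt_series B)"
proof (rule bounded_clinearI)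
  fix x y :: 'a and c
  note P = contraction_pow_bounded
  show "sqrt_series B (x + y) = sqrt_series B x + sqrt_series B y"
    using has_sum_add[OF sqrt_series_has_sum[of x] sqrt_series_has_sum[of y]]
      sqrt_series_has_sum[of "x + y"]
    by (simp add: bounded_clinear_add[OF P] scaleR_add_right has_sum_unique)
  have "((\<lambda>k. c *\<^sub>C (sqrt_coeff k *\<^sub>R (B ^^ k) x)) has_sum c *\<^sub>C sqrt_series B x) UNIV"
    by (rule has_sum_bounded_linear[OF scaleC.bounded_linear_right sqrt_series_has_sum])
  then show "sqrt_series B (c *\<^sub>C x) = c *\<^sub>C sqrt_series B x"
    using sqrt_series_has_sum[of "c *\<^sub>C x"]
    by (simp add: bounded_clinear_scaleC[OF P] scaleC.scaleR_right has_sum_unique)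
  have "norm (sqrt_series B x) \<le> (\<Sum>\<^sub>\<infinity>k. norm (sqrt_coeff k *\<^sub>R (B ^^ k) x))"
    unfolding sqrt_series_def by (rule norm_infsum_bound) (rule sqrt_series_abs_summable)
  also have "\<dots> \<le> (\<Sum>\<^sub>\<infinity>k. \<bar>sqrt_coeff k\<bar> * norm x)"
  proof (rule infsum_mono)
    show "(\<lambda>k. \<bar>sqrt_coeff k\<bar> * norm x) summable_on UNIV"
      by (rule summable_on_cmult_left[OF sqrt_coeff_summable_on])
  qed (use sqrt_series_abs_summable in \<open>auto intro: mult_left_mono contraction_pow_le\<close>)
  also have "\<dots> = (\<Sum>\<^sub>\<infinity>k. \<bar>sqrt_coeff k\<bar>) * norm x"
    by (rule infsum_cmult_left')
  finally show "norm (sqrt_series B x) \<le> (\<Sum>\<^sub>\<infinity>k. \<bar>sqrt_coeff k\<bar>) * norm x" .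
qed

text \<open>The double series converges absolutely, so it may be regrouped along the antidiagonals i
  + j = n, where the convolution identity leaves only n = 0 and n = 1.\<close>

lemma sqrt_series_square: "sqrt_series B (sqrt_series B x) = x - B x"
proof -
  note P = contraction_pow_bounded
  define f where "f = (\<lambda>(i, j). (sqrt_coeff i * sqrt_coeff j) *\<^sub>R (B ^^ (i + j)) x)"
  have "(\<lambda>p. norm (case p of (i, j) \<Rightarrow> sqrt_coeff i * sqrt_coeff j)) summable_on UNIV \<times> UNIV"
    unfolding Infinite_Sum.abs_summable_on_Sigma_iff
  proof (intro conjI ballI)
    show "(\<lambda>j. norm (case (i, j) of (i, j) \<Rightarrow> sqrt_coeff i * sqrt_coeff j)) summable_on UNIV" for i
      using summable_on_cmult_right[OF sqrt_coeff_summable_on, of "\<bar>sqrt_coeff i\<bar>"] by (simp add: abs_mult)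
    show "(\<lambda>i. norm (\<Sum>\<^sub>\<infinity>j. norm (case (i, j) of (i, j) \<Rightarrow> sqrt_coeff i * sqrt_coeff j)))
        summable_on UNIV"
      using summable_on_cmult_left[OF sqrt_coeff_summable_on, of "\<bar>infsum (\<lambda>k. \<bar>sqrt_coeff k\<bar>) UNIV\<bar>"]
      by (simp add: abs_mult infsum_cmult_right')
  qed
  then have "(\<lambda>p. norm (case p of (i, j) \<Rightarrow> sqrt_coeff i * sqrt_coeff j) * norm x)
      summable_on UNIV \<times> UNIV"
    by (rule summable_on_cmult_left)
  then have "(\<lambda>p. norm (f p)) summable_on UNIV \<times> UNIV"
    by (rule Infinite_Sum.abs_summable_on_comparison_test')
      (auto simp: f_def abs_mult intro!: mult_left_mono contraction_pow_le)
  then have fs: "f summable_on UNIV \<times> UNIV" by (rule abs_summable_summable)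
  have "sqrt_series B (sqrt_series B x)
      = (\<Sum>\<^sub>\<infinity>i. sqrt_coeff i *\<^sub>R (B ^^ i) (sqrt_series B x))"
    by (rule sqrt_series_def)
  also have "\<dots> = (\<Sum>\<^sub>\<infinity>i. \<Sum>\<^sub>\<infinity>j. f (i, j))"
  proof (rule infsum_cong)
    fix i
    have "((\<lambda>j. sqrt_coeff i *\<^sub>R (B ^^ i) (sqrt_coeff j *\<^sub>R (B ^^ j) x))
        has_sum sqrt_coeff i *\<^sub>R (B ^^ i) (sqrt_series B x)) UNIV"
      by (intro has_sum_bounded_linear[OF bounded_linear_scaleR_right]
          has_sum_bounded_linear[OF bounded_clinear_bounded_linear[OF P]] sqrt_series_has_sum)
    moreover have "sqrt_coeff i *\<^sub>R (B ^^ i) (sqrt_coeff j *\<^sub>R (B ^^ j) x) = f (i, j)" for j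
      using linear_scale[OF bounded_linear.linear[OF bounded_clinear_bounded_linear[OF P[of i]]]]
      by (simp add: f_def funpow_add)
    ultimately show "sqrt_coeff i *\<^sub>R (B ^^ i) (sqrt_series B x) = (\<Sum>\<^sub>\<infinity>j. f (i, j))"
      by (simp add: infsumI)
  qed
  also have "\<dots> = infsum f (UNIV \<times> UNIV)" by (rule infsum_Sigma_banach[OF fs])
  also have "\<dots> = infsum (\<lambda>(n, i). f (i, n - i)) (SIGMA n:UNIV. {..n})"
    by (rule infsum_reindex_bij_witness[of _ "\<lambda>(n, i). (i, n - i)" "\<lambda>(i, j). (i + j, i)"]) auto
  also have "\<dots> = (\<Sum>\<^sub>\<infinity>n. \<Sum>\<^sub>\<infinity>i\<in>{..n}. f (i, n - i))"
  proof (subst infsum_Sigma'_banach[symmetric])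
    show "(\<lambda>(n, i). f (i, n - i)) summable_on (SIGMA n:UNIV. {..n})"
      using fs
      by (subst summable_on_reindex_bij_witness[of _ "\<lambda>(i, j). (i + j, i)" "\<lambda>(n, i). (i, n - i)"
          "UNIV \<times> UNIV" f]) auto
  qed simp
  also have "\<dots> = (\<Sum>\<^sub>\<infinity>n. (\<Sum>i\<le>n. sqrt_coeff i * sqrt_coeff (n - i)) *\<^sub>R (B ^^ n) x)"
    by (simp add: f_def scaleR_sum_left)
  also have "\<dots> = (\<Sum>\<^sub>\<infinity>n\<in>{0, 1}. (if n = 0 then 1 else - 1) *\<^sub>R (B ^^ n) x)"
    unfolding sqrt_coeff_convolution by (rule infsum_cong_neutral) auto
  also have "\<dots> = x - B x" by simp
  finally show ?thesis .
qed

lemma sqrt_series_commute: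
  assumes "bounded_clinear C" "\<And>x. C (B x) = B (C x)"
  shows "C (sqrt_series B x) = sqrt_series B (C x)"
proof -
  have "C ((B ^^ k) x) = (B ^^ k) (C x)" for k
    by (induction k) (auto simp: assms(2))
  moreover have "((\<lambda>k. C (sqrt_coeff k *\<^sub>R (B ^^ k) x)) has_sum C (sqrt_series B x)) UNIV"
    by (intro has_sum_bounded_linear[OF bounded_clinear_bounded_linear[OF assms(1)]] sqrt_series_has_sum)
  moreover have "C (r *\<^sub>R y) = r *\<^sub>R C y" for r y
    using linear_scale[OF bounded_linear.linear[OF bounded_clinear_bounded_linear[OF assms(1)]]] .
  ultimately show ?thesis using sqrt_series_has_sum[of "C x"] by (simp add: has_sum_unique)
qed

text \<open>All coefficients after the first are nonpositive and <B^k x, x> is at most |x|^2 = <B^0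
  x, x>. Hence a partial sum of the quadratic form is at least |x|^2 times the partial sum of the
  coefficients, which is nonnegative.\<close>

lemma sqrt_series_pos:
  assumes "\<And>x y. cinner (B x) y = cinner x (B y)"
  shows "pos_op (sqrt_series B)"
  unfolding pos_op_def
proof (intro conjI allI)
  fix x
  have sa: "cinner ((B ^^ k) x) y = cinner x ((B ^^ k) y)" for k x y
    by (induction k arbitrary: y) (auto simp: assms, metis assms funpow_swap1)
  define b where "b k = Re (cinner ((B ^^ k) x) x)" for k
  have "cnj (cinner ((B ^^ k) x) x) = cinner ((B ^^ k) x) x" for k
    by (metis sa cinner_commute)
  then have b: "cinner ((B ^^ k) x) x = complex_of_real (b k)" for k
    by (simp add: b_def complex_eq_iff)
  have s: "(\<lambda>k. cinner (sqrt_coeff k *\<^sub>R (B ^^ k) x) x) sums cinner (sqrt_series B x) x"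
    by (rule bounded_linear.sums[OF cinner.bounded_linear_left sqrt_series_sums])
  then have s: "(\<lambda>k. complex_of_real (sqrt_coeff k * b k)) sums cinner (sqrt_series B x) x"
    by (simp add: cinner.scaleR_left b scaleR_conv_of_real)
  have "(\<lambda>k. Im (complex_of_real (sqrt_coeff k * b k))) sums Im (cinner (sqrt_series B x) x)"
    using s by (rule sums_Im)
  then have "Im (cinner (sqrt_series B x) x) = 0" by (simp add: sums_iff)
  then show "cinner (sqrt_series B x) x \<in> \<real>" by (simp add: complex_is_Real_iff)
  have "(\<lambda>k. Re (complex_of_real (sqrt_coeff k * b k))) sums Re (cinner (sqrt_series B x) x)"
    using s by (rule sums_Re)
  then have "(\<lambda>n. \<Sum>k\<le>n. sqrt_coeff k * b k) \<longlonglongrightarrow> Re (cinner (sqrt_series B x) x)"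
    by (simp add: sums_def_le)
  moreover have "0 \<le> (\<Sum>k\<le>n. sqrt_coeff k * b k)" for n
  proof -
    have bk: "b k \<le> (norm x)\<^sup>2" for k
    proof -
      have "b k \<le> norm ((B ^^ k) x) * norm x" unfolding b_def by (rule Re_cinner_le)
      also have "\<dots> \<le> norm x * norm x" by (intro mult_right_mono contraction_pow_le) auto
      finally show ?thesis by (simp add: power2_eq_square)
    qed
    have "0 \<le> (\<Sum>k\<le>n. sqrt_coeff k) * (norm x)\<^sup>2" by (simp add: sqrt_coeff_sum_nonneg)
    also have "\<dots> \<le> (\<Sum>k\<le>n. sqrt_coeff k * b k)"
      unfolding sum_distrib_right
    proof (rule sum_mono)
      fix k show "sqrt_coeff k * (norm x)\<^sup>2 \<le> sqrt_coeff k * b k"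
        using bk[of k] sqrt_coeff_Suc
        by (cases k) (auto simp: sqrt_coeff_0 b_def norm_sq_cinner intro: mult_left_mono_neg)
    qed
    finally show ?thesis .
  qed
  ultimately show "0 \<le> Re (cinner (sqrt_series B x) x)"
    by (meson LIMSEQ_le_const)
qed (rule sqrt_series_bounded_clinear)

end

lemma op_sqrt_props:
  assumes A: "pos_op (A :: 'a :: chilbert_space \<Rightarrow> 'a)" and le: "\<And>x. Re (cinner (A x) x) \<le> (norm x)\<^sup>2"
  shows op_sqrt_pos: "pos_op (op_sqrt A)" and op_sqrt_square: "op_sqrt A (op_sqrt A x) = A x"
proof -
  define B where "B x = x - A x" for x
  have B: "bounded_clinear B"
    unfolding B_def[abs_def]
    by (intro bounded_clinear_minus bounded_clinear_id pos_op_bounded[OF A])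
  have sa: "cinner (B x) y = cinner x (B y)" for x y
    by (simp add: B_def cinner.diff_left cinner.diff_right pos_op_selfadjoint[OF A])
  have pos: "0 \<le> Re (cinner (B x) x)" for x
    using le[of x] by (simp add: B_def cinner.diff_left norm_sq_cinner)
  \<comment> \<open>Positivity of B at x - B x gives 2 |B x|^2 \<le> <B x, x> + <B (B x), B x>, and
    B \<le> I bounds the right side by |x|^2 + |B x|^2.\<close>
  have B_le: "norm (B x) \<le> norm x" for x
  proof -
    have "0 \<le> Re (cinner (B (x - B x)) (x - B x))" by (rule pos)
    also have "\<dots> = Re (cinner (B x) x) - 2 * (norm (B x))\<^sup>2 + Re (cinner (B (B x)) (B x))"
      by (simp add: bounded_clinear_diff[OF B] cinner.diff_left cinner.diff_right sa norm_sq_cinner)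
    also have "Re (cinner (B (B x)) (B x)) \<le> (norm (B x))\<^sup>2"
      using pos_op_Re[OF A, of "B x"] by (simp add: B_def[of "B x"] cinner.diff_left norm_sq_cinner)
    also have "Re (cinner (B x) x) \<le> (norm x)\<^sup>2"
      using pos_op_Re[OF A, of x] by (simp add: B_def cinner.diff_left norm_sq_cinner)
    finally have "(norm (B x))\<^sup>2 \<le> (norm x)\<^sup>2" by simp
    then show ?thesis by (rule power2_le_imp_le) simp
  qed
  define R where "R = sqrt_series B"
  have R: "pos_op R" unfolding R_def by (rule sqrt_series_pos[OF B B_le sa])
  have RR: "R (R x) = A x" for x
    unfolding R_def sqrt_series_square[OF B B_le] by (simp add: B_def)
  \<comment> \<open>A second root R' commutes with A = R' R', hence with the series R. For y = R x -
    R' x this gives (R + R') y = 0, so both positive forms vanish at y; then R y = R' y = 0, and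
    moving R and R' across the inner product gives <y, y> = 0.\<close>
  have uniq: "R' = R" if R': "pos_op R'" "R' \<circ> R' = A" for R'
  proof
    fix x
    note b = pos_op_bounded[OF R'(1)] and bR = pos_op_bounded[OF R]
    have R'R': "R' (R' x) = A x" for x using R'(2) by (auto simp: fun_eq_iff)
    have "R' (A z) = A (R' z)" for z by (metis R'R')
    then have "R' (B z) = B (R' z)" for z by (simp add: B_def bounded_clinear_diff[OF b])
    then have comm: "R' (R z) = R (R' z)" for z
      unfolding R_def by (intro sqrt_series_commute[OF B B_le b])
    define y where "y = R x - R' x"
    have "R y + R' y = 0"
      by (simp add: y_def bounded_clinear_diff[OF b] bounded_clinear_diff[OF bR] RR R'R' comm)
    then have "Re (cinner (R y) y) + Re (cinner (R' y) y) = 0"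
      by (metis cinner.add_left cinner_zero_left plus_complex.sel(1) zero_complex.sel(1))
    then have "Re (cinner (R y) y) = 0" "Re (cinner (R' y) y) = 0"
      using pos_op_Re[OF R, of y] pos_op_Re[OF R'(1), of y] by linarith+
    then have "R y = 0" "R' y = 0" using pos_op_zero R R'(1) by auto
    then have "cinner y y = 0"
      unfolding y_def cinner.diff_left pos_op_selfadjoint[OF R] pos_op_selfadjoint[OF R'(1)]
      by (simp add: y_def)
    then show "R' x = R x" by (simp add: cinner_eq_0_self y_def)
  qed
  have "op_sqrt A = R"
    unfolding op_sqrt_def
  proof (rule the_equality)
    show "pos_op R \<and> R \<circ> R = A" using R RR by (simp add: fun_eq_iff)
  qed (use uniq in blast)
  then show "pos_op (op_sqrt A)" "op_sqrt A (op_sqrt A x) = A x" using R RR by auto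
qed

section \<open>Orthonormal bases and Hilbert space dimension\<close>

definition orthonormal :: "'a :: chilbert_space set \<Rightarrow> bool"
  where "orthonormal B \<longleftrightarrow>
    (\<forall>x\<in>B. norm x = 1) \<and> (\<forall>x\<in>B. \<forall>y\<in>B. x \<noteq> y \<longrightarrow> cinner x y = 0)"

lemma is_onb_iff: "is_onb M B \<longleftrightarrow> orthonormal B \<and> ccspan B = M"
  by (auto simp: is_onb_def orthonormal_def)

lemma orthonormal_cinner:
  "orthonormal B \<Longrightarrow> x \<in> B \<Longrightarrow> y \<in> B \<Longrightarrow> cinner x y = (if x = y then 1 else 0)"
  by (auto simp: orthonormal_def cinner_self)

lemma orthonormal_subset: "orthonormal B \<Longrightarrow> F \<subseteq> B \<Longrightarrow> orthonormal F"
  by (auto simp: orthonormal_def)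

text \<open>A maximal orthonormal subset of M, provided by Zorn's lemma, is total: otherwise the
  normalized residual of a missed vector would enlarge it.\<close>

lemma onb_exists:
  assumes M: "closed_csubspace M" shows "\<exists>B. is_onb M B"
proof -
  let ?A = "{B. B \<subseteq> M \<and> orthonormal B}"
  have "\<exists>B\<in>?A. \<forall>X\<in>?A. B \<subseteq> X \<longrightarrow> X = B"
  proof (rule subset_Zorn')
    fix C assume C: "subset.chain ?A C"
    have "orthonormal (\<Union>C)"
      unfolding orthonormal_def
    proof (intro conjI ballI impI)
      fix x assume "x \<in> \<Union>C"
      then obtain X where X: "X \<in> C" "x \<in> X" by blast
      then show "norm x = 1" using C by (auto simp: subset_chain_def orthonormal_def)
      fix y assume "y \<in> \<Union>C" and xy: "x \<noteq> y"
      then obtain Y where Y: "Y \<in> C" "y \<in> Y" by blast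
      have "X \<subseteq> Y \<or> Y \<subseteq> X" using C X Y by (auto simp: subset_chain_def)
      then obtain Z where "Z \<in> C" "x \<in> Z" "y \<in> Z" using X Y by blast
      then show "cinner x y = 0" using C xy by (auto simp: subset_chain_def orthonormal_def)
    qed
    then show "\<Union>C \<in> ?A" using C by (auto simp: subset_chain_def)
  qed
  then obtain B where BA: "B \<in> ?A" and BX: "\<forall>X\<in>?A. B \<subseteq> X \<longrightarrow> X = B" ..
  have B: "B \<subseteq> M" "orthonormal B" using BA by auto
  have mx: "X = B" if "X \<subseteq> M" "orthonormal X" "B \<subseteq> X" for X using BX that by simp
  have "ccspan B = M"
  proof (rule ccontr)
    assume "ccspan B \<noteq> M"
    moreover have sub: "ccspan B \<subseteq> M" by (rule ccspan_minimal[OF M B(1)])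
    ultimately obtain x where x: "x \<in> M" "x \<notin> ccspan B" by blast
    note cB = closed_csubspace_ccspan[of B]
    define w where "w = x - proj (ccspan B) x"
    have wM: "w \<in> M" unfolding w_def using closed_csubspaceD(7)[OF M x(1)] proj_in[OF cB] sub by blast
    have "w \<in> ortho (ccspan B)" unfolding w_def by (rule proj_ortho[OF cB])
    then have wo: "cinner w y = 0" if "y \<in> B" for y using that ccspan_superset[of B] by (auto simp: ortho_def)
    have w0: "w \<noteq> 0" using x(2) proj_in[OF cB, of x] by (auto simp: w_def)
    define u where "u = complex_of_real (1 / norm w) *\<^sub>C w"
    have nu: "norm u = 1" using w0 by (simp add: u_def norm_scaleC norm_divide)
    have uo: "cinner u y = 0" "cinner y u = 0" if "y \<in> B" for y
      using wo[OF that] by (simp_all add: u_def cinner_scaleC_left cinner_scaleC_right cinner_eq_0_commute)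
    have "insert u B = B"
    proof (rule mx)
      show "insert u B \<subseteq> M" using B wM closed_csubspaceD(3)[OF M] by (auto simp: u_def)
      show "orthonormal (insert u B)" using B(2) nu uo by (auto simp: orthonormal_def)
    qed auto
    then have "cinner u u = 0" using uo by blast
    then show False using nu by (simp add: cinner_self)
  qed
  then show ?thesis using B by (auto simp: is_onb_iff)
qed

lemma proj_finite_orthonormal:
  assumes F: "finite F" "orthonormal F"
  shows "proj (ccspan F) x = (\<Sum>u\<in>F. cinner x u *\<^sub>C u)"
proof (rule proj_eqI[OF closed_csubspace_ccspan])
  show "(\<Sum>u\<in>F. cinner x u *\<^sub>C u) \<in> ccspan F"
    using ccspan_superset[of F]
    by (intro closed_csubspace_sum closed_csubspaceD(3) closed_csubspace_ccspan) auto
  have "cinner (x - (\<Sum>u\<in>F. cinner x u *\<^sub>C u)) v = 0" if v: "v \<in> F" for v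
  proof -
    have "(\<Sum>u\<in>F. cinner x u * cinner u v) = (\<Sum>u\<in>F. if u = v then cinner x u else 0)"
      using v by (intro sum.cong) (auto simp: orthonormal_cinner[OF F(2)])
    then show ?thesis
      using F(1) v by (simp add: cinner.diff_left cinner.sum_left cinner_scaleC_left)
  qed
  then show "x - (\<Sum>u\<in>F. cinner x u *\<^sub>C u) \<in> ortho (ccspan F)"
    unfolding ortho_ccspan by (simp add: ortho_def)
qed

lemma norm_sq_proj_finite_orthonormal:
  assumes F: "finite F" "orthonormal F"
  shows "(norm (proj (ccspan F) x))\<^sup>2 = (\<Sum>u\<in>F. (cmod (cinner x u))\<^sup>2)"
  unfolding proj_finite_orthonormal[OF assms]
  using F by (subst norm_sq_sum_orth)
    (auto simp: cinner_scaleC_left cinner_scaleC_right norm_scaleC orthonormal_def power_mult_distrib)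

lemma bessel:
  assumes "finite F" "orthonormal F"
  shows "(\<Sum>u\<in>F. (cmod (cinner x u))\<^sup>2) \<le> (norm x)\<^sup>2"
  using norm_proj_le[OF closed_csubspace_ccspan, of F x]
  by (simp add: norm_sq_proj_finite_orthonormal[OF assms, symmetric] power_mono)

lemma norm_proj_minimal:
  assumes M: "closed_csubspace M" and y: "y \<in> M"
  shows "norm (x - proj M x) \<le> norm (x - y)"
proof -
  have "cinner (x - proj M x) (proj M x - y) = 0"
    using proj_ortho[OF M, of x] closed_csubspaceD(7)[OF M proj_in[OF M] y] by (simp add: ortho_def)
  from norm_sq_add_orth[OF this] show ?thesis
    by (intro power2_le_imp_le[of "norm (x - proj M x)" "norm (x - y)"]) auto
qed

text \<open>An epsilon form of Parseval avoids sums over bases of arbitrary cardinality. A finite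
  combination close to x is never closer than the projection onto the span of the same vectors, and
  the norm of that projection is a finite Bessel sum.\<close>

lemma parseval_approx:
  assumes B: "is_onb M B" and x: "x \<in> M" and e: "e > 0"
  shows "\<exists>F. finite F \<and> F \<subseteq> B \<and> (norm x)\<^sup>2 \<le> (\<Sum>u\<in>F. (cmod (cinner x u))\<^sup>2) + e"
proof -
  have "x \<in> closure (cspan B)" using B x by (auto simp: is_onb_iff ccspan_def)
  then obtain y where y: "y \<in> cspan B" "dist y x < sqrt e"
    using e unfolding closure_approachable by (meson real_sqrt_gt_zero)
  then obtain F c where F: "finite F" "F \<subseteq> B" "y = (\<Sum>u\<in>F. c u *\<^sub>C u)" unfolding cspan_def by blast
  have o: "orthonormal F" using B F orthonormal_subset by (auto simp: is_onb_iff)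
  have "y \<in> ccspan F"
    unfolding F(3) using ccspan_superset[of F]
    by (intro closed_csubspace_sum closed_csubspaceD(3) closed_csubspace_ccspan) auto
  then have "norm (x - proj (ccspan F) x) \<le> norm (x - y)"
    by (rule norm_proj_minimal[OF closed_csubspace_ccspan])
  also have "\<dots> < sqrt e" using y(2) by (simp add: dist_norm norm_minus_commute)
  finally have "(norm (x - proj (ccspan F) x))\<^sup>2 \<le> (sqrt e)\<^sup>2" by (intro power_mono) auto
  then have "(norm x)\<^sup>2 \<le> (norm (proj (ccspan F) x))\<^sup>2 + e"
    using norm_sq_proj[OF closed_csubspace_ccspan, of x F] e by simp
  then show ?thesis using F by (auto simp: norm_sq_proj_finite_orthonormal[OF F(1) o])
qed

lemma countable_card_le_infinite:
  assumes "countable Y" "infinite B" shows "(card_of Y, card_of B) \<in> ordLeq"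
proof -
  obtain f :: "_ \<Rightarrow> nat" where f: "inj_on f Y" using assms(1) by (auto simp: countable_def)
  obtain g :: "nat \<Rightarrow> _" where g: "inj g" "range g \<subseteq> B"
    using infinite_countable_subset[OF assms(2)] by blast
  have "inj_on (g \<circ> f) Y" "(g \<circ> f) ` Y \<subseteq> B"
    using f g by (auto simp: inj_on_def)
  then show ?thesis using card_of_ordLeq by blast
qed

text \<open>For finite B, summing |<q, u>|^2 over both sets and using Parseval in one order and
  Bessel in the other gives the count. For infinite B, each basis vector is non-orthogonal to only
  countably many members of Q, and no member of Q is orthogonal to all of B, so Q is covered by |B|
  many countable sets.\<close>

lemma orthonormal_card_le_onb:
  assumes Q: "orthonormal Q" "Q \<subseteq> M" and B: "is_onb M B"
  shows "(card_of Q, card_of B) \<in> ordLeq"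
proof (cases "finite B")
  case True
  have oB: "orthonormal B" using B by (simp add: is_onb_iff)
  have le: "(norm x)\<^sup>2 \<le> (\<Sum>u\<in>B. (cmod (cinner x u))\<^sup>2)" if x: "x \<in> M" for x
  proof (rule field_le_epsilon)
    fix e :: real assume "e > 0"
    then obtain F where F: "finite F" "F \<subseteq> B" "(norm x)\<^sup>2 \<le> (\<Sum>u\<in>F. (cmod (cinner x u))\<^sup>2) + e"
      using parseval_approx[OF B x] by meson
    have "(\<Sum>u\<in>F. (cmod (cinner x u))\<^sup>2) \<le> (\<Sum>u\<in>B. (cmod (cinner x u))\<^sup>2)"
      by (rule sum_mono2) (use F True in auto)
    then show "(norm x)\<^sup>2 \<le> (\<Sum>u\<in>B. (cmod (cinner x u))\<^sup>2) + e" using F by linarith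
  qed
  have "card F \<le> card B" if F: "F \<subseteq> Q" "finite F" for F
  proof -
    have oF: "orthonormal F" using Q F orthonormal_subset by blast
    have "real (card F) = (\<Sum>q\<in>F. (norm q)\<^sup>2)" using oF by (simp add: orthonormal_def)
    also have "\<dots> \<le> (\<Sum>q\<in>F. \<Sum>u\<in>B. (cmod (cinner q u))\<^sup>2)" by (intro sum_mono le) (use F Q in auto)
    also have "\<dots> = (\<Sum>u\<in>B. \<Sum>q\<in>F. (cmod (cinner u q))\<^sup>2)"
      by (subst sum.swap, intro sum.cong refl) (metis cinner_commute complex_mod_cnj)
    also have "\<dots> \<le> (\<Sum>u\<in>B. (norm u)\<^sup>2)" by (intro sum_mono bessel oF F)
    also have "\<dots> = real (card B)" using oB by (simp add: orthonormal_def)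
    finally show ?thesis by simp
  qed
  then have "finite Q \<and> card Q \<le> card B" using finite_if_finite_subsets_card_bdd by blast
  then obtain f where "f ` Q \<subseteq> B" "inj_on f Q" using card_le_inj[of Q B] True by blast
  then show ?thesis using card_of_ordLeq by blast
next
  case False
  have "Q \<subseteq> (\<Union>u\<in>B. {q \<in> Q. cinner u q \<noteq> 0})"
  proof
    fix q assume q: "q \<in> Q"
    show "q \<in> (\<Union>u\<in>B. {q \<in> Q. cinner u q \<noteq> 0})"
    proof (rule ccontr)
      assume "\<not> ?thesis"
      then have "q \<in> ortho B" using q by (auto simp: ortho_def cinner_eq_0_commute)
      moreover have "q \<in> ccspan B" using q Q B by (auto simp: is_onb_iff)
      ultimately have "q = 0" using ortho_self[of q "ccspan B"] by (simp add: ortho_ccspan)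
      then show False using q Q by (auto simp: orthonormal_def)
    qed
  qed
  then have "(card_of Q, card_of (\<Union>u\<in>B. {q \<in> Q. cinner u q \<noteq> 0})) \<in> ordLeq" by (rule card_of_mono1)
  moreover have "(card_of (\<Union>u\<in>B. {q \<in> Q. cinner u q \<noteq> 0}), card_of B) \<in> ordLeq"
  proof (rule card_of_UNION_ordLeq_infinite[OF False], rule ordLeq_refl[OF card_of_Card_order], rule ballI)
    fix u
    have "(\<lambda>q. (cmod (cinner u q))\<^sup>2) summable_on Q"
      by (rule nonneg_bdd_above_summable_on)
        (auto intro!: bdd_aboveI[of _ "(norm u)\<^sup>2"] bessel orthonormal_subset[OF Q(1)])
    then have "countable {q \<in> Q. (cmod (cinner u q))\<^sup>2 \<noteq> 0}" by (rule summable_countable_real)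
    then show "(card_of {q \<in> Q. cinner u q \<noteq> 0}, card_of B) \<in> ordLeq"
      using False by (intro countable_card_le_infinite) auto
  qed
  ultimately show ?thesis by (rule ordLeq_transitive)
qed

text \<open>Any two bases dominate each other in cardinality, so the choice made inside
  \<open>hdim\<close> is immaterial.\<close>

lemma hdim_onb:
  assumes B: "is_onb M B" shows "(hdim M, card_of B) \<in> ordIso"
proof -
  have S: "is_onb M (SOME B. is_onb M B)" using B by (rule someI)
  have "B \<subseteq> M" "(SOME B. is_onb M B) \<subseteq> M"
    using B S ccspan_superset by (auto simp: is_onb_iff)
  moreover have "orthonormal B" "orthonormal (SOME B. is_onb M B)"
    using B S unfolding is_onb_iff by auto
  ultimately show ?thesis
    unfolding hdim_def ordIso_iff_ordLeq
    using orthonormal_card_le_onb[OF _ _ B] orthonormal_card_le_onb[OF _ _ S] by blast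
qed

lemma isometry_orthonormal:
  assumes "closed_csubspace M" "isometry_on M V" "B \<subseteq> M" "orthonormal B"
  shows "orthonormal (V ` B)" "inj_on V B"
proof -
  have c: "cinner (V x) (V y) = cinner x y" if "x \<in> B" "y \<in> B" for x y
    using isometric_cinner[OF assms(1,2)] that assms(3) by blast
  show inj: "inj_on V B"
  proof (rule inj_onI, rule ccontr)
    fix x y assume xy: "x \<in> B" "y \<in> B" "V x = V y" "x \<noteq> y"
    then have "cinner x x = cinner x y" using c[of x x] c[of x y] by simp
    then show False using xy orthonormal_cinner[OF assms(4)] by simp
  qed
  show "orthonormal (V ` B)"
    unfolding orthonormal_def
    using assms(2,3,4) c by (auto simp: isometry_on_def orthonormal_def subset_iff)
qed

lemma hdim_isometry_le:
  assumes M: "closed_csubspace M" and N: "closed_csubspace N"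
    and V: "isometry_on M V" "V ` M \<subseteq> N"
  shows "(hdim M, hdim N) \<in> ordLeq"
proof -
  obtain B where B: "is_onb M B" using onb_exists[OF M] by blast
  obtain C where C: "is_onb N C" using onb_exists[OF N] by blast
  have BM: "B \<subseteq> M" "orthonormal B" using B ccspan_superset by (auto simp: is_onb_iff)
  have "(card_of B, card_of (V ` B)) \<in> ordIso"
    using isometry_orthonormal(2)[OF M V(1) BM] card_of_ordIso by (auto simp: bij_betw_def)
  moreover have "(card_of (V ` B), card_of C) \<in> ordLeq"
    using isometry_orthonormal(1)[OF M V(1) BM] V(2) BM
    by (intro orthonormal_card_le_onb[OF _ _ C]) auto
  ultimately show ?thesis
    using hdim_onb[OF B] hdim_onb[OF C] ordIso_symmetric ordIso_ordLeq_trans ordLeq_ordIso_trans by meson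
qed

lemma unitary_between_inv:
  assumes M: "closed_csubspace M" and U: "unitary_between M N U"
  shows "unitary_between N M (inv_into M U)"
proof -
  have iso: "isometry_on M U" and im: "U ` M = N" using U by (auto simp: unitary_between_def)
  have inj: "inj_on U M"
  proof (rule inj_onI)
    fix x y assume xy: "x \<in> M" "y \<in> M" "U x = U y"
    then have m: "- y \<in> M" "x + - y \<in> M"
      using closed_csubspaceD[OF M] by auto
    have "U (- 1 *\<^sub>C y) = - 1 *\<^sub>C U y" using iso xy(2) unfolding isometry_on_def by blast
    then have "U (- y) = - U y" by (simp add: scaleC_minus_one)
    moreover have "U (x + - y) = U x + U (- y)" using iso xy m unfolding isometry_on_def by blast
    ultimately have "U (x + - y) = 0" using xy by simp
    then have "norm (x + - y) = 0" using iso m unfolding isometry_on_def by force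
    then show "x = y" by simp
  qed
  let ?W = "inv_into M U"
  have W: "?W (U x) = x" if "x \<in> M" for x using inj that by (rule inv_into_f_f)
  have "isometry_on N ?W"
    unfolding isometry_on_def im[symmetric]
  proof (intro conjI ballI allI)
    fix a b c assume "a \<in> U ` M"
    then obtain x where x: "a = U x" "x \<in> M" by blast
    have s: "c *\<^sub>C a = U (c *\<^sub>C x)" "norm (U x) = norm x" using iso x by (auto simp: isometry_on_def)
    show "norm (?W a) = norm a" using x s W by simp
    show "?W (c *\<^sub>C a) = c *\<^sub>C ?W a" using x s W closed_csubspaceD(3)[OF M] by simp
    assume "b \<in> U ` M"
    then obtain y where y: "b = U y" "y \<in> M" by blast
    have "a + b = U (x + y)" using iso x y by (auto simp: isometry_on_def)
    then show "?W (a + b) = ?W a + ?W b" using x y W closed_csubspaceD(2)[OF M] by simp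
  qed
  moreover have "?W ` N = M" unfolding im[symmetric] using W by (auto simp: image_iff)
  ultimately show ?thesis by (simp add: unitary_between_def)
qed

lemma hdim_unitary:
  assumes "closed_csubspace M" "closed_csubspace N" "unitary_between M N U"
  shows "(hdim M, hdim N) \<in> ordIso"
  using hdim_isometry_le[OF assms(1,2), of U] hdim_isometry_le[OF assms(2,1), of "inv_into M U"]
    unitary_between_inv[OF assms(1,3)] assms(3)
  by (auto simp: ordIso_iff_ordLeq unitary_between_def)

section \<open>Isometries determined by Gram matrices\<close>

text \<open>The closed graph of the map taking combinations of g to the same combinations of c. It
  is kept as a relation because a vector may be a combination in several ways; single-valuedness is
  a consequence of equal Gram matrices.\<close>

definition gram_graph :: "'i set \<Rightarrow> ('i \<Rightarrow> 'a :: chilbert_space) \<Rightarrow> ('i \<Rightarrow> 'b :: chilbert_space) \<Rightarrow> ('a \<times> 'b) set"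
  where "gram_graph I g c = closure
    {((\<Sum>i\<in>F. a i *\<^sub>C g i), (\<Sum>i\<in>F. a i *\<^sub>C c i)) |F a. finite F \<and> F \<subseteq> I}"

lemma gram_graph_seq:
  "(x, y) \<in> gram_graph I g c \<longleftrightarrow> (\<exists>F a. (\<forall>n::nat. finite (F n) \<and> F n \<subseteq> I) \<and>
    (\<lambda>n. \<Sum>i\<in>F n. a n i *\<^sub>C g i) \<longlonglongrightarrow> x \<and> (\<lambda>n. \<Sum>i\<in>F n. a n i *\<^sub>C c i) \<longlonglongrightarrow> y)"
  (is "_ \<longleftrightarrow> ?R")
proof
  assume "(x, y) \<in> gram_graph I g c"
  then obtain f where f: "\<And>n. \<exists>F a. f n = ((\<Sum>i\<in>F. a i *\<^sub>C g i), (\<Sum>i\<in>F. a i *\<^sub>C c i)) \<and> finite F \<and> F \<subseteq> I"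
      "f \<longlonglongrightarrow> (x, y)"
    unfolding gram_graph_def closure_sequential by auto
  from f(1) obtain F a where Fa: "\<And>n. f n = ((\<Sum>i\<in>F n. a n i *\<^sub>C g i), (\<Sum>i\<in>F n. a n i *\<^sub>C c i))"
      "\<And>n. finite (F n) \<and> F n \<subseteq> I"
    by metis
  then show ?R
    using tendsto_fst[OF f(2)] tendsto_snd[OF f(2)]
    by (intro exI[of _ F] exI[of _ a]) (simp add: Fa)
next
  assume ?R
  then obtain F a where Fa: "\<forall>n::nat. finite (F n) \<and> F n \<subseteq> I"
      "(\<lambda>n. \<Sum>i\<in>F n. a n i *\<^sub>C g i) \<longlonglongrightarrow> x" "(\<lambda>n. \<Sum>i\<in>F n. a n i *\<^sub>C c i) \<longlonglongrightarrow> y"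
    by blast
  show "(x, y) \<in> gram_graph I g c"
    unfolding gram_graph_def closure_sequential
    by (rule exI[of _ "\<lambda>n. ((\<Sum>i\<in>F n. a n i *\<^sub>C g i), (\<Sum>i\<in>F n. a n i *\<^sub>C c i))"])
      (use Fa in \<open>auto intro!: tendsto_Pair\<close>)
qed

text \<open>This symmetry turns the description of the domain into surjectivity.\<close>

lemma gram_graph_swap: "(x, y) \<in> gram_graph I g c \<longleftrightarrow> (y, x) \<in> gram_graph I c g"
  unfolding gram_graph_seq by blast

lemma cspan_image:
  "x \<in> cspan (g ` I) \<Longrightarrow> \<exists>F a. finite F \<and> F \<subseteq> I \<and> x = (\<Sum>i\<in>F. a i *\<^sub>C g i)"
proof -
  assume "x \<in> cspan (g ` I)"
  then obtain G b where G: "finite G" "G \<subseteq> g ` I" "x = (\<Sum>y\<in>G. b y *\<^sub>C y)" unfolding cspan_def by blast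
  then obtain F where F: "F \<subseteq> I" "inj_on g F" "G = g ` F" by (auto simp: subset_image_inj)
  show ?thesis
    using F G by (intro exI[of _ F] exI[of _ "\<lambda>i. b (g i)"]) (auto simp: sum.reindex finite_image_iff)
qed

context
  fixes I :: "'i set" and g :: "'i \<Rightarrow> 'a :: chilbert_space" and c :: "'i \<Rightarrow> 'b :: chilbert_space"
  assumes gram: "\<forall>i\<in>I. \<forall>j\<in>I. cinner (g i) (g j) = cinner (c i) (c j)"
begin

lemma gram_sum_norm:
  assumes "finite F" "F \<subseteq> I"
  shows "norm (\<Sum>i\<in>F. a i *\<^sub>C g i) = norm (\<Sum>i\<in>F. a i *\<^sub>C c i)"
proof -
  have "cinner (\<Sum>i\<in>F. a i *\<^sub>C g i) (\<Sum>i\<in>F. a i *\<^sub>C g i) = cinner (\<Sum>i\<in>F. a i *\<^sub>C c i) (\<Sum>i\<in>F. a i *\<^sub>C c i)"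
    unfolding cinner.sum_left cinner.sum_right cinner_scaleC_left cinner_scaleC_right
    using gram assms(2) by (intro sum.cong refl) (simp add: subset_iff)
  then have "(norm (\<Sum>i\<in>F. a i *\<^sub>C g i))\<^sup>2 = (norm (\<Sum>i\<in>F. a i *\<^sub>C c i))\<^sup>2"
    by (simp add: norm_sq_cinner)
  then show ?thesis by simp
qed

text \<open>Both coordinates of the graph must be combined with one common index set and one
  coefficient function, so the coefficients are padded by zero on the union.\<close>

lemma gram_sum_combine:
  assumes "finite F" "F \<subseteq> I" "finite G" "G \<subseteq> I"
  shows "\<exists>H d. finite H \<and> H \<subseteq> I
    \<and> s *\<^sub>C (\<Sum>i\<in>F. a i *\<^sub>C g i) + t *\<^sub>C (\<Sum>i\<in>G. b i *\<^sub>C g i) = (\<Sum>i\<in>H. d i *\<^sub>C g i)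
    \<and> s *\<^sub>C (\<Sum>i\<in>F. a i *\<^sub>C c i) + t *\<^sub>C (\<Sum>i\<in>G. b i *\<^sub>C c i) = (\<Sum>i\<in>H. d i *\<^sub>C c i)"
proof -
  let ?a = "\<lambda>i. if i \<in> F then a i else 0" and ?b = "\<lambda>i. if i \<in> G then b i else 0"
  have *: "s *\<^sub>C (\<Sum>i\<in>F. a i *\<^sub>C h i) + t *\<^sub>C (\<Sum>i\<in>G. b i *\<^sub>C h i)
      = (\<Sum>i\<in>F \<union> G. (s * ?a i + t * ?b i) *\<^sub>C h i)" for h :: "'i \<Rightarrow> 'z :: chilbert_space"
  proof -
    have "(\<Sum>i\<in>F. a i *\<^sub>C h i) = (\<Sum>i\<in>F \<union> G. ?a i *\<^sub>C h i)"
      using assms by (intro sum.mono_neutral_cong_left) auto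
    moreover have "(\<Sum>i\<in>G. b i *\<^sub>C h i) = (\<Sum>i\<in>F \<union> G. ?b i *\<^sub>C h i)"
      using assms by (intro sum.mono_neutral_cong_left) auto
    ultimately show ?thesis
      by (simp only: scaleC.sum_right scaleC_scaleC scaleC_add_left sum.distrib)
  qed
  show ?thesis
    using assms by (intro exI[of _ "F \<union> G"] exI[of _ "\<lambda>i. s * ?a i + t * ?b i"]) (simp only: *, simp)
qed

lemma gram_graph_comb:
  assumes "(x, y) \<in> gram_graph I g c" "(x', y') \<in> gram_graph I g c"
  shows "(s *\<^sub>C x + t *\<^sub>C x', s *\<^sub>C y + t *\<^sub>C y') \<in> gram_graph I g c"
proof -
  from assms(1)[unfolded gram_graph_seq] obtain F a where F: "\<And>n::nat. finite (F n)" "\<And>n. F n \<subseteq> I"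
      "(\<lambda>n. \<Sum>i\<in>F n. a n i *\<^sub>C g i) \<longlonglongrightarrow> x" "(\<lambda>n. \<Sum>i\<in>F n. a n i *\<^sub>C c i) \<longlonglongrightarrow> y" by blast
  from assms(2)[unfolded gram_graph_seq] obtain G b where G: "\<And>n::nat. finite (G n)" "\<And>n. G n \<subseteq> I"
      "(\<lambda>n. \<Sum>i\<in>G n. b n i *\<^sub>C g i) \<longlonglongrightarrow> x'" "(\<lambda>n. \<Sum>i\<in>G n. b n i *\<^sub>C c i) \<longlonglongrightarrow> y'" by blast
  have "\<forall>n. \<exists>H d. finite H \<and> H \<subseteq> I
    \<and> s *\<^sub>C (\<Sum>i\<in>F n. a n i *\<^sub>C g i) + t *\<^sub>C (\<Sum>i\<in>G n. b n i *\<^sub>C g i) = (\<Sum>i\<in>H. d i *\<^sub>C g i)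
    \<and> s *\<^sub>C (\<Sum>i\<in>F n. a n i *\<^sub>C c i) + t *\<^sub>C (\<Sum>i\<in>G n. b n i *\<^sub>C c i) = (\<Sum>i\<in>H. d i *\<^sub>C c i)"
    by (intro allI gram_sum_combine F G)
  then obtain H d where H: "\<And>n. finite (H n) \<and> H n \<subseteq> I"
    "\<And>n. s *\<^sub>C (\<Sum>i\<in>F n. a n i *\<^sub>C g i) + t *\<^sub>C (\<Sum>i\<in>G n. b n i *\<^sub>C g i) = (\<Sum>i\<in>H n. d n i *\<^sub>C g i)"
    "\<And>n. s *\<^sub>C (\<Sum>i\<in>F n. a n i *\<^sub>C c i) + t *\<^sub>C (\<Sum>i\<in>G n. b n i *\<^sub>C c i) = (\<Sum>i\<in>H n. d n i *\<^sub>C c i)"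
    by metis
  have "(\<lambda>n. \<Sum>i\<in>H n. d n i *\<^sub>C g i) \<longlonglongrightarrow> s *\<^sub>C x + t *\<^sub>C x'"
    unfolding H(2)[symmetric] by (intro tendsto_add scaleC.tendsto tendsto_const F G)
  moreover have "(\<lambda>n. \<Sum>i\<in>H n. d n i *\<^sub>C c i) \<longlonglongrightarrow> s *\<^sub>C y + t *\<^sub>C y'"
    unfolding H(3)[symmetric] by (intro tendsto_add scaleC.tendsto tendsto_const F G)
  ultimately show ?thesis
    unfolding gram_graph_seq using H(1) by blast
qed

lemma gram_graph_norm:
  assumes "(x, y) \<in> gram_graph I g c" shows "norm x = norm y"
proof -
  from assms[unfolded gram_graph_seq] obtain F a where F: "\<And>n::nat. finite (F n)" "\<And>n. F n \<subseteq> I"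
      "(\<lambda>n. \<Sum>i\<in>F n. a n i *\<^sub>C g i) \<longlonglongrightarrow> x" "(\<lambda>n. \<Sum>i\<in>F n. a n i *\<^sub>C c i) \<longlonglongrightarrow> y" by blast
  have "(\<lambda>n. norm (\<Sum>i\<in>F n. a n i *\<^sub>C g i)) \<longlonglongrightarrow> norm x" by (intro tendsto_norm F)
  moreover have "(\<lambda>n. norm (\<Sum>i\<in>F n. a n i *\<^sub>C g i)) \<longlonglongrightarrow> norm y"
    unfolding gram_sum_norm[OF F(1,2)] by (intro tendsto_norm F)
  ultimately show ?thesis by (rule LIMSEQ_unique)
qed

lemma gram_graph_unique:
  assumes "(x, y) \<in> gram_graph I g c" "(x, y') \<in> gram_graph I g c" shows "y = y'"
  using gram_graph_norm[OF gram_graph_comb[OF assms, of 1 "- 1"]]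
  by (simp add: scaleC_minus_one)

text \<open>Approximants of x from the span of g have companions in the span of c whose differences
  have the same norms; a convergent sequence on one side is therefore Cauchy on the other.\<close>

lemma gram_graph_dom: "x \<in> ccspan (g ` I) \<longleftrightarrow> (\<exists>y. (x, y) \<in> gram_graph I g c)"
proof
  assume "\<exists>y. (x, y) \<in> gram_graph I g c"
  then obtain F a where F: "\<And>n::nat. finite (F n)" "\<And>n. F n \<subseteq> I"
      "(\<lambda>n. \<Sum>i\<in>F n. a n i *\<^sub>C g i) \<longlonglongrightarrow> x" unfolding gram_graph_seq by blast
  have "(\<Sum>i\<in>F n. a n i *\<^sub>C g i) \<in> ccspan (g ` I)" for n
    using F(2) ccspan_superset[of "g ` I"]
    by (intro closed_csubspace_sum closed_csubspaceD(3) closed_csubspace_ccspan) blast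
  then show "x \<in> ccspan (g ` I)"
    using closed_sequentially[OF closed_csubspaceD(4)[OF closed_csubspace_ccspan] _ F(3)] by blast
next
  assume "x \<in> ccspan (g ` I)"
  then obtain f where f: "\<And>n. f n \<in> cspan (g ` I)" "f \<longlonglongrightarrow> x"
    unfolding ccspan_def closure_sequential by blast
  from f(1) have "\<forall>n. \<exists>F a. finite F \<and> F \<subseteq> I \<and> f n = (\<Sum>i\<in>F. a i *\<^sub>C g i)"
    using cspan_image by blast
  then obtain F a where F: "\<And>n. finite (F n)" "\<And>n. F n \<subseteq> I" "\<And>n. f n = (\<Sum>i\<in>F n. a n i *\<^sub>C g i)" by metis
  define k where "k n = (\<Sum>i\<in>F n. a n i *\<^sub>C c i)" for n
  have in_graph: "(f n, k n) \<in> gram_graph I g c" for n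
    unfolding gram_graph_def F(3) k_def using F(1,2) by (intro subsetD[OF closure_subset]) blast
  have nrm: "norm (k m - k n) = norm (f m - f n)" for m n
    using gram_graph_norm[OF gram_graph_comb[OF in_graph[of m] in_graph[of n], of 1 "- 1"]]
    by (simp add: scaleC_minus_one)
  have "Cauchy f" using f(2) by (rule LIMSEQ_imp_Cauchy)
  then have "Cauchy k" by (simp add: Cauchy_def dist_norm nrm)
  then obtain y where "k \<longlonglongrightarrow> y" using Cauchy_convergent convergent_def by blast
  then have "(x, y) \<in> gram_graph I g c"
    unfolding gram_graph_seq using F f(2) by (intro exI[of _ F] exI[of _ a]) (simp add: k_def[symmetric] F(3)[symmetric])
  then show "\<exists>y. (x, y) \<in> gram_graph I g c" by blast
qed

end

lemma gram_unitary:
  fixes g :: "'i \<Rightarrow> 'a :: chilbert_space" and c :: "'i \<Rightarrow> 'b :: chilbert_space"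
  assumes gram: "\<forall>i\<in>I. \<forall>j\<in>I. cinner (g i) (g j) = cinner (c i) (c j)"
  shows "\<exists>W. bounded_clinear W \<and> unitary_between (ccspan (g ` I)) (ccspan (c ` I)) W \<and> (\<forall>i\<in>I. W (g i) = c i)"
proof -
  define M where "M = ccspan (g ` I)"
  have M: "closed_csubspace M" unfolding M_def by (rule closed_csubspace_ccspan)
  have gram': "\<forall>i\<in>I. \<forall>j\<in>I. cinner (c i) (c j) = cinner (g i) (g j)" using gram by simp
  \<comment> \<open>Precomposing with the projection onto M makes the map bounded and linear on the
    whole space, while it is isometric only on M.\<close>
  define W where "W x = (THE y. (proj M x, y) \<in> gram_graph I g c)" for x
  note uniq = gram_graph_unique[OF gram]
  have W: "(proj M x, W x) \<in> gram_graph I g c" for x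
  proof -
    obtain y where y: "(proj M x, y) \<in> gram_graph I g c"
      using proj_in[OF M, of x] gram_graph_dom[OF gram] unfolding M_def by blast
    show ?thesis unfolding W_def by (rule theI[of _ y]) (use y uniq in blast)+
  qed
  have W_eq: "W x = y" if "x \<in> M" "(x, y) \<in> gram_graph I g c" for x y
    using uniq[OF _ that(2)] W[of x] by (simp add: proj_id[OF M that(1)])
  note P = bounded_clinear_proj[OF M]
  have bW: "bounded_clinear W"
  proof (rule bounded_clinearI[of _ 1])
    fix x y d
    show "W (x + y) = W x + W y"
      using uniq[OF W[of "x + y"]] gram_graph_comb[OF gram W[of x] W[of y], of 1 1]
      by (simp add: bounded_clinear_add[OF P])
    show "W (d *\<^sub>C x) = d *\<^sub>C W x"
      using uniq[OF W[of "d *\<^sub>C x"]] gram_graph_comb[OF gram W[of x] W[of x], of d 0]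
      by (simp add: bounded_clinear_scaleC[OF P])
    show "norm (W x) \<le> 1 * norm x"
      using gram_graph_norm[OF gram W[of x]] norm_proj_le[OF M, of x] by simp
  qed
  have iso: "isometry_on M W"
    unfolding isometry_on_def
    using gram_graph_norm[OF gram W, symmetric] proj_id[OF M]
    by (simp add: bounded_clinear_add[OF bW] bounded_clinear_scaleC[OF bW])
  have "W ` M = ccspan (c ` I)"
  proof (intro set_eqI iffI)
    fix y assume "y \<in> W ` M"
    then obtain x where "y = W x" by blast
    then show "y \<in> ccspan (c ` I)"
      using W[of x] gram_graph_dom[OF gram'] gram_graph_swap by blast
  next
    fix y assume "y \<in> ccspan (c ` I)"
    then obtain x where x: "(x, y) \<in> gram_graph I g c"
      using gram_graph_dom[OF gram'] gram_graph_swap by blast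
    then have "x \<in> M" unfolding M_def using gram_graph_dom[OF gram] by blast
    then show "y \<in> W ` M" using W_eq[OF _ x] by blast
  qed
  moreover have "W (g i) = c i" if i: "i \<in> I" for i
  proof (rule W_eq)
    show "g i \<in> M" unfolding M_def using ccspan_superset[of "g ` I"] i by auto
    show "(g i, c i) \<in> gram_graph I g c"
      unfolding gram_graph_def
      by (rule subsetD[OF closure_subset], rule CollectI, rule exI[of _ "{i}"], rule exI[of _ "\<lambda>_. 1"])
        (use i in auto)
  qed
  ultimately show ?thesis using bW iso unfolding M_def unitary_between_def by blast
qed

lemma closed_csubspace_closure_range:
  assumes "bounded_clinear A" shows "closure (range A) = ccspan (range A)"
proof -
  have "cspan (range A) = range A"
  proof
    show "cspan (range A) \<subseteq> range A"
    proof
      fix y assume "y \<in> cspan (range A)"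
      then obtain F a where "y = (\<Sum>i\<in>F. a i *\<^sub>C A i)" using cspan_image by blast
      then have "y = A (\<Sum>i\<in>F. a i *\<^sub>C i)"
        by (simp add: bounded_clinear_sum[OF assms] bounded_clinear_scaleC[OF assms])
      then show "y \<in> range A" by blast
    qed
    show "range A \<subseteq> cspan (range A)" by (simp add: cspan_eq_span cvs.span_superset)
  qed
  then show ?thesis by (simp add: ccspan_def)
qed

text \<open>Equal norms for all h give equal Gram matrices by polarization. In the applications A is
  the defect operator and C the vacuum component of an isometry.\<close>

lemma equal_norm_unitary:
  fixes A :: "'h :: chilbert_space \<Rightarrow> 'a :: chilbert_space" and C :: "'h \<Rightarrow> 'b :: chilbert_space"
  assumes A: "bounded_clinear A" and C: "bounded_clinear C" and eq: "\<And>h. norm (A h) = norm (C h)"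
  shows "\<exists>W. bounded_clinear W \<and> unitary_between (closure (range A)) (closure (range C)) W \<and> (\<forall>h. W (A h) = C h)"
proof -
  have re: "Re (cinner (A x) (A y)) = Re (cinner (C x) (C y))" for x y
    using norm_sq_add[of "A x" "A y"] norm_sq_add[of "C x" "C y"] eq[of "x + y"] eq[of x] eq[of y]
    by (simp add: bounded_clinear_add[OF A] bounded_clinear_add[OF C])
  have "cinner (A x) (A y) = cinner (C x) (C y)" for x y
  proof -
    have "Re (cnj \<i> * cinner (A x) (A y)) = Re (cnj \<i> * cinner (C x) (C y))"
      using re[of x "\<i> *\<^sub>C y"]
      by (simp only: bounded_clinear_scaleC[OF A] bounded_clinear_scaleC[OF C] cinner_scaleC_right)
    then show ?thesis using re[of x y] by (simp add: complex_eq_iff)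
  qed
  then show ?thesis
    using gram_unitary[of UNIV A C]
    by (simp add: closed_csubspace_closure_range[OF A] closed_csubspace_closure_range[OF C])
qed

text \<open>A bijection between orthonormal bases preserves the Gram matrix, so it extends to a
  unitary.\<close>

lemma hdim_eq_unitary:
  assumes M: "closed_csubspace M" and N: "closed_csubspace N" and eq: "(hdim M, hdim N) \<in> ordIso"
  shows "\<exists>W. bounded_clinear W \<and> unitary_between M N W"
proof -
  obtain B where B: "is_onb M B" using onb_exists[OF M] by blast
  obtain C where C: "is_onb N C" using onb_exists[OF N] by blast
  have "(card_of B, card_of C) \<in> ordIso"
    using eq hdim_onb[OF B] hdim_onb[OF C] ordIso_symmetric ordIso_transitive by meson
  then obtain f where f: "bij_betw f B C" using card_of_ordIso by blast
  have "cinner x y = cinner (f x) (f y)" if "x \<in> B" "y \<in> B" for x y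
    using that f B C orthonormal_cinner[of B x y] orthonormal_cinner[of C "f x" "f y"]
    by (auto simp: is_onb_iff bij_betw_def inj_on_def)
  then have "\<forall>x\<in>B. \<forall>y\<in>B. cinner x y = cinner (f x) (f y)" by blast
  from gram_unitary[OF this] show ?thesis
    using f B C by (auto simp: is_onb_iff bij_betw_def)
qed

section \<open>Amplifications\<close>

lemma l2_eqI: "(\<And>i. l2_nth x i = l2_nth y i) \<Longrightarrow> x = y"
  by (simp add: l2_nth_inject[symmetric] fun_eq_iff)

lemma norm_l2_sq: "(norm x)\<^sup>2 = infsum (\<lambda>i. (norm (l2_nth x i))\<^sup>2) UNIV"
  by (simp add: norm_l2.rep_eq infsum_nonneg)

lemma l2_nth_sum_sq_le: "finite F \<Longrightarrow> (\<Sum>i\<in>F. (norm (l2_nth x i))\<^sup>2) \<le> (norm x)\<^sup>2"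
  unfolding norm_l2_sq by (rule sqsummable_finite_le[OF sqsummable_l2_nth])

lemma norm_l2_sq_leI:
  "(\<And>F. finite F \<Longrightarrow> (\<Sum>i\<in>F. (norm (l2_nth x i))\<^sup>2) \<le> C) \<Longrightarrow> (norm x)\<^sup>2 \<le> C"
  unfolding norm_l2_sq by (rule sqsummable_bound(2))

lemma norm_l2_nth_le: "norm (l2_nth x i) \<le> norm x"
  using l2_nth_sum_sq_le[of "{i}" x] by (auto intro: power2_le_imp_le[of "norm (l2_nth x i)"])

lemma bounded_clinear_l2_nth: "bounded_clinear (\<lambda>x. l2_nth x i)"
  by (rule bounded_clinearI[of _ 1]) (simp_all add: plus_l2.rep_eq scaleC_l2.rep_eq norm_l2_nth_le)

lemma sqsummable_comparison:
  assumes "sqsummable f" "\<And>i. norm (g i) \<le> K * norm (f i)"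
  shows "sqsummable g"
proof (rule sqsummable_bound)
  fix F :: "'a set" assume F: "finite F"
  have "(\<Sum>i\<in>F. (norm (g i))\<^sup>2) \<le> (\<Sum>i\<in>F. K\<^sup>2 * (norm (f i))\<^sup>2)"
    using assms(2) by (intro sum_mono) (simp add: power_mult_distrib[symmetric] power_mono)
  also have "\<dots> \<le> K\<^sup>2 * infsum (\<lambda>i. (norm (f i))\<^sup>2) UNIV"
    unfolding sum_distrib_left[symmetric] by (intro mult_left_mono sqsummable_finite_le assms F) auto
  finally show "(\<Sum>i\<in>F. (norm (g i))\<^sup>2) \<le> K\<^sup>2 * infsum (\<lambda>i. (norm (f i))\<^sup>2) UNIV" .
qed

lemma has_sum_in_closed_csubspace:
  assumes "closed_csubspace M" "(f has_sum s) A" "\<And>i. i \<in> A \<Longrightarrow> f i \<in> M"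
  shows "s \<in> M"
proof (rule Lim_in_closed_set[OF closed_csubspaceD(4)[OF assms(1)]])
  show "(sum f \<longlongrightarrow> s) (finite_subsets_at_top A)" using assms(2) by (simp add: has_sum_def)
  show "\<forall>\<^sub>F F in finite_subsets_at_top A. sum f F \<in> M"
    by (rule eventually_finite_subsets_at_top_weakI)
      (use assms in \<open>auto intro: closed_csubspace_sum\<close>)
qed simp

lemma ket_cinner: "cinner (ket i) (ket j) = (if i = j then 1 else 0)"
proof -
  have "infsum (\<lambda>k. cinner (if k = i then 1 else 0 :: complex) (if k = j then 1 else 0)) UNIV
      = infsum (\<lambda>k. if i = j then 1 else 0) {i}"
    by (rule infsum_cong_neutral) (auto simp: cinner_complex_def)
  then show ?thesis by (simp add: cinner_l2.rep_eq ket.rep_eq)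
qed

lemma cinner_ket_tens: "cinner x (ket i \<otimes>\<^sub>h d) = cinner (l2_nth x i) d"
proof -
  have "infsum (\<lambda>k. cinner (l2_nth x k) (l2_nth (ket i \<otimes>\<^sub>h d) k)) UNIV
      = infsum (\<lambda>k. cinner (l2_nth x k) d) {i}"
    by (rule infsum_cong_neutral) (auto simp: l2_nth_ket_tens)
  then show ?thesis by (simp add: cinner_l2.rep_eq)
qed

lemma norm_tens: "norm (x \<otimes>\<^sub>h d) = norm x * norm d"
proof -
  have "complex_of_real ((norm (x \<otimes>\<^sub>h d))\<^sup>2) = complex_of_real ((norm x * norm d)\<^sup>2)"
    unfolding cinner_self[symmetric] cinner_tens by (simp add: cinner_self power_mult_distrib)
  then have "(norm (x \<otimes>\<^sub>h d))\<^sup>2 = (norm x * norm d)\<^sup>2" by (simp only: of_real_eq_iff)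
  then show ?thesis by simp
qed

lemma ket_tens_complex: "ket i \<otimes>\<^sub>h c = c *\<^sub>C ket i"
  by (rule l2_eqI) (simp add: l2_nth_ket_tens scaleC_l2.rep_eq ket.rep_eq scaleC_complex_def)

lemma bounded_clinear_tens_left: "bounded_clinear (\<lambda>x. x \<otimes>\<^sub>h d)"
proof (rule bounded_clinearI[of _ "norm d"])
  fix x y :: "('a, complex) l2" and c
  show "(x + y) \<otimes>\<^sub>h d = x \<otimes>\<^sub>h d + y \<otimes>\<^sub>h d"
    by (rule l2_eqI) (simp add: tens.rep_eq plus_l2.rep_eq scaleC_add_left)
  show "(c *\<^sub>C x) \<otimes>\<^sub>h d = c *\<^sub>C (x \<otimes>\<^sub>h d)"
    by (rule l2_eqI) (simp add: tens.rep_eq scaleC_l2.rep_eq scaleC_complex_def scaleC_scaleC)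
qed (simp add: norm_tens)

lemma bounded_clinear_tens_right: "bounded_clinear (\<lambda>d. x \<otimes>\<^sub>h d)"
proof (rule bounded_clinearI[of _ "norm x"])
  fix d e :: 'a and c
  show "x \<otimes>\<^sub>h (d + e) = x \<otimes>\<^sub>h d + x \<otimes>\<^sub>h e"
    by (rule l2_eqI) (simp add: tens.rep_eq plus_l2.rep_eq scaleC_add_right)
  show "x \<otimes>\<^sub>h (c *\<^sub>C d) = c *\<^sub>C (x \<otimes>\<^sub>h d)"
    by (rule l2_eqI) (simp add: tens.rep_eq scaleC_l2.rep_eq scaleC_scaleC mult.commute)
qed (simp add: norm_tens)

text \<open>\<open>slice u\<close> is \<open>I \<otimes> \<langle>\<cdot>, u\<rangle>\<close>; an amplification \<open>A \<otimes> I\<close> acts as \<open>A\<close> on every slice.\<close>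

lift_definition slice :: "'d :: chilbert_space \<Rightarrow> ('i, 'd) l2 \<Rightarrow> ('i, complex) l2"
  is "\<lambda>u f i. cinner (f i) u"
proof -
  fix u and f :: "'i \<Rightarrow> 'd" assume "sqsummable f"
  then show "sqsummable (\<lambda>i. cinner (f i) u)"
    by (rule sqsummable_comparison[of _ _ "norm u"]) (metis mult.commute cmod_cinner_le)
qed

lemma slice_ext: "(\<And>u. slice u x = slice u y) \<Longrightarrow> x = y"
  by (rule l2_eqI, rule cinner_ext) (metis slice.rep_eq)

lemma cinner_slice: "cinner (slice u x) y = cinner x (y \<otimes>\<^sub>h u)"
  by (simp add: cinner_l2.rep_eq slice.rep_eq tens.rep_eq cinner_scaleC_right cinner_complex_def mult.commute)

lemma slice_tens: "slice u (x \<otimes>\<^sub>h d) = cinner d u *\<^sub>C x"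
  by (rule l2_eqI)
    (simp add: slice.rep_eq tens.rep_eq scaleC_l2.rep_eq cinner_scaleC_left scaleC_complex_def mult.commute)

lemma slice_add_left: "slice (u + v) x = slice u x + slice v x"
  by (rule l2_eqI) (simp add: slice.rep_eq plus_l2.rep_eq cinner_add_right)

lemma slice_scaleC_left: "slice (c *\<^sub>C u) x = cnj c *\<^sub>C slice u x"
  by (rule l2_eqI) (simp add: slice.rep_eq scaleC_l2.rep_eq cinner_scaleC_right scaleC_complex_def)

lemma norm_slice_le: "norm (slice u x) \<le> norm u * norm x"
proof -
  have "(norm (slice u x))\<^sup>2 = Re (cinner x (slice u x \<otimes>\<^sub>h u))"
    by (simp add: norm_sq_cinner cinner_slice)
  also have "\<dots> \<le> norm x * norm (slice u x \<otimes>\<^sub>h u)" by (rule Re_cinner_le)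
  also have "\<dots> = norm x * (norm (slice u x) * norm u)" by (simp add: norm_tens)
  finally have "norm (slice u x) * norm (slice u x) \<le> norm (slice u x) * (norm u * norm x)"
    by (simp add: power2_eq_square mult_ac)
  then show ?thesis by (cases "norm (slice u x) = 0") (auto simp: mult_le_cancel_left)
qed

lemma bounded_clinear_slice: "bounded_clinear (slice u)"
proof (rule bounded_clinearI[of _ "norm u"])
  fix x y :: "('a, 'b) l2" and c
  show "slice u (x + y) = slice u x + slice u y"
    by (rule l2_eqI) (simp add: slice.rep_eq plus_l2.rep_eq cinner_add_left)
  show "slice u (c *\<^sub>C x) = c *\<^sub>C slice u x"
    by (rule l2_eqI) (simp add: slice.rep_eq scaleC_l2.rep_eq cinner_scaleC_left scaleC_complex_def)
qed (rule norm_slice_le)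

text \<open>The vector p assembled from the slices satisfies <x, p> = |p|^2, so |p| \<le> |x|, while
  orthonormality of G evaluates |p|^2 as the sum of the squared slice norms.\<close>

lemma slice_bessel:
  assumes "finite G" "orthonormal G"
  shows "(\<Sum>u\<in>G. (norm (slice u x))\<^sup>2) \<le> (norm x)\<^sup>2"
proof -
  define p where "p = (\<Sum>u\<in>G. slice u x \<otimes>\<^sub>h u)"
  have n: "norm (slice u x \<otimes>\<^sub>h u) = norm (slice u x)" if "u \<in> G" for u
    using that assms(2) by (simp add: norm_tens orthonormal_def)
  have "(norm p)\<^sup>2 = (\<Sum>u\<in>G. (norm (slice u x \<otimes>\<^sub>h u))\<^sup>2)"
    unfolding p_def
    by (rule norm_sq_sum_orth[OF assms(1)]) (use assms(2) in \<open>auto simp: cinner_tens orthonormal_def\<close>)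
  also have "\<dots> = (\<Sum>u\<in>G. (norm (slice u x))\<^sup>2)" using n by simp
  finally have np: "(norm p)\<^sup>2 = (\<Sum>u\<in>G. (norm (slice u x))\<^sup>2)" .
  have "cinner x p = (\<Sum>u\<in>G. cinner (slice u x) (slice u x))"
    unfolding p_def cinner.sum_right cinner_slice ..
  then have "Re (cinner x p) = (norm p)\<^sup>2" unfolding np by (simp add: norm_sq_cinner)
  then have "norm p * norm p \<le> norm x * norm p" using Re_cinner_le[of x p] by (simp add: power2_eq_square)
  then have "norm p \<le> norm x" by (cases "norm p = 0") (auto simp: mult_le_cancel_right)
  then show ?thesis unfolding np[symmetric] by (rule power_mono) simp
qed

text \<open>The j-th coordinate of the image of x is the Riesz vector z of the functional that sends
  u to the conjugate of the j-th coordinate of A applied to the slice at u. Square-summability with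
  the norm of A as constant comes from expanding the coordinates in orthonormal vectors, exchanging
  the sums and applying Bessel's inequality for slices.\<close>

lemma ampl_ex:
  fixes A :: "('i, complex) l2 \<Rightarrow> ('i, complex) l2"
  assumes A: "bounded_clinear A"
  shows "\<exists>X :: ('i, 'd :: chilbert_space) l2 \<Rightarrow> ('i, 'd) l2. bounded_clinear X
    \<and> (\<forall>u x. slice u (X x) = A (slice u x)) \<and> (\<forall>x. norm (X x) \<le> onorm A * norm x)"
proof -
  define K where "K = onorm A"
  have K: "norm (A x) \<le> K * norm x" for x unfolding K_def by (rule bounded_clinear_onorm[OF A])
  have "\<exists>z. \<forall>u. cnj (l2_nth (A (slice u x)) j) = cinner u z" for x :: "('i, 'd) l2" and j
  proof (rule riesz, rule bounded_clinearI[of _ "K * norm x"])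
    fix u v :: 'd and c
    show "cnj (l2_nth (A (slice (u + v) x)) j) = cnj (l2_nth (A (slice u x)) j) + cnj (l2_nth (A (slice v x)) j)"
      by (simp add: slice_add_left bounded_clinear_add[OF A] plus_l2.rep_eq)
    show "cnj (l2_nth (A (slice (c *\<^sub>C u) x)) j) = c *\<^sub>C cnj (l2_nth (A (slice u x)) j)"
      by (simp add: slice_scaleC_left bounded_clinear_scaleC[OF A] scaleC_l2.rep_eq scaleC_complex_def)
    have "norm (cnj (l2_nth (A (slice u x)) j)) \<le> norm (A (slice u x))"
      using norm_l2_nth_le[of "A (slice u x)" j] by simp
    also have "\<dots> \<le> K * (norm u * norm x)"
      using K[of "slice u x"] mult_left_mono[OF norm_slice_le[of u x], of K]
        onorm_pos_le[OF bounded_clinear_bounded_linear[OF A]] by (simp add: K_def)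
    finally show "norm (cnj (l2_nth (A (slice u x)) j)) \<le> K * norm x * norm u" by (simp add: mult_ac)
  qed
  then obtain z where z: "cnj (l2_nth (A (slice u x)) j) = cinner u (z x j)" for u :: 'd and x j by metis
  then have z: "cinner (z x j) u = l2_nth (A (slice u x)) j" for u x j
    by (metis cinner_commute complex_cnj_cnj)
  obtain B where B: "is_onb (UNIV :: 'd set) B" using onb_exists[OF closed_csubspace_UNIV] by blast
  have bound: "(\<Sum>j\<in>F. (norm (z x j))\<^sup>2) \<le> (K * norm x)\<^sup>2" if F: "finite F" for F x
  proof (rule field_le_epsilon)
    fix e :: real assume e: "e > 0"
    \<comment> \<open>The error e is spread over the coordinates in F; the summand 1 covers the case
      of empty F.\<close>
    define d where "d = e / (real (card F) + 1)"
    have d: "d > 0" "real (card F) * d \<le> e" using e by (auto simp: d_def field_simps)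
    have "\<forall>j. \<exists>G. finite G \<and> G \<subseteq> B \<and> (norm (z x j))\<^sup>2 \<le> (\<Sum>u\<in>G. (cmod (cinner (z x j) u))\<^sup>2) + d"
      using parseval_approx[OF B UNIV_I d(1)] by blast
    then obtain G where G: "\<And>j. finite (G j)" "\<And>j. G j \<subseteq> B"
      "\<And>j. (norm (z x j))\<^sup>2 \<le> (\<Sum>u\<in>G j. (cmod (cinner (z x j) u))\<^sup>2) + d" by metis
    \<comment> \<open>One finite orthonormal set serves all coordinates in F at once, which allows
      the two sums to be exchanged.\<close>
    define H where "H = (\<Union>j\<in>F. G j)"
    have H: "finite H" "orthonormal H"
      using F G(1,2) B orthonormal_subset[of B H] by (auto simp: H_def is_onb_iff)
    have "(\<Sum>j\<in>F. (norm (z x j))\<^sup>2) \<le> (\<Sum>j\<in>F. (\<Sum>u\<in>H. (cmod (cinner (z x j) u))\<^sup>2) + d)"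
    proof (rule sum_mono)
      fix j assume j: "j \<in> F"
      have "(\<Sum>u\<in>G j. (cmod (cinner (z x j) u))\<^sup>2) \<le> (\<Sum>u\<in>H. (cmod (cinner (z x j) u))\<^sup>2)"
        by (rule sum_mono2[OF H(1)]) (use j in \<open>auto simp: H_def\<close>)
      then show "(norm (z x j))\<^sup>2 \<le> (\<Sum>u\<in>H. (cmod (cinner (z x j) u))\<^sup>2) + d" using G(3)[of j] by simp
    qed
    also have "\<dots> \<le> (\<Sum>j\<in>F. \<Sum>u\<in>H. (cmod (cinner (z x j) u))\<^sup>2) + e"
      using d(2) by (simp add: sum.distrib)
    also have "(\<Sum>j\<in>F. \<Sum>u\<in>H. (cmod (cinner (z x j) u))\<^sup>2)
        = (\<Sum>u\<in>H. \<Sum>j\<in>F. (norm (l2_nth (A (slice u x)) j))\<^sup>2)"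
      unfolding z by (rule sum.swap)
    also have "\<dots> \<le> (\<Sum>u\<in>H. (K * norm (slice u x))\<^sup>2)"
    proof (rule sum_mono)
      fix u
      have "(\<Sum>j\<in>F. (norm (l2_nth (A (slice u x)) j))\<^sup>2) \<le> (norm (A (slice u x)))\<^sup>2"
        by (rule l2_nth_sum_sq_le[OF F])
      also have "\<dots> \<le> (K * norm (slice u x))\<^sup>2" by (intro power_mono K) auto
      finally show "(\<Sum>j\<in>F. (norm (l2_nth (A (slice u x)) j))\<^sup>2) \<le> (K * norm (slice u x))\<^sup>2" .
    qed
    also have "\<dots> = K\<^sup>2 * (\<Sum>u\<in>H. (norm (slice u x))\<^sup>2)"
      by (simp add: power_mult_distrib sum_distrib_left)
    also have "\<dots> \<le> K\<^sup>2 * (norm x)\<^sup>2" by (intro mult_left_mono slice_bessel[OF H]) auto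
    finally show "(\<Sum>j\<in>F. (norm (z x j))\<^sup>2) \<le> (K * norm x)\<^sup>2 + e" by (simp add: power_mult_distrib)
  qed
  define X where "X x = Abs_l2 (z x)" for x
  have X: "l2_nth (X x) = z x" for x
    unfolding X_def using sqsummable_bound(1)[OF bound] by (simp add: Abs_l2_inverse)
  have sl: "slice u (X x) = A (slice u x)" for u x
    by (rule l2_eqI) (simp add: slice.rep_eq X z)
  have nX: "norm (X x) \<le> K * norm x" for x
  proof -
    have "(norm (X x))\<^sup>2 \<le> (K * norm x)\<^sup>2" by (rule norm_l2_sq_leI) (simp add: X bound)
    then show ?thesis
      using onorm_pos_le[OF bounded_clinear_bounded_linear[OF A]]
      by (intro power2_le_imp_le[of "norm (X x)"]) (auto simp: K_def)
  qed
  have "bounded_clinear X"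
  proof (rule bounded_clinearI[of _ K])
    fix x y c
    note S = bounded_clinear_slice
    show "X (x + y) = X x + X y"
      by (rule slice_ext) (simp add: sl bounded_clinear_add[OF S] bounded_clinear_add[OF A])
    show "X (c *\<^sub>C x) = c *\<^sub>C X x"
      by (rule slice_ext) (simp add: sl bounded_clinear_scaleC[OF S] bounded_clinear_scaleC[OF A])
  qed (rule nX)
  then show ?thesis using sl nX unfolding K_def by blast
qed

lemma ampl_props:
  fixes A :: "('i, complex) l2 \<Rightarrow> ('i, complex) l2"
  assumes A: "bounded_clinear A"
  shows bounded_clinear_ampl: "bounded_clinear (ampl A :: ('i, 'd :: chilbert_space) l2 \<Rightarrow> ('i, 'd) l2)"
    and slice_ampl: "slice u (ampl A x) = A (slice u (x :: ('i, 'd) l2))"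
    and norm_ampl_le: "norm (ampl A (x :: ('i, 'd) l2)) \<le> onorm A * norm x"
proof -
  obtain X :: "('i, 'd) l2 \<Rightarrow> ('i, 'd) l2" where X: "bounded_clinear X" "\<And>u x. slice u (X x) = A (slice u x)"
      "\<And>x. norm (X x) \<le> onorm A * norm x"
    using ampl_ex[OF A] by blast
  have Xt: "X (x \<otimes>\<^sub>h d) = A x \<otimes>\<^sub>h d" for x d
    by (rule slice_ext) (simp add: X slice_tens bounded_clinear_scaleC[OF A])
  have "ampl A = X"
    unfolding ampl_def
  proof (rule the_equality)
    show "bounded_clinear X \<and> (\<forall>x d. X (x \<otimes>\<^sub>h d) = A x \<otimes>\<^sub>h d)" using X Xt by blast
    fix Y :: "('i, 'd) l2 \<Rightarrow> ('i, 'd) l2"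
    assume Y: "bounded_clinear Y \<and> (\<forall>x d. Y (x \<otimes>\<^sub>h d) = A x \<otimes>\<^sub>h d)"
    show "Y = X"
    proof
      fix x
      show "Y x = X x"
        by (rule ccspan_eq_on[of Y X "{x \<otimes>\<^sub>h d |x d. True}"]) (use X Y Xt ccspan_tens in auto)
    qed
  qed
  then show "bounded_clinear (ampl A :: ('i, 'd) l2 \<Rightarrow> ('i, 'd) l2)" "slice u (ampl A x) = A (slice u x)"
    "norm (ampl A x) \<le> onorm A * norm x"
    using X by auto
qed

lemma ampl_eqI: "bounded_clinear A \<Longrightarrow> (\<And>u. slice u y = A (slice u x)) \<Longrightarrow> ampl A x = y"
  by (rule slice_ext) (simp add: slice_ampl)

lemma ampl_tens: "bounded_clinear A \<Longrightarrow> ampl A (x \<otimes>\<^sub>h d) = A x \<otimes>\<^sub>h d"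
  by (rule ampl_eqI) (simp_all add: slice_tens bounded_clinear_scaleC)

lemma ampl_compose:
  "bounded_clinear A \<Longrightarrow> bounded_clinear B \<Longrightarrow> ampl (A \<circ> B) x = ampl A (ampl B x)"
  by (rule ampl_eqI) (simp_all add: bounded_clinear_compose slice_ampl)

text \<open>Both sides are bounded and linear in x, so simple tensors suffice; there the claim
  reduces to the adjoint relation of A against a slice of y.\<close>

lemma cadj_ampl:
  fixes A :: "('i, complex) l2 \<Rightarrow> ('i, complex) l2"
  assumes A: "bounded_clinear A"
  shows "cadj (ampl A :: ('i, 'd :: chilbert_space) l2 \<Rightarrow> ('i, 'd) l2) = ampl (cadj A)"
proof (rule cadj_eqI[OF bounded_clinear_ampl[OF A]])
  fix x y :: "('i, 'd) l2"
  note A' = bounded_clinear_cadj[OF A]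
  show "cinner (ampl A x) y = cinner x (ampl (cadj A) y)"
  proof (rule ccspan_eq_on[of "\<lambda>x. cinner (ampl A x) y" "\<lambda>x. cinner x (ampl (cadj A) y)"
        "{x \<otimes>\<^sub>h d |x d. True}"])
    show "bounded_clinear (\<lambda>x. cinner (ampl A x) y)"
      by (rule bounded_clinear_compose2[OF bounded_clinear_cinner bounded_clinear_ampl[OF A]])
    show "bounded_clinear (\<lambda>x. cinner x (ampl (cadj A) y))" by (rule bounded_clinear_cinner)
    show "x \<in> ccspan {x \<otimes>\<^sub>h d |x d. True}" unfolding ccspan_tens by (rule UNIV_I)
    fix v :: "('i, 'd) l2" assume "v \<in> {x \<otimes>\<^sub>h d |x d. True}"
    then obtain x' d where v: "v = x' \<otimes>\<^sub>h d" by blast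
    have "cinner y (ampl A v) = cinner (ampl (cadj A) y) v"
      unfolding v ampl_tens[OF A] cinner_slice[symmetric] slice_ampl[OF A'] by (rule cinner_cadj_left[OF A, symmetric])
    then show "cinner (ampl A v) y = cinner v (ampl (cadj A) y)" by (metis cinner_commute)
  qed
qed

lemma cinner_ampl: "bounded_clinear A \<Longrightarrow> cinner (ampl A x) y = cinner x (ampl (cadj A) y)"
  by (metis bounded_clinear_ampl cadj_ampl cinner_cadj)

text \<open>The residual of z is orthogonal to D, hence to z itself and to the projection of z, and
  so to itself.\<close>

lemma orthogonal_ortho_in:
  assumes D: "closed_csubspace D" and z: "\<And>u. u \<in> ortho D \<Longrightarrow> cinner z u = 0"
  shows "z \<in> D"
proof -
  define u where "u = z - proj D z"
  have u: "u \<in> ortho D" unfolding u_def by (rule proj_ortho[OF D])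
  have "cinner (proj D z) u = 0"
    using u proj_in[OF D, of z] by (simp add: ortho_def cinner_eq_0_commute)
  then have "cinner u u = 0" using z[OF u] by (simp add: u_def cinner.diff_left)
  then have "proj D z = z" by (simp add: cinner_eq_0_self u_def)
  then show ?thesis using proj_in[OF D, of z] by simp
qed

text \<open>Slices of x in directions orthogonal to D vanish, and the amplification acts slice by
  slice.\<close>

lemma ampl_coeff_in:
  assumes A: "bounded_clinear A" and D: "closed_csubspace D" and x: "\<And>i. l2_nth x i \<in> D"
  shows "l2_nth (ampl A x) i \<in> D"
proof (rule orthogonal_ortho_in[OF D])
  fix u assume u: "u \<in> ortho D"
  have "slice u x = 0"
    by (rule l2_eqI) (use u x in \<open>auto simp: slice.rep_eq zero_l2.rep_eq ortho_def cinner_eq_0_commute\<close>)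
  then have "slice u (ampl A x) = 0" by (simp add: slice_ampl[OF A] bounded_clinear_0[OF A])
  then show "cinner (l2_nth (ampl A x) i) u = 0" by (metis slice.rep_eq zero_l2.rep_eq)
qed

lemma ampl_proj_fixed:
  assumes "closed_csubspace N" "\<And>u. slice u x \<in> N"
  shows "ampl (proj N) x = x"
  by (rule ampl_eqI) (simp_all add: assms bounded_clinear_proj proj_id)

section \<open>Tensor products of closed subspaces\<close>

lemma closed_csubspace_htens: "closed_csubspace (htens N D)"
  unfolding htens_def by (rule closed_csubspace_ccspan)

text \<open>For the converse, the projection onto N is amplified and applied to the basis expansion
  of x. It fixes x because all slices lie in N, and it turns each term into a simple tensor with
  factors in N and D.\<close>

lemma htens_iff:
  assumes N: "closed_csubspace N" and D: "closed_csubspace D"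
  shows "x \<in> htens N D \<longleftrightarrow> (\<forall>u. slice u x \<in> N) \<and> (\<forall>i. l2_nth x i \<in> D)"
proof
  have "closed_csubspace ({x. \<forall>u. slice u x \<in> N} \<inter> {x. \<forall>i. l2_nth x i \<in> D})"
    by (intro closed_csubspace_Int closed_csubspace_Collect_all
        closed_csubspace_vimage[OF bounded_clinear_slice N] closed_csubspace_vimage[OF bounded_clinear_l2_nth D])
  moreover have "{x \<otimes>\<^sub>h d |x d. x \<in> N \<and> d \<in> D} \<subseteq> {x. \<forall>u. slice u x \<in> N} \<inter> {x. \<forall>i. l2_nth x i \<in> D}"
    by (auto simp: slice_tens tens.rep_eq closed_csubspaceD(3)[OF N] closed_csubspaceD(3)[OF D])
  ultimately have "htens N D \<subseteq> {x. \<forall>u. slice u x \<in> N} \<inter> {x. \<forall>i. l2_nth x i \<in> D}"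
    unfolding htens_def by (rule ccspan_minimal)
  then show "x \<in> htens N D \<Longrightarrow> (\<forall>u. slice u x \<in> N) \<and> (\<forall>i. l2_nth x i \<in> D)" by blast
next
  assume x: "(\<forall>u. slice u x \<in> N) \<and> (\<forall>i. l2_nth x i \<in> D)"
  note P = bounded_clinear_proj[OF N]
  have "((\<lambda>i. ampl (proj N) (ket i \<otimes>\<^sub>h l2_nth x i)) has_sum ampl (proj N) x) UNIV"
    by (rule has_sum_bounded_linear[OF bounded_clinear_bounded_linear[OF bounded_clinear_ampl[OF P]]
          has_sum_ket_tens])
  then have "((\<lambda>i. proj N (ket i) \<otimes>\<^sub>h l2_nth x i) has_sum x) UNIV"
    using x by (simp add: ampl_tens[OF P] ampl_proj_fixed[OF N])
  then show "x \<in> htens N D"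
  proof (rule has_sum_in_closed_csubspace[OF closed_csubspace_htens])
    fix i
    have "proj N (ket i) \<otimes>\<^sub>h l2_nth x i \<in> {x \<otimes>\<^sub>h d |x d. x \<in> N \<and> d \<in> D}"
      using x proj_in[OF N] by blast
    then show "proj N (ket i) \<otimes>\<^sub>h l2_nth x i \<in> htens N D"
      unfolding htens_def by (rule subsetD[OF ccspan_superset])
  qed
qed

text \<open>The projection onto N \<otimes> D is the tensor product of the two projections, and the
  second factor already fixes a vector whose coordinates lie in D.\<close>

lemma proj_htens:
  assumes N: "closed_csubspace N" and D: "closed_csubspace D" and x: "\<And>i. l2_nth x i \<in> D"
  shows "proj (htens N D) x = ampl (proj N) x"
proof (rule proj_eqI[OF closed_csubspace_htens])
  note P = bounded_clinear_proj[OF N]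
  show "ampl (proj N) x \<in> htens N D"
    unfolding htens_iff[OF N D] by (auto simp: slice_ampl[OF P] proj_in[OF N] ampl_coeff_in[OF P D x])
  show "x - ampl (proj N) x \<in> ortho (htens N D)"
    unfolding ortho_def
    by (auto simp: cinner.diff_left cinner_ampl[OF P] cadj_proj[OF N] htens_iff[OF N D] ampl_proj_fixed[OF N])
qed

text \<open>The operator I \<otimes> W. The default value 0 keeps the lifted map square-summable
  when W is not bounded linear.\<close>

lift_definition l2map ::
    "('a :: chilbert_space \<Rightarrow> 'b :: chilbert_space) \<Rightarrow> ('i, 'a) l2 \<Rightarrow> ('i, 'b) l2"
  is "\<lambda>W f i. if bounded_clinear W then W (f i) else 0"
proof -
  fix W :: "'a \<Rightarrow> 'b" and f :: "'i \<Rightarrow> 'a" assume f: "sqsummable f"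
  show "sqsummable (\<lambda>i. if bounded_clinear W then W (f i) else 0)"
  proof (cases "bounded_clinear W")
    case True
    then show ?thesis
      using sqsummable_comparison[OF f, of "\<lambda>i. W (f i)" "onorm W"] bounded_clinear_onorm by auto
  qed (simp add: sqsummable_def)
qed

lemma l2_nth_l2map: "bounded_clinear W \<Longrightarrow> l2_nth (l2map W x) i = W (l2_nth x i)"
  by (simp add: l2map.rep_eq)

lemma slice_l2map: "bounded_clinear W \<Longrightarrow> slice u (l2map W x) = slice (cadj W u) x"
  by (rule l2_eqI) (simp add: slice.rep_eq l2_nth_l2map cinner_cadj)

lemma l2map_ampl:
  "bounded_clinear W \<Longrightarrow> bounded_clinear A \<Longrightarrow> l2map W (ampl A x) = ampl A (l2map W x)"
  by (rule slice_ext) (simp add: slice_l2map slice_ampl)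

lemma l2map_linear:
  assumes "bounded_clinear W"
  shows "l2map W (x + y) = l2map W x + l2map W y" "l2map W (c *\<^sub>C x) = c *\<^sub>C l2map W x"
  by (rule l2_eqI, simp add: l2_nth_l2map[OF assms] plus_l2.rep_eq bounded_clinear_add[OF assms])
    (rule l2_eqI, simp add: l2_nth_l2map[OF assms] scaleC_l2.rep_eq bounded_clinear_scaleC[OF assms])

lemma norm_l2map:
  assumes "bounded_clinear W" "isometry_on D W" "\<And>i. l2_nth x i \<in> D"
  shows "norm (l2map W x) = norm x"
proof -
  have "norm (W (l2_nth x i)) = norm (l2_nth x i)" for i using assms(2,3) by (simp add: isometry_on_def)
  then show ?thesis by (simp add: norm_l2.rep_eq l2_nth_l2map[OF assms(1)])
qed

section \<open>Creation operators\<close>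

text \<open>Relabelling of basis vectors along an injection. It covers left creation, by prefixing a
  letter, and right creation, by appending a word; the default 0 handles non-injective
  labels.\<close>

lift_definition l2push :: "('i \<Rightarrow> 'j) \<Rightarrow> ('i, 'd :: chilbert_space) l2 \<Rightarrow> ('j, 'd) l2"
  is "\<lambda>h f j. if inj h \<and> j \<in> range h then f (inv h j) else 0"
proof -
  fix h :: "'i \<Rightarrow> 'j" and f :: "'i \<Rightarrow> 'd" assume f: "sqsummable f"
  let ?g = "\<lambda>j. if inj h \<and> j \<in> range h then f (inv h j) else 0"
  show "sqsummable ?g"
  proof (cases "inj h")
    case True
    show ?thesis
    proof (rule sqsummable_bound)
      fix F :: "'j set" assume F: "finite F"
      have "(\<Sum>j\<in>F. (norm (?g j))\<^sup>2) = (\<Sum>j\<in>h ` (h -` F). (norm (f (inv h j)))\<^sup>2)"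
        using F True by (intro sum.mono_neutral_cong_right) auto
      also have "\<dots> = (\<Sum>i\<in>h -` F. (norm (f i))\<^sup>2)"
        using True by (subst sum.reindex) (auto simp: inj_on_def)
      also have "\<dots> \<le> infsum (\<lambda>i. (norm (f i))\<^sup>2) UNIV"
        by (rule sqsummable_finite_le[OF f finite_vimageI[OF F True]])
      finally show "(\<Sum>j\<in>F. (norm (?g j))\<^sup>2) \<le> infsum (\<lambda>i. (norm (f i))\<^sup>2) UNIV" .
    qed
  qed (simp add: sqsummable_def)
qed

lemma l2push_in: "inj h \<Longrightarrow> l2_nth (l2push h x) (h i) = l2_nth x i"
  by (simp add: l2push.rep_eq)

lemma l2push_out: "j \<notin> range h \<Longrightarrow> l2_nth (l2push h x) j = 0"
  by (simp add: l2push.rep_eq)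

lemma bounded_clinear_l2push:
  "bounded_clinear (l2push h :: ('i, 'd :: chilbert_space) l2 \<Rightarrow> ('j, 'd) l2)"
proof (rule bounded_clinearI[of _ 1])
  fix x y :: "('i, 'd) l2" and c
  show "l2push h (x + y) = l2push h x + l2push h y"
    by (rule l2_eqI) (simp add: l2push.rep_eq plus_l2.rep_eq)
  show "l2push h (c *\<^sub>C x) = c *\<^sub>C l2push h x"
    by (rule l2_eqI) (simp add: l2push.rep_eq scaleC_l2.rep_eq)
  have "(norm (l2push h x))\<^sup>2 \<le> (norm x)\<^sup>2"
  proof (rule norm_l2_sq_leI)
    fix F :: "'j set" assume F: "finite F"
    show "(\<Sum>j\<in>F. (norm (l2_nth (l2push h x) j))\<^sup>2) \<le> (norm x)\<^sup>2"
    proof (cases "inj h")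
      case True
      have "(\<Sum>j\<in>F. (norm (l2_nth (l2push h x) j))\<^sup>2) = (\<Sum>j\<in>h ` (h -` F). (norm (l2_nth (l2push h x) j))\<^sup>2)"
        using F by (intro sum.mono_neutral_right) (auto simp: l2push_out)
      also have "\<dots> = (\<Sum>i\<in>h -` F. (norm (l2_nth x i))\<^sup>2)"
        using True by (subst sum.reindex) (auto simp: inj_on_def l2push_in)
      also have "\<dots> \<le> (norm x)\<^sup>2" by (rule l2_nth_sum_sq_le[OF finite_vimageI[OF F True]])
      finally show ?thesis .
    qed (simp add: l2push.rep_eq)
  qed
  then show "norm (l2push h x) \<le> 1 * norm x"
    using power2_le_imp_le[of "norm (l2push h x)" "norm x"] by simp
qed

lemma l2push_ket: "inj h \<Longrightarrow> l2push h (ket i) = ket (h i)"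
  by (rule l2_eqI) (auto simp: l2push.rep_eq ket.rep_eq inj_eq)

lemma creation_l2push: "creation i = l2push ((#) i)"
proof
  fix x :: "'a fock"
  show "creation i x = l2push ((#) i) x"
  proof (rule l2_eqI)
    fix \<alpha> show "l2_nth (creation i x) \<alpha> = l2_nth (l2push ((#) i) x) \<alpha>"
      by (cases "\<alpha> \<in> range ((#) i)")
        (auto simp: l2push_out l2push_in creation.rep_eq split: list.split)
  qed
qed

lemma bounded_clinear_creation: "bounded_clinear (creation i)"
  unfolding creation_l2push by (rule bounded_clinear_l2push)

lemma bounded_clinear_opword: "(\<And>i. bounded_clinear (X i)) \<Longrightarrow> bounded_clinear (opword X \<alpha>)"
  by (induction \<alpha>) (simp_all only: opword.simps bounded_clinear_id bounded_clinear_compose)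

lemma cadj_opword_Cons:
  "(\<And>i. bounded_clinear (X i)) \<Longrightarrow> cadj (opword X (i # \<alpha>)) = cadj (opword X \<alpha>) \<circ> cadj (X i)"
  by (simp add: cadj_compose bounded_clinear_opword)

lemma cadj_opword_in:
  assumes "\<And>i. bounded_clinear (X i)" "coinvariant M X" "x \<in> M"
  shows "cadj (opword X \<alpha>) x \<in> M"
  using assms(3)
proof (induction \<alpha> arbitrary: x)
  case (Cons i \<alpha>)
  then show ?case using assms(2) by (simp only: cadj_opword_Cons[OF assms(1)] coinvariant_def o_apply)
qed (simp add: cadj_id)

definition cword :: "'n list \<Rightarrow> ('n list, 'd :: chilbert_space) l2 \<Rightarrow> ('n list, 'd) l2"
  where "cword \<alpha> = opword (\<lambda>i. ampl (creation i)) \<alpha>"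

lemma bounded_clinear_cword: "bounded_clinear (cword \<alpha>)"
  unfolding cword_def by (intro bounded_clinear_opword bounded_clinear_ampl bounded_clinear_creation)

lemma l2_nth_cadj_ampl_creation: "l2_nth (cadj (ampl (creation i)) x) \<beta> = l2_nth x (i # \<beta>)"
proof (rule cinner_ext)
  fix d
  have "cinner (l2_nth (cadj (ampl (creation i)) x) \<beta>) d = cinner x (ampl (creation i) (ket \<beta> \<otimes>\<^sub>h d))"
    by (simp only: cinner_ket_tens[symmetric] cinner_cadj_left[OF bounded_clinear_ampl[OF bounded_clinear_creation]])
  also have "\<dots> = cinner (l2_nth x (i # \<beta>)) d"
    by (simp add: ampl_tens bounded_clinear_creation creation_ket cinner_ket_tens)
  finally show "cinner (l2_nth (cadj (ampl (creation i)) x) \<beta>) d = cinner (l2_nth x (i # \<beta>)) d" .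
qed

lemma cadj_cword_Cons: "cadj (cword (i # \<alpha>)) = cadj (cword \<alpha>) \<circ> cadj (ampl (creation i))"
  unfolding cword_def by (rule cadj_opword_Cons) (intro bounded_clinear_ampl bounded_clinear_creation)

lemma l2_nth_cadj_cword: "l2_nth (cadj (cword \<alpha>) x) \<beta> = l2_nth x (\<alpha> @ \<beta>)"
proof (induction \<alpha> arbitrary: x)
  case Nil then show ?case by (simp add: cword_def cadj_id)
next
  case (Cons i \<alpha>) then show ?case by (simp add: cadj_cword_Cons l2_nth_cadj_ampl_creation)
qed

lemma l2_nth_cword:
  fixes x :: "('n list, 'b :: chilbert_space) l2"
  shows "l2_nth (cword \<alpha> x) \<gamma> = (if take (length \<alpha>) \<gamma> = \<alpha> then l2_nth x (drop (length \<alpha>) \<gamma>) else 0)"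
proof (rule cinner_ext)
  fix d :: 'b
  let ?\<beta> = "drop (length \<alpha>) \<gamma>"
  have *: "cadj (cword \<alpha>) (ket \<gamma> \<otimes>\<^sub>h d) = (if take (length \<alpha>) \<gamma> = \<alpha> then ket ?\<beta> \<otimes>\<^sub>h d else 0)"
  proof (rule l2_eqI)
    fix \<beta>
    have "\<alpha> @ \<beta> = \<gamma> \<longleftrightarrow> take (length \<alpha>) \<gamma> = \<alpha> \<and> \<beta> = ?\<beta>"
      by (metis append_take_drop_id append_eq_conv_conj)
    then show "l2_nth (cadj (cword \<alpha>) (ket \<gamma> \<otimes>\<^sub>h d)) \<beta>
        = l2_nth (if take (length \<alpha>) \<gamma> = \<alpha> then ket ?\<beta> \<otimes>\<^sub>h d else 0) \<beta>"
      by (simp add: l2_nth_cadj_cword l2_nth_ket_tens zero_l2.rep_eq)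
  qed
  have "cinner (l2_nth (cword \<alpha> x) \<gamma>) d = cinner x (cadj (cword \<alpha>) (ket \<gamma> \<otimes>\<^sub>h d))"
    by (simp add: cinner_ket_tens[symmetric] cinner_cadj[OF bounded_clinear_cword])
  then show "cinner (l2_nth (cword \<alpha> x) \<gamma>) d
      = cinner (if take (length \<alpha>) \<gamma> = \<alpha> then l2_nth x ?\<beta> else 0) d"
    by (simp add: * cinner_ket_tens)
qed

text \<open>Prefixes of equal length split the words into disjoint classes, so these isometries have
  orthogonal ranges.\<close>

lemma cadj_cword_cword:
  assumes "length \<alpha> = length \<beta>"
  shows "cadj (cword \<beta>) (cword \<alpha> x) = (if \<alpha> = \<beta> then x else 0)"
proof (rule l2_eqI)
  fix \<delta>
  have "take (length \<alpha>) (\<beta> @ \<delta>) = \<beta>" "drop (length \<alpha>) (\<beta> @ \<delta>) = \<delta>" using assms by simp_all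
  then show "l2_nth (cadj (cword \<beta>) (cword \<alpha> x)) \<delta> = l2_nth (if \<alpha> = \<beta> then x else 0) \<delta>"
    by (simp add: l2_nth_cadj_cword l2_nth_cword zero_l2.rep_eq)
qed

lemma norm_cword: "norm (cword \<alpha> x) = norm x"
proof -
  have "cinner (cword \<alpha> x) (cword \<alpha> x) = cinner x x"
    by (subst cinner_cadj[OF bounded_clinear_cword]) (simp add: cadj_cword_cword)
  then have "(norm (cword \<alpha> x))\<^sup>2 = (norm x)\<^sup>2" by (simp add: norm_sq_cinner)
  then show ?thesis by simp
qed

section \<open>The noncommutative analytic Toeplitz algebra\<close>

lemma Finf_creation: "creation i \<in> Finf"
  unfolding Finf_def by blast

lemma inj_append_right: "inj (\<lambda>\<alpha>. \<alpha> @ \<beta>)"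
  by (simp add: inj_on_def)

text \<open>Every element of the algebra commutes with the right creation operators \<open>e\<^sub>\<alpha> \<mapsto> e\<^sub>\<alpha> \<otimes> e\<^sub>\<beta>\<close>,
  so it is determined by its value at the vacuum vector.\<close>

lemma Finf_props:
  fixes f :: "'n fock \<Rightarrow> 'n fock"
  assumes "f \<in> Finf"
  shows Finf_bounded: "bounded_clinear f"
    and Finf_commute: "f (l2push (\<lambda>\<alpha>. \<alpha> @ \<beta>) x) = l2push (\<lambda>\<alpha>. \<alpha> @ \<beta>) (f x)"
proof -
  define R :: "'n fock \<Rightarrow> 'n fock" where "R = l2push (\<lambda>\<alpha>. \<alpha> @ \<beta>)"
  have R: "bounded_clinear R" unfolding R_def by (rule bounded_clinear_l2push)
  define \<A> where "\<A> = {f. bounded_clinear f \<and> (\<forall>x. f (R x) = R (f x))}"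
  \<comment> \<open>Commutation with R written in matrix coefficients: every condition compares two
    coordinates of a point of the product space, so C is closed there and its pullback is
    WOT-closed.\<close>
  define C where "C = {\<phi> :: 'n fock \<times> 'n fock \<Rightarrow> complex. \<forall>x y. \<phi> (R x, y) = \<phi> (x, cadj R y)}"
  define ev where "ev = (\<lambda>(A :: 'n fock \<Rightarrow> 'n fock) (x, y). cinner (A x) y)"
  have "op_algebra \<A>"
    unfolding op_algebra_def \<A>_def
    by (auto simp: bounded_clinear_const_0 bounded_clinear_0[OF R] bounded_clinear_plus
        bounded_clinear_add[OF R] bounded_clinear_scale bounded_clinear_scaleC[OF R] bounded_clinear_compose)
  moreover have "closedin wot \<A>"
  proof -
    have "closed C"
      unfolding C_def by (intro closed_Collect_all closed_Collect_eq continuous_on_product_coordinates)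
    have "(f \<in> \<A>) = (bounded_clinear f \<and> ev f \<in> C)" for f
      unfolding \<A>_def C_def ev_def
      by (auto simp: cinner_cadj[OF R, symmetric] intro: cinner_ext)
    then have eq: "{f. bounded_clinear f} - \<A> = ev -` (- C) \<inter> {f. bounded_clinear f}" by auto
    have top: "topspace wot = {f :: 'n fock \<Rightarrow> 'n fock. bounded_clinear f}"
      unfolding wot_def topspace_pullback_topology by simp
    have "openin wot ({f. bounded_clinear f} - \<A>)"
      unfolding wot_def openin_pullback_topology eq ev_def
      using \<open>closed C\<close> by (intro exI[of _ "- C"]) (simp add: open_Compl)
    then show ?thesis unfolding closedin_def top by (auto simp: \<A>_def)
  qed
  moreover have "id \<in> \<A>" by (simp add: \<A>_def bounded_clinear_id)
  moreover have "range creation \<subseteq> \<A>"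
  proof -
    have "creation i (R x) = R (creation i x)" for i x
    proof (rule l2_eqI)
      fix \<gamma> :: "'n list"
      show "l2_nth (creation i (R x)) \<gamma> = l2_nth (R (creation i x)) \<gamma>"
      proof (cases "\<gamma> \<in> range (\<lambda>\<alpha>. i # \<alpha> @ \<beta>)")
        case True
        then obtain \<alpha> where \<alpha>: "\<gamma> = i # \<alpha> @ \<beta>" by blast
        have "l2_nth (R x) (\<alpha> @ \<beta>) = l2_nth x \<alpha>"
          unfolding R_def by (rule l2push_in[OF inj_append_right])
        moreover have "l2_nth (R (creation i x)) ((i # \<alpha>) @ \<beta>) = l2_nth (creation i x) (i # \<alpha>)"
          unfolding R_def by (rule l2push_in[OF inj_append_right])
        ultimately show ?thesis unfolding \<alpha> by (simp add: creation.rep_eq)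
      next
        case False
        have "l2_nth (creation i (R x)) \<gamma> = 0"
        proof (cases "\<exists>\<delta>. \<gamma> = i # \<delta>")
          case True
          then obtain \<delta> where \<delta>: "\<gamma> = i # \<delta>" by blast
          then have "\<delta> \<notin> range (\<lambda>\<alpha>. \<alpha> @ \<beta>)" using False by auto
          then show ?thesis by (simp add: \<delta> creation.rep_eq R_def l2push_out)
        qed (auto simp: creation.rep_eq split: list.split)
        moreover have "l2_nth (R (creation i x)) \<gamma> = 0"
        proof (cases "\<gamma> \<in> range (\<lambda>\<alpha>. \<alpha> @ \<beta>)")
          case True
          then obtain \<alpha> where \<alpha>: "\<gamma> = \<alpha> @ \<beta>" by blast
          have "l2_nth (R (creation i x)) \<gamma> = l2_nth (creation i x) \<alpha>"
            unfolding R_def \<alpha> by (rule l2push_in[OF inj_append_right])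
          then show ?thesis using False \<alpha> by (auto simp: creation.rep_eq split: list.split)
        qed (simp add: R_def l2push_out)
        ultimately show ?thesis by simp
      qed
    qed
    then show ?thesis by (auto simp: \<A>_def bounded_clinear_creation)
  qed
  ultimately have "Finf \<subseteq> \<A>" unfolding Finf_def by blast
  then show "bounded_clinear f" "f (l2push (\<lambda>\<alpha>. \<alpha> @ \<beta>) x) = l2push (\<lambda>\<alpha>. \<alpha> @ \<beta>) (f x)"
    using assms by (auto simp: \<A>_def R_def)
qed

lemma l2_nth_Finf_ket:
  assumes "f \<in> Finf"
  shows "l2_nth (f (ket \<beta>)) \<gamma>
    = (if \<gamma> \<in> range (\<lambda>\<alpha>. \<alpha> @ \<beta>) then l2_nth (f (ket [])) (take (length \<gamma> - length \<beta>) \<gamma>) else 0)"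
proof -
  have "f (ket \<beta>) = l2push (\<lambda>\<alpha>. \<alpha> @ \<beta>) (f (ket []))"
    using Finf_commute[OF assms, of \<beta> "ket []"] l2push_ket[OF inj_append_right, of \<beta> "[]"] by simp
  moreover have "l2_nth (l2push (\<lambda>\<alpha>. \<alpha> @ \<beta>) (f (ket []))) (\<alpha> @ \<beta>) = l2_nth (f (ket [])) \<alpha>" for \<alpha>
    by (rule l2push_in[OF inj_append_right])
  ultimately show ?thesis by (auto simp: l2push_out)
qed

text \<open>Only basis vectors indexed by suffixes of \<gamma> reach the coordinate \<gamma>,
  because the image of \<open>ket \<beta>\<close> is the right translate by \<beta> of the image of
  the vacuum. The expansion of x thus collapses to a finite sum over the splittings of
  \<gamma>.\<close>

lemma l2_nth_ampl_Finf:
  assumes f: "f \<in> Finf"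
  shows "l2_nth (ampl f x) \<gamma> = (\<Sum>k\<le>length \<gamma>. l2_nth (f (ket [])) (take k \<gamma>) *\<^sub>C l2_nth x (drop k \<gamma>))"
proof -
  note F = Finf_bounded[OF f]
  have "((\<lambda>\<beta>. l2_nth (ampl f (ket \<beta> \<otimes>\<^sub>h l2_nth x \<beta>)) \<gamma>) has_sum l2_nth (ampl f x) \<gamma>) UNIV"
    by (intro has_sum_bounded_linear[OF bounded_clinear_bounded_linear[OF bounded_clinear_l2_nth]]
        has_sum_bounded_linear[OF bounded_clinear_bounded_linear[OF bounded_clinear_ampl[OF F]]] has_sum_ket_tens)
  then have "((\<lambda>\<beta>. l2_nth (f (ket \<beta>)) \<gamma> *\<^sub>C l2_nth x \<beta>) has_sum l2_nth (ampl f x) \<gamma>) UNIV"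
    by (simp add: ampl_tens[OF F] tens.rep_eq)
  moreover have "((\<lambda>\<beta>. l2_nth (f (ket \<beta>)) \<gamma> *\<^sub>C l2_nth x \<beta>)
      has_sum (\<Sum>\<beta>\<in>(\<lambda>k. drop k \<gamma>) ` {..length \<gamma>}. l2_nth (f (ket \<beta>)) \<gamma> *\<^sub>C l2_nth x \<beta>)) UNIV"
  proof (rule has_sum_cong_neutral[THEN iffD1, OF _ _ _ has_sum_finite])
    show "l2_nth (f (ket \<beta>)) \<gamma> *\<^sub>C l2_nth x \<beta> = 0" if "\<beta> \<in> UNIV - (\<lambda>k. drop k \<gamma>) ` {..length \<gamma>}" for \<beta>
    proof -
      have "\<gamma> \<notin> range (\<lambda>\<alpha>. \<alpha> @ \<beta>)"
      proof
        assume "\<gamma> \<in> range (\<lambda>\<alpha>. \<alpha> @ \<beta>)"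
        then obtain \<alpha> where "\<gamma> = \<alpha> @ \<beta>" by blast
        then have "\<beta> = drop (length \<alpha>) \<gamma>" "length \<alpha> \<le> length \<gamma>" by auto
        then show False using that by blast
      qed
      then show ?thesis by (simp add: l2_nth_Finf_ket[OF f])
    qed
  qed auto
  ultimately have "l2_nth (ampl f x) \<gamma>
      = (\<Sum>\<beta>\<in>(\<lambda>k. drop k \<gamma>) ` {..length \<gamma>}. l2_nth (f (ket \<beta>)) \<gamma> *\<^sub>C l2_nth x \<beta>)"
    by (rule has_sum_unique)
  also have "\<dots> = (\<Sum>k\<le>length \<gamma>. l2_nth (f (ket (drop k \<gamma>))) \<gamma> *\<^sub>C l2_nth x (drop k \<gamma>))"
  proof -
    have "inj_on (\<lambda>k. drop k \<gamma>) {..length \<gamma>}"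
    proof (rule inj_onI)
      fix j k assume "j \<in> {..length \<gamma>}" "k \<in> {..length \<gamma>}" "drop j \<gamma> = drop k \<gamma>"
      then show "j = k" using length_drop[of j \<gamma>] length_drop[of k \<gamma>] by simp
    qed
    then show ?thesis by (simp add: sum.reindex)
  qed
  also have "\<dots> = (\<Sum>k\<le>length \<gamma>. l2_nth (f (ket [])) (take k \<gamma>) *\<^sub>C l2_nth x (drop k \<gamma>))"
  proof (intro sum.cong refl)
    fix k assume "k \<in> {..length \<gamma>}"
    then have "length \<gamma> - length (drop k \<gamma>) = k" by simp
    moreover have "\<gamma> \<in> range (\<lambda>\<alpha>. \<alpha> @ drop k \<gamma>)" by (rule range_eqI[of _ _ "take k \<gamma>"]) simp
    ultimately show "l2_nth (f (ket (drop k \<gamma>))) \<gamma> *\<^sub>C l2_nth x (drop k \<gamma>)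
        = l2_nth (f (ket [])) (take k \<gamma>) *\<^sub>C l2_nth x (drop k \<gamma>)"
      by (subst l2_nth_Finf_ket[OF f]) simp
  qed
  finally show ?thesis .
qed

section \<open>Strong convergence of multipliers\<close>

text \<open>For eventually uniformly bounded operators, strong convergence passes to closed spans;
  it then suffices to test it on basis tensors.\<close>

lemma closed_csubspace_tendsto:
  fixes T :: "'r \<Rightarrow> 'a :: chilbert_space \<Rightarrow> 'b :: chilbert_space"
  assumes lin: "\<forall>\<^sub>F r in F. bounded_clinear (T r) \<and> (\<forall>x. norm (T r x) \<le> C * norm x)"
    and S: "bounded_clinear S"
  shows "closed_csubspace {x. ((\<lambda>r. T r x) \<longlongrightarrow> S x) F}"
  unfolding closed_csubspace_def mem_Collect_eq
proof (intro conjI ballI allI)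
  show "((\<lambda>r. T r 0) \<longlongrightarrow> S 0) F"
    by (rule tendsto_eventually, rule eventually_mono[OF lin])
      (simp add: bounded_clinear_0 bounded_clinear_0[OF S])
  fix x c assume "x \<in> {x. ((\<lambda>r. T r x) \<longlongrightarrow> S x) F}"
  then have x: "((\<lambda>r. T r x) \<longlongrightarrow> S x) F" by simp
  have "((\<lambda>r. c *\<^sub>C T r x) \<longlongrightarrow> c *\<^sub>C S x) F" by (intro scaleC.tendsto tendsto_const x)
  then show "((\<lambda>r. T r (c *\<^sub>C x)) \<longlongrightarrow> S (c *\<^sub>C x)) F"
    unfolding bounded_clinear_scaleC[OF S]
    by (rule Lim_transform_eventually) (auto intro: eventually_mono[OF lin] simp: bounded_clinear_scaleC)
  fix y assume "y \<in> {x. ((\<lambda>r. T r x) \<longlongrightarrow> S x) F}"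
  then have y: "((\<lambda>r. T r y) \<longlongrightarrow> S y) F" by simp
  have "((\<lambda>r. T r x + T r y) \<longlongrightarrow> S x + S y) F" by (intro tendsto_add x y)
  then show "((\<lambda>r. T r (x + y)) \<longlongrightarrow> S (x + y)) F"
    unfolding bounded_clinear_add[OF S]
    by (rule Lim_transform_eventually) (auto intro: eventually_mono[OF lin] simp: bounded_clinear_add)
next
  show "closed {x. ((\<lambda>r. T r x) \<longlongrightarrow> S x) F}"
    unfolding closed_limpt islimpt_approachable mem_Collect_eq
  proof (intro allI impI)
    fix x assume x: "\<forall>e>0. \<exists>x'\<in>{x. ((\<lambda>r. T r x) \<longlongrightarrow> S x) F}. x' \<noteq> x \<and> dist x' x < e"
    \<comment> \<open>A common Lipschitz constant for the family and its limit; the absolute value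
      covers a negative C, and the summand 1 makes K positive.\<close>
    define K where "K = \<bar>C\<bar> + onorm S + 1"
    have nS: "onorm S \<ge> 0" by (rule onorm_pos_le[OF bounded_clinear_bounded_linear[OF S]])
    have K: "K > 0" unfolding K_def using nS by simp
    show "((\<lambda>r. T r x) \<longlongrightarrow> S x) F"
    proof (rule tendstoI)
      fix e :: real assume e: "e > 0"
      then obtain x' where x': "((\<lambda>r. T r x') \<longlongrightarrow> S x') F" "dist x' x < e / (2 * K)"
        using x K by (metis divide_pos_pos mem_Collect_eq mult_pos_pos zero_less_numeral)
      have "\<forall>\<^sub>F r in F. dist (T r x') (S x') < e / 2" using x'(1) e by (intro tendstoD) auto
      then show "\<forall>\<^sub>F r in F. dist (T r x) (S x) < e"
        using lin
      proof eventually_elim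
        case (elim r)
        have "norm (T r x - T r x') \<le> C * norm (x - x')"
          using elim(2) by (simp add: bounded_clinear_diff[symmetric])
        moreover have "norm (S x - S x') \<le> onorm S * norm (x - x')"
          using bounded_clinear_onorm[OF S, of "x - x'"] by (simp add: bounded_clinear_diff[OF S])
        moreover have "C * norm (x - x') + onorm S * norm (x - x') \<le> K * norm (x - x')"
        proof -
          have "C + onorm S \<le> K" unfolding K_def by simp
          then show ?thesis using mult_right_mono[of "C + onorm S" K "norm (x - x')"]
            by (simp add: distrib_right)
        qed
        moreover have "K * norm (x - x') < e / 2"
          using x'(2) K by (simp add: dist_norm norm_minus_commute field_simps)
        moreover have "norm (T r x - S x) \<le> norm (T r x - T r x') + norm (T r x' - S x') + norm (S x - S x')"
          using norm_triangle_ineq[of "T r x - T r x'" "T r x' - S x'"]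
            norm_triangle_ineq4[of "T r x - S x'" "S x - S x'"] by simp
        ultimately show ?case using elim(1) by (simp add: dist_norm)
      qed
    qed
  qed
qed

text \<open>Dominated convergence: outside a finite set of coordinates the error is at most the tail
  of z, since |w - 1| \<le> 1, and on the finite set pointwise convergence of the weights is
  enough.\<close>

lemma l2_multiplier_tendsto:
  fixes z :: "('i, 'd :: chilbert_space) l2"
  assumes y: "\<forall>\<^sub>F r in R. \<forall>i. l2_nth (y r) i = w r i *\<^sub>R l2_nth z i \<and> 0 \<le> w r i \<and> w r i \<le> 1"
    and w: "\<And>i. ((\<lambda>r. w r i) \<longlongrightarrow> 1) R"
  shows "(y \<longlongrightarrow> z) R"
proof (rule tendstoI)
  fix e :: real assume e: "e > 0"
  have "((\<lambda>F. \<Sum>i\<in>F. ket i \<otimes>\<^sub>h l2_nth z i) \<longlongrightarrow> z) (finite_subsets_at_top UNIV)"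
    using has_sum_ket_tens[of z] by (simp add: has_sum_def)
  then have "\<forall>\<^sub>F F in finite_subsets_at_top UNIV. dist (\<Sum>i\<in>F. ket i \<otimes>\<^sub>h l2_nth z i) z < e / 2"
    using e by (intro tendstoD) auto
  then obtain F where F: "finite F" "dist (\<Sum>i\<in>F. ket i \<otimes>\<^sub>h l2_nth z i) z < e / 2"
    unfolding eventually_finite_subsets_at_top by auto
  define t where "t = z - (\<Sum>i\<in>F. ket i \<otimes>\<^sub>h l2_nth z i)"
  have t: "l2_nth t i = (if i \<in> F then 0 else l2_nth z i)" for i
    using F(1) by (simp add: t_def minus_l2.rep_eq l2_nth_sum l2_nth_ket_tens)
  have nt: "norm t < e / 2" using F(2) by (simp add: t_def dist_norm norm_minus_commute)
  have "((\<lambda>r. \<Sum>i\<in>F. (norm ((w r i - 1) *\<^sub>R l2_nth z i))\<^sup>2) \<longlongrightarrow> (\<Sum>i\<in>F. (norm ((1 - 1) *\<^sub>R l2_nth z i))\<^sup>2)) R"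
    by (intro tendsto_intros w)
  then have "((\<lambda>r. \<Sum>i\<in>F. (norm ((w r i - 1) *\<^sub>R l2_nth z i))\<^sup>2) \<longlongrightarrow> 0) R" by simp
  then have "\<forall>\<^sub>F r in R. (\<Sum>i\<in>F. (norm ((w r i - 1) *\<^sub>R l2_nth z i))\<^sup>2) < (e / 2)\<^sup>2"
    by (rule order_tendstoD) (use e in auto)
  then show "\<forall>\<^sub>F r in R. dist (y r) z < e"
    using y
  proof eventually_elim
    case (elim r)
    have "(norm (y r - z))\<^sup>2 \<le> (e / 2)\<^sup>2 + (norm t)\<^sup>2"
    proof (rule norm_l2_sq_leI)
      fix G :: "'i set" assume G: "finite G"
      have d: "l2_nth (y r - z) i = (w r i - 1) *\<^sub>R l2_nth z i" for i
        using elim(2) by (simp add: minus_l2.rep_eq scaleR_diff_left)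
      have "(\<Sum>i\<in>G. (norm (l2_nth (y r - z) i))\<^sup>2)
          = (\<Sum>i\<in>G \<inter> F. (norm (l2_nth (y r - z) i))\<^sup>2) + (\<Sum>i\<in>G - F. (norm (l2_nth (y r - z) i))\<^sup>2)"
        by (rule sum.Int_Diff[OF G])
      also have "(\<Sum>i\<in>G \<inter> F. (norm (l2_nth (y r - z) i))\<^sup>2) \<le> (\<Sum>i\<in>F. (norm ((w r i - 1) *\<^sub>R l2_nth z i))\<^sup>2)"
        unfolding d by (rule sum_mono2[OF F(1)]) auto
      also have "\<dots> \<le> (e / 2)\<^sup>2" using elim(1) by simp
      also have "(\<Sum>i\<in>G - F. (norm (l2_nth (y r - z) i))\<^sup>2) \<le> (\<Sum>i\<in>G - F. (norm (l2_nth t i))\<^sup>2)"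
      proof (rule sum_mono)
        fix i assume i: "i \<in> G - F"
        have "\<bar>w r i - 1\<bar> \<le> 1" using elim(2) by (auto simp: abs_le_iff intro: order_trans[of _ 1])
        then have "norm (l2_nth (y r - z) i) \<le> norm (l2_nth t i)"
          using i mult_right_mono[of "\<bar>w r i - 1\<bar>" 1 "norm (l2_nth z i)"] by (simp add: d t)
        then show "(norm (l2_nth (y r - z) i))\<^sup>2 \<le> (norm (l2_nth t i))\<^sup>2" by (rule power_mono) simp
      qed
      also have "\<dots> \<le> (norm t)\<^sup>2" using G by (intro l2_nth_sum_sq_le) auto
      finally show "(\<Sum>i\<in>G. (norm (l2_nth (y r - z) i))\<^sup>2) \<le> (e / 2)\<^sup>2 + (norm t)\<^sup>2" by simp
    qed
    also have "(norm t)\<^sup>2 \<le> (e / 2)\<^sup>2" using nt by (intro power_mono) auto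
    also have "(e / 2)\<^sup>2 + (e / 2)\<^sup>2 < e\<^sup>2" using e by (simp add: power2_eq_square field_simps)
    finally have "norm (y r - z) < e" using e by (simp add: power2_less_imp_less)
    then show ?case by (simp add: dist_norm)
  qed
qed

section \<open>Schur multiplication by powers of r\<close>

lemma finite_words_length: "finite {\<alpha> :: 'n :: finite list. length \<alpha> = k}"
  using finite_lists_length_eq[of "UNIV :: 'n set" k] by simp

lemma finite_words_length_le: "finite {\<alpha> :: 'n :: finite list. length \<alpha> \<le> k}"
  using finite_lists_length_le[of "UNIV :: 'n set" k] by simp

text \<open>A Gram representation of the Schur multiplier \<open>r\<^bsup>i - j\<^esup>\<close> on lower triangular matrices.\<close>

definition gram_weight :: "real \<Rightarrow> nat \<Rightarrow> nat \<Rightarrow> real"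
  where "gram_weight r g j = (if g \<le> j then r ^ (j - g) * (if g = 0 then 1 else sqrt (1 - r\<^sup>2)) else 0)"

text \<open>The weights are the coefficients of the stationary recursion X_0 = eps_0, X_(j+1) = r
  X_j + sqrt(1 - r^2) eps_(j+1) with orthonormal innovations eps_g. The covariance of X_j and
  X_(j-k) is r^k, and \<open>geo\<close> says that every X_m has variance 1.\<close>

lemma gram_weight_sum:
  assumes r: "0 \<le> r" "r < 1" and k: "k \<le> j" "j \<le> N"
  shows "(\<Sum>g\<le>N. gram_weight r g j * gram_weight r g (j - k)) = r ^ k"
proof -
  define m where "m = j - k"
  have j: "j = m + k" using k by (simp add: m_def)
  have sq: "sqrt (1 - r\<^sup>2) * sqrt (1 - r\<^sup>2) = 1 - r\<^sup>2" using r by (simp add: abs_square_le_1)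
  have geo: "(\<Sum>g\<le>m. (r\<^sup>2) ^ (m - g) * (if g = 0 then 1 else 1 - r\<^sup>2)) = 1"
  proof (induction m)
    case (Suc m)
    have "(\<Sum>g\<le>Suc m. (r\<^sup>2) ^ (Suc m - g) * (if g = 0 then 1 else 1 - r\<^sup>2))
        = (\<Sum>g\<le>m. r\<^sup>2 * ((r\<^sup>2) ^ (m - g) * (if g = 0 then 1 else 1 - r\<^sup>2))) + (1 - r\<^sup>2)"
      unfolding sum.atMost_Suc by (intro arg_cong2[where f = "(+)"] sum.cong) (auto simp: Suc_diff_le)
    also have "\<dots> = r\<^sup>2 * 1 + (1 - r\<^sup>2)" unfolding sum_distrib_left[symmetric] Suc.IH ..
    finally show ?case by simp
  qed simp
  have "(\<Sum>g\<le>N. gram_weight r g j * gram_weight r g m) = (\<Sum>g\<le>m. gram_weight r g j * gram_weight r g m)"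
    using k by (intro sum.mono_neutral_right) (auto simp: gram_weight_def m_def)
  also have "\<dots> = (\<Sum>g\<le>m. r ^ k * ((r\<^sup>2) ^ (m - g) * (if g = 0 then 1 else 1 - r\<^sup>2)))"
  proof (intro sum.cong refl)
    fix g assume "g \<in> {..m}"
    then have g: "g \<le> m" by simp
    have "r ^ (j - g) = r ^ k * r ^ (m - g)" using g by (simp add: j power_add[symmetric] add.commute)
    then show "gram_weight r g j * gram_weight r g m = r ^ k * ((r\<^sup>2) ^ (m - g) * (if g = 0 then 1 else 1 - r\<^sup>2))"
      using g sq by (simp add: gram_weight_def j power_mult[symmetric] power2_eq_square power_mult_distrib)
  qed
  also have "\<dots> = r ^ k" unfolding sum_distrib_left[symmetric] geo by simp
  finally show ?thesis by (simp add: m_def)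
qed

text \<open>A diagonal operator depending on word length, cut off at length N so that all sums are
  finite; with constant weight 1 it is the truncation itself.\<close>

definition length_weight :: "(nat \<Rightarrow> real) \<Rightarrow> nat \<Rightarrow> ('n :: finite list, 'd :: chilbert_space) l2 \<Rightarrow> ('n list, 'd) l2"
  where "length_weight w N x = (\<Sum>\<beta> | length \<beta> \<le> N. ket \<beta> \<otimes>\<^sub>h (w (length \<beta>) *\<^sub>R l2_nth x \<beta>))"

lemma l2_nth_length_weight:
  "l2_nth (length_weight w N x) \<gamma> = (if length \<gamma> \<le> N then w (length \<gamma>) *\<^sub>R l2_nth x \<gamma> else 0)"
  by (simp add: length_weight_def l2_nth_sum l2_nth_ket_tens finite_words_length_le)

lemma cinner_length_weight:
  "cinner u (length_weight w N x) = (\<Sum>\<beta> | length \<beta> \<le> N. w (length \<beta>) *\<^sub>R cinner (l2_nth u \<beta>) (l2_nth x \<beta>))"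
  by (simp add: length_weight_def cinner.sum_right cinner_ket_tens cinner.scaleR_right)

lemma norm_sq_length_weight:
  "(norm (length_weight w N x))\<^sup>2 = (\<Sum>\<beta> | length \<beta> \<le> N. (w (length \<beta>))\<^sup>2 * (norm (l2_nth x \<beta>))\<^sup>2)"
proof -
  have "Re (cinner (length_weight w N x) (length_weight w N x))
      = (\<Sum>\<beta> | length \<beta> \<le> N. Re (w (length \<beta>) *\<^sub>R cinner (l2_nth (length_weight w N x) \<beta>) (l2_nth x \<beta>)))"
    by (subst cinner_length_weight) (rule Re_sum)
  also have "\<dots> = (\<Sum>\<beta> | length \<beta> \<le> N. (w (length \<beta>))\<^sup>2 * (norm (l2_nth x \<beta>))\<^sup>2)"
    by (intro sum.cong refl)
      (simp add: l2_nth_length_weight cinner.scaleR_left norm_sq_cinner[symmetric] power2_eq_square[of "w _"])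
  finally show ?thesis by (simp add: norm_sq_cinner)
qed

text \<open>Let D_g be the diagonal operator with weights \<open>v g\<close>. Up to length N, the
  Gram identity gives y = sum_g D_g F D_g x. Pairing with y and applying Cauchy-Schwarz in the space
  and then over g, with sum_g D_g^2 = I on the truncation, returns the bound C of F itself,
  uniformly in r.\<close>

lemma schur_multiplier_bound:
  fixes F :: "('n :: finite list, 'd :: chilbert_space) l2 \<Rightarrow> ('n list, 'd) l2"
    and x y :: "('n list, 'd) l2"
  assumes F: "\<And>x. norm (F x) \<le> C * norm x"
    and Fc: "\<And>x \<gamma>. l2_nth (F x) \<gamma> = (\<Sum>k\<le>length \<gamma>. a (take k \<gamma>) *\<^sub>C l2_nth x (drop k \<gamma>))"
    and yc: "\<And>\<gamma>. l2_nth y \<gamma> = (\<Sum>k\<le>length \<gamma>. r ^ k *\<^sub>R (a (take k \<gamma>) *\<^sub>C l2_nth x (drop k \<gamma>)))"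
    and r: "0 \<le> r" "r < 1"
  shows "norm y \<le> C * norm x"
proof -
  have C: "0 \<le> C * norm x" using F[of x] norm_ge_zero[of "F x"] by linarith
  define v where "v = gram_weight r"
  have le: "norm (length_weight (\<lambda>_. 1) N y) \<le> C * norm x" for N
  proof -
    let ?L = "{\<gamma> :: 'n list. length \<gamma> \<le> N}"
    define Y where "Y = norm (length_weight (\<lambda>_. 1) N y)"
    define X where "X = norm (length_weight (\<lambda>_. 1) N x)"
    have XC: "X \<le> norm x"
    proof -
      have "X\<^sup>2 \<le> (norm x)\<^sup>2"
        unfolding X_def norm_sq_length_weight
        using l2_nth_sum_sq_le[OF finite_words_length_le, of x N] by simp
      then show ?thesis by (rule power2_le_imp_le) simp
    qed
    define xw where "xw g = length_weight (v g) N x" for g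
    define yw where "yw g = length_weight (v g) N y" for g
    have yg: "l2_nth y \<gamma> = (\<Sum>g\<le>N. v g (length \<gamma>) *\<^sub>R l2_nth (F (xw g)) \<gamma>)"
      if \<gamma>: "length \<gamma> \<le> N" for \<gamma>
    proof -
      have "(\<Sum>g\<le>N. v g (length \<gamma>) *\<^sub>R l2_nth (F (xw g)) \<gamma>)
          = (\<Sum>g\<le>N. \<Sum>k\<le>length \<gamma>. (v g (length \<gamma>) * v g (length \<gamma> - k)) *\<^sub>R (a (take k \<gamma>) *\<^sub>C l2_nth x (drop k \<gamma>)))"
        unfolding Fc scaleR_sum_right
        by (intro sum.cong refl) (simp add: xw_def l2_nth_length_weight scaleC.scaleR_right le_trans[OF diff_le_self \<gamma>])
      also have "\<dots> = (\<Sum>k\<le>length \<gamma>. (\<Sum>g\<le>N. v g (length \<gamma>) * v g (length \<gamma> - k)) *\<^sub>R (a (take k \<gamma>) *\<^sub>C l2_nth x (drop k \<gamma>)))"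
        unfolding scaleR_sum_left by (rule sum.swap)
      also have "\<dots> = l2_nth y \<gamma>"
        unfolding yc v_def using \<gamma> by (intro sum.cong refl) (simp add: gram_weight_sum[OF r])
      finally show ?thesis by simp
    qed
    \<comment> \<open>The diagonal case k = 0 of the Gram identity; the term
      \<open>length \<beta> - 0\<close> is written to match its form.\<close>
    have vv: "(\<Sum>g\<le>N. (norm (length_weight (v g) N u))\<^sup>2) = (norm (length_weight (\<lambda>_. 1) N u))\<^sup>2"
      for u :: "('n list, 'd) l2"
    proof -
      have "(\<Sum>g\<le>N. (norm (length_weight (v g) N u))\<^sup>2)
          = (\<Sum>\<beta>\<in>?L. (\<Sum>g\<le>N. v g (length \<beta>) * v g (length \<beta> - 0)) * (norm (l2_nth u \<beta>))\<^sup>2)"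
        unfolding norm_sq_length_weight sum_distrib_right
        by (subst sum.swap) (simp add: power2_eq_square)
      also have "\<dots> = (\<Sum>\<beta>\<in>?L. 1\<^sup>2 * (norm (l2_nth u \<beta>))\<^sup>2)"
        unfolding v_def by (intro sum.cong refl) (simp only: mem_Collect_eq gram_weight_sum[OF r le0], simp)
      finally show ?thesis unfolding norm_sq_length_weight .
    qed
    have "complex_of_real (Y\<^sup>2) = (\<Sum>\<gamma>\<in>?L. cinner (l2_nth y \<gamma>) (l2_nth y \<gamma>))"
      unfolding Y_def norm_sq_length_weight of_real_sum by (simp add: cinner_self)
    also have "\<dots> = (\<Sum>\<gamma>\<in>?L. \<Sum>g\<le>N. v g (length \<gamma>) *\<^sub>R cinner (l2_nth (F (xw g)) \<gamma>) (l2_nth y \<gamma>))"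
      by (intro sum.cong refl) (simp only: mem_Collect_eq yg cinner.sum_left cinner.scaleR_left)
    also have "\<dots> = (\<Sum>g\<le>N. cinner (F (xw g)) (yw g))"
      unfolding yw_def cinner_length_weight by (rule sum.swap)
    finally have "Y\<^sup>2 = (\<Sum>g\<le>N. Re (cinner (F (xw g)) (yw g)))"
      by (metis Re_complex_of_real Re_sum)
    also have "\<dots> \<le> (\<Sum>g\<le>N. C * (norm (xw g) * norm (yw g)))"
    proof (rule sum_mono)
      fix g
      show "Re (cinner (F (xw g)) (yw g))
          \<le> C * (norm (xw g) * norm (yw g))"
        using Re_cinner_le[of "F (xw g)" "yw g"]
          mult_right_mono[OF F[of "xw g"], of "norm (yw g)"]
        by (simp add: mult_ac)
    qed
    also have "\<dots> = C * (\<Sum>g\<le>N. norm (xw g) * norm (yw g))"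
      by (rule sum_distrib_left[symmetric])
    finally have 1: "Y\<^sup>2 \<le> C * (\<Sum>g\<le>N. norm (xw g) * norm (yw g))" .
    have 2: "(\<Sum>g\<le>N. norm (xw g) * norm (yw g)) \<le> X * Y"
      using L2_set_mult_ineq[of "\<lambda>g. norm (xw g)" "\<lambda>g. norm (yw g)" "{..N}"]
      by (simp add: L2_set_def xw_def yw_def vv X_def Y_def)
    show ?thesis
    proof (cases "Y = 0")
      case True
      then show ?thesis using C by (simp add: Y_def)
    next
      case False
      then have Y: "Y > 0" by (simp add: Y_def)
      \<comment> \<open>The sign of C is extracted from the estimate: a negative C would make the
        positive number Y^2 nonpositive.\<close>
      have C0: "C \<ge> 0"
      proof (rule ccontr)
        assume "\<not> 0 \<le> C"
        moreover have "(\<Sum>g\<le>N. norm (xw g) * norm (yw g)) \<ge> 0"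
          by (intro sum_nonneg mult_nonneg_nonneg) auto
        ultimately have "Y\<^sup>2 \<le> 0" using 1 by (meson linear mult_nonpos_nonneg order_trans)
        then show False using Y by simp
      qed
      have "Y * Y \<le> C * (X * Y)" using 1 mult_left_mono[OF 2 C0] by (simp add: power2_eq_square)
      then have "Y \<le> C * X" using Y by (simp add: mult.assoc[symmetric])
      also have "\<dots> \<le> C * norm x" by (rule mult_left_mono[OF XC C0])
      finally show ?thesis by (simp add: Y_def)
    qed
  qed
  \<comment> \<open>Every finite set of words has bounded length, so the truncated bounds control
    all finite partial sums of the norm.\<close>
  have "(norm y)\<^sup>2 \<le> (C * norm x)\<^sup>2"
  proof (rule norm_l2_sq_leI)
    fix G :: "'n list set" assume G: "finite G"
    obtain N where N: "\<And>\<gamma>. \<gamma> \<in> G \<Longrightarrow> length \<gamma> \<le> N"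
      using finite_nat_set_iff_bounded_le[of "length ` G"] G by auto
    have "(\<Sum>\<gamma>\<in>G. (norm (l2_nth y \<gamma>))\<^sup>2) \<le> (norm (length_weight (\<lambda>_. 1) N y))\<^sup>2"
      unfolding norm_sq_length_weight
      using N by (simp, intro sum_mono2 finite_words_length_le) auto
    also have "\<dots> \<le> (C * norm x)\<^sup>2" by (intro power_mono le) auto
    finally show "(\<Sum>\<gamma>\<in>G. (norm (l2_nth y \<gamma>))\<^sup>2) \<le> (C * norm x)\<^sup>2" .
  qed
  then show ?thesis using C by (rule power2_le_imp_le)
qed


section \<open>Abel means and the functional calculus\<close>

text \<open>The homogeneous part of degree k of f(r S_1, ..., r S_n) \<otimes> I.\<close>

definition poisson_term ::
    "('n :: finite fock \<Rightarrow> 'n fock) \<Rightarrow> real \<Rightarrow> nat \<Rightarrow> ('n list, 'd :: chilbert_space) l2 \<Rightarrow> ('n list, 'd) l2"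
  where "poisson_term f r k x = (\<Sum>\<alpha> | length \<alpha> = k.
    (complex_of_real r ^ length \<alpha> * l2_nth (f (ket [])) \<alpha>) *\<^sub>C cword \<alpha> x)"

definition poisson_sum ::
    "('n :: finite fock \<Rightarrow> 'n fock) \<Rightarrow> real \<Rightarrow> ('n list, 'd :: chilbert_space) l2 \<Rightarrow> ('n list, 'd) l2"
  where "poisson_sum f r x = (\<Sum>k. poisson_term f r k x)"

lemma bounded_clinear_poisson_term: "bounded_clinear (poisson_term f r k)"
  unfolding poisson_term_def[abs_def]
  by (intro bounded_clinear_setsum bounded_clinear_scale bounded_clinear_cword)

text \<open>Isometries belonging to words of the same length have orthogonal ranges, so Pythagoras
  replaces the sum of the absolute coefficients by their l2 norm. The factor \<open>r ^ k\<close>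
  then gives geometric convergence.\<close>

lemma norm_poisson_term_le:
  assumes "0 \<le> r"
  shows "norm (poisson_term f r k x) \<le> r ^ k * (norm (f (ket [])) * norm x)"
proof -
  define a where "a = l2_nth (f (ket []))"
  have "(norm (poisson_term f r k x))\<^sup>2
      = (\<Sum>\<alpha> | length \<alpha> = k. (norm ((complex_of_real r ^ length \<alpha> * a \<alpha>) *\<^sub>C cword \<alpha> x))\<^sup>2)"
    unfolding poisson_term_def a_def
  proof (rule norm_sq_sum_orth[OF finite_words_length])
    fix \<alpha> \<beta> :: "'a list" assume "\<alpha> \<in> {\<alpha>. length \<alpha> = k}" "\<beta> \<in> {\<alpha>. length \<alpha> = k}" "\<alpha> \<noteq> \<beta>"
    then have "cinner (cword \<alpha> x) (cword \<beta> x) = 0"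
      by (subst cinner_cadj[OF bounded_clinear_cword]) (simp add: cadj_cword_cword)
    then show "cinner ((complex_of_real r ^ length \<alpha> * l2_nth (f (ket [])) \<alpha>) *\<^sub>C cword \<alpha> x)
        ((complex_of_real r ^ length \<beta> * l2_nth (f (ket [])) \<beta>) *\<^sub>C cword \<beta> x) = 0"
      by (simp add: cinner_scaleC_left cinner_scaleC_right)
  qed
  also have "\<dots> = (r ^ k)\<^sup>2 * (norm x)\<^sup>2 * (\<Sum>\<alpha> | length \<alpha> = k. (norm (a \<alpha>))\<^sup>2)"
    unfolding sum_distrib_left using assms
    by (intro sum.cong refl) (simp add: norm_scaleC norm_cword norm_mult norm_power power_mult_distrib mult_ac)
  also have "\<dots> \<le> (r ^ k)\<^sup>2 * (norm x)\<^sup>2 * (norm (f (ket [])))\<^sup>2"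
    unfolding a_def by (intro mult_left_mono l2_nth_sum_sq_le finite_words_length) auto
  also have "\<dots> = (r ^ k * (norm (f (ket [])) * norm x))\<^sup>2" by (simp add: power_mult_distrib mult_ac)
  finally show ?thesis by (rule power2_le_imp_le) (simp add: assms)
qed

lemma poisson_sums:
  assumes r: "0 \<le> r" "r < 1"
  shows "(\<lambda>k. poisson_term f r k x) sums poisson_sum f r x"
proof -
  have "summable (\<lambda>k. poisson_term f r k x)"
  proof (rule summable_comparison_test')
    show "summable (\<lambda>k. r ^ k * (norm (f (ket [])) * norm x))"
      using r by (intro summable_mult2 summable_geometric) simp
    show "norm (poisson_term f r k x) \<le> r ^ k * (norm (f (ket [])) * norm x)" if "k \<ge> 0" for k
      by (rule norm_poisson_term_le[OF r(1)])
  qed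
  then show ?thesis unfolding poisson_sum_def by (rule summable_sums)
qed

lemma l2_nth_poisson_term:
  "l2_nth (poisson_term f r k x) \<gamma>
    = (if k \<le> length \<gamma> then r ^ k *\<^sub>R (l2_nth (f (ket [])) (take k \<gamma>) *\<^sub>C l2_nth x (drop k \<gamma>)) else 0)"
proof -
  define c where "c \<alpha> = complex_of_real r ^ length \<alpha> * l2_nth (f (ket [])) \<alpha>" for \<alpha>
  have "l2_nth (poisson_term f r k x) \<gamma>
      = (\<Sum>\<alpha> | length \<alpha> = k. if take k \<gamma> = \<alpha> then c \<alpha> *\<^sub>C l2_nth x (drop k \<gamma>) else 0)"
    unfolding poisson_term_def l2_nth_sum c_def[symmetric]
    by (intro sum.cong refl) (auto simp: scaleC_l2.rep_eq l2_nth_cword)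
  also have "\<dots> = (if length (take k \<gamma>) = k then c (take k \<gamma>) *\<^sub>C l2_nth x (drop k \<gamma>) else 0)"
    by (simp add: finite_words_length)
  also have "\<dots> = (if k \<le> length \<gamma> then r ^ k *\<^sub>R (l2_nth (f (ket [])) (take k \<gamma>) *\<^sub>C l2_nth x (drop k \<gamma>)) else 0)"
    by (auto simp: c_def scaleC_of_real[symmetric] scaleC_scaleC)
  finally show ?thesis .
qed

lemma l2_nth_poisson_sum:
  assumes "0 \<le> r" "r < 1"
  shows "l2_nth (poisson_sum f r x) \<gamma>
    = (\<Sum>k\<le>length \<gamma>. r ^ k *\<^sub>R (l2_nth (f (ket [])) (take k \<gamma>) *\<^sub>C l2_nth x (drop k \<gamma>)))"
proof -
  have "(\<lambda>k. l2_nth (poisson_term f r k x) \<gamma>) sums l2_nth (poisson_sum f r x) \<gamma>"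
    by (rule bounded_linear.sums[OF bounded_clinear_bounded_linear[OF bounded_clinear_l2_nth] poisson_sums[OF assms]])
  moreover have "(\<lambda>k. l2_nth (poisson_term f r k x) \<gamma>) sums (\<Sum>k\<le>length \<gamma>. l2_nth (poisson_term f r k x) \<gamma>)"
    by (rule sums_finite) (auto simp: l2_nth_poisson_term)
  ultimately have "l2_nth (poisson_sum f r x) \<gamma> = (\<Sum>k\<le>length \<gamma>. l2_nth (poisson_term f r k x) \<gamma>)"
    by (rule sums_unique2)
  then show ?thesis by (simp add: l2_nth_poisson_term)
qed

text \<open>The geometric estimate of the terms blows up as r tends to 1; this bound does not depend
  on r.\<close>

lemma norm_poisson_sum_le:
  assumes f: "f \<in> Finf" and r: "0 \<le> r" "r < 1"
  shows "norm (poisson_sum f r x) \<le> onorm (ampl f :: ('n :: finite list, 'd :: chilbert_space) l2 \<Rightarrow> _) * norm (x :: ('n list, 'd) l2)"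
proof (rule schur_multiplier_bound[where F = "ampl f" and a = "l2_nth (f (ket []))" and r = r])
  show "l2_nth (poisson_sum f r x) \<gamma>
      = (\<Sum>k\<le>length \<gamma>. r ^ k *\<^sub>R l2_nth (f (ket [])) (take k \<gamma>) *\<^sub>C l2_nth x (drop k \<gamma>))" for \<gamma>
    by (rule l2_nth_poisson_sum[OF r])
qed (auto simp: r bounded_clinear_onorm[OF bounded_clinear_ampl[OF Finf_bounded[OF f]]] l2_nth_ampl_Finf[OF f])

lemma bounded_clinear_poisson_sum:
  assumes f: "f \<in> Finf" and r: "0 \<le> r" "r < 1"
  shows "bounded_clinear (poisson_sum f r)"
proof (rule bounded_clinearI[OF _ _ norm_poisson_sum_le[OF f r]])
  fix x y c
  show "poisson_sum f r (x + y) = poisson_sum f r x + poisson_sum f r y"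
    using sums_add[OF poisson_sums[OF r, of f x] poisson_sums[OF r, of f y]] poisson_sums[OF r, of f "x + y"]
    by (simp add: bounded_clinear_add[OF bounded_clinear_poisson_term] sums_unique2)
  have "(\<lambda>k. c *\<^sub>C poisson_term f r k x) sums (c *\<^sub>C poisson_sum f r x)"
    by (rule bounded_linear.sums[OF scaleC.bounded_linear_right poisson_sums[OF r]])
  then show "poisson_sum f r (c *\<^sub>C x) = c *\<^sub>C poisson_sum f r x"
    using poisson_sums[OF r, of f "c *\<^sub>C x"]
    by (simp add: bounded_clinear_scaleC[OF bounded_clinear_poisson_term] sums_unique2)
qed

lemma eventually_at_left_1: "\<forall>\<^sub>F r in at_left (1 :: real). 0 < r \<and> r < 1"
  using eventually_at_left_real[of 0 "1 :: real"] by simp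

lemma poisson_sum_tendsto:
  fixes x :: "('n :: finite list, 'd :: chilbert_space) l2"
  assumes f: "f \<in> Finf"
  shows "((\<lambda>r. poisson_sum f r x) \<longlongrightarrow> ampl f x) (at_left 1)"
proof -
  let ?M = "{x :: ('n list, 'd) l2. ((\<lambda>r. poisson_sum f r x) \<longlongrightarrow> ampl f x) (at_left 1)}"
  note F = bounded_clinear_ampl[OF Finf_bounded[OF f]]
  have M: "closed_csubspace ?M"
    by (rule closed_csubspace_tendsto[where C = "onorm (ampl f :: ('n list, 'd) l2 \<Rightarrow> _)",
          OF eventually_mono[OF eventually_at_left_1] F])
      (simp add: bounded_clinear_poisson_sum[OF f] norm_poisson_sum_le[OF f])
  have "ket \<beta> \<otimes>\<^sub>h d \<in> ?M" for \<beta> d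
  proof (rule CollectI, rule l2_multiplier_tendsto)
    show "((\<lambda>r. r ^ (length \<gamma> - length \<beta>)) \<longlongrightarrow> (1 :: real)) (at_left 1)" for \<gamma> :: "'n list"
      using tendsto_power[OF tendsto_ident_at[of "1 :: real" "{..<1}"], of "length \<gamma> - length \<beta>"] by simp
    \<comment> \<open>Only the splitting of \<gamma> with suffix \<beta> contributes, which forces k
      = |\<gamma>| - |\<beta>|. If \<gamma> does not end in \<beta>, both sides vanish, so the
      truncated subtraction is harmless.\<close>
    have "l2_nth (poisson_sum f r (ket \<beta> \<otimes>\<^sub>h d)) \<gamma>
        = r ^ (length \<gamma> - length \<beta>) *\<^sub>R l2_nth (ampl f (ket \<beta> \<otimes>\<^sub>h d)) \<gamma>" if r: "0 < r" "r < 1" for r \<gamma>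
      unfolding l2_nth_poisson_sum[OF less_imp_le[OF r(1)] r(2)] l2_nth_ampl_Finf[OF f] scaleR_sum_right
      by (intro sum.cong refl) (auto simp: l2_nth_ket_tens)
    then show "\<forall>\<^sub>F r in at_left 1. \<forall>\<gamma>. l2_nth (poisson_sum f r (ket \<beta> \<otimes>\<^sub>h d)) \<gamma>
        = r ^ (length \<gamma> - length \<beta>) *\<^sub>R l2_nth (ampl f (ket \<beta> \<otimes>\<^sub>h d)) \<gamma>
        \<and> 0 \<le> r ^ (length \<gamma> - length \<beta>) \<and> r ^ (length \<gamma> - length \<beta>) \<le> 1"
      by (intro eventually_mono[OF eventually_at_left_1]) (auto intro: power_le_one)
  qed
  then have "x \<in> ?M"
    using has_sum_in_closed_csubspace[OF M has_sum_ket_tens[of x]] by blast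
  then show ?thesis by simp
qed

text \<open>Existence and value of the Abel limit for every tuple whose words factor through the
  amplified shift. It is applied with L the adjoint of the Poisson kernel and with L the projection
  onto a co-invariant subspace.\<close>

lemma fcalc_eq:
  fixes X :: "'n :: finite \<Rightarrow> 'h :: chilbert_space \<Rightarrow> 'h" and x :: "('n list, 'd :: chilbert_space) l2"
  assumes f: "f \<in> Finf" and L: "bounded_clinear L"
    and X: "\<And>\<alpha>. opword X \<alpha> h = L (cword \<alpha> x)"
  shows "fcalc f X h = L (ampl f x)"
proof -
  have "((\<lambda>r. \<Sum>k. \<Sum>\<alpha> | length \<alpha> = k. (complex_of_real r ^ length \<alpha> * l2_nth (f (ket [])) \<alpha>) *\<^sub>C opword X \<alpha> h)
      \<longlongrightarrow> L (ampl f x)) (at_left 1)"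
  proof (rule Lim_transform_eventually[OF bounded_clinear_tendsto[OF L poisson_sum_tendsto[OF f]]])
    have "L (poisson_sum f r x) = (\<Sum>k. \<Sum>\<alpha> | length \<alpha> = k. (complex_of_real r ^ length \<alpha> * l2_nth (f (ket [])) \<alpha>) *\<^sub>C opword X \<alpha> h)"
      if r: "0 < r" "r < 1" for r
    proof -
      have "(\<lambda>k. L (poisson_term f r k x)) sums L (poisson_sum f r x)"
        by (rule bounded_linear.sums[OF bounded_clinear_bounded_linear[OF L] poisson_sums[OF less_imp_le[OF r(1)] r(2)]])
      moreover have "L (poisson_term f r k x)
          = (\<Sum>\<alpha> | length \<alpha> = k. (complex_of_real r ^ length \<alpha> * l2_nth (f (ket [])) \<alpha>) *\<^sub>C opword X \<alpha> h)" for k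
        unfolding poisson_term_def by (simp only: bounded_clinear_sum[OF L] bounded_clinear_scaleC[OF L] X)
      ultimately show ?thesis by (simp add: sums_iff)
    qed
    then show "\<forall>\<^sub>F r in at_left 1. L (poisson_sum f r x)
        = (\<Sum>k. \<Sum>\<alpha> | length \<alpha> = k. (complex_of_real r ^ length \<alpha> * l2_nth (f (ket [])) \<alpha>) *\<^sub>C opword X \<alpha> h)"
      by (intro eventually_mono[OF eventually_at_left_1]) auto
  qed
  then show ?thesis unfolding fcalc_def by (intro tendsto_Lim) simp
qed

text \<open>A subspace co-invariant under the creation operators is co-invariant under all of
  \<open>F\<^sup>\<infinity> \<otimes> I\<close>; hence \<open>(f \<otimes> I)\<^sup>*\<close> maps \<open>M\<close> into both \<open>M\<^sup>\<bottom>\<^sup>\<bottom>\<close> and \<open>M\<^sup>\<bottom>\<close> below.\<close>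

lemma coinvariant_annihilated:
  fixes M :: "('n :: finite list, 'd :: chilbert_space) l2 set"
  assumes f: "f \<in> Finf" and co: "coinvariant M (\<lambda>i. ampl (creation i))"
    and z: "\<And>x y. x \<in> M \<Longrightarrow> y \<in> M \<Longrightarrow> cinner (ampl f x) y = 0" and x: "x \<in> M"
  shows "cinner x (ampl f y) = 0"
proof -
  note F = bounded_clinear_ampl[OF Finf_bounded[OF f]]
  define w where "w = cadj (ampl f) x"
  have w1: "w \<in> ortho M"
    using z x by (auto simp: w_def ortho_def cinner_cadj_left[OF F] cinner_eq_0_commute[of x])
  have cw: "cadj (cword \<alpha>) x \<in> M" for \<alpha>
    unfolding cword_def by (rule cadj_opword_in[OF bounded_clinear_ampl[OF bounded_clinear_creation] co x])
  have "cinner x (ampl f v) = 0" if v: "v \<in> ortho M" for v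
  proof -
    have "cinner x (poisson_sum f r v) = 0" if r: "0 < r" "r < 1" for r
    proof -
      have "cinner x (cword \<alpha> v) = 0" for \<alpha>
        using cw[of \<alpha>] v by (simp add: cinner_cadj_left[OF bounded_clinear_cword, symmetric]
            ortho_def cinner_eq_0_commute[of _ v])
      then have "cinner x (poisson_term f r k v) = 0" for k
        unfolding poisson_term_def cinner.sum_right cinner_scaleC_right by simp
      moreover have "(\<lambda>k. cinner x (poisson_term f r k v)) sums cinner x (poisson_sum f r v)"
        by (rule bounded_linear.sums[OF cinner.bounded_linear_right poisson_sums[OF less_imp_le[OF r(1)] r(2)]])
      ultimately show ?thesis by (simp add: sums_iff)
    qed
    then have ev: "\<forall>\<^sub>F r in at_left 1. cinner x (poisson_sum f r v) = 0"
      by (intro eventually_mono[OF eventually_at_left_1]) auto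
    have "((\<lambda>r. cinner x (poisson_sum f r v)) \<longlongrightarrow> cinner x (ampl f v)) (at_left 1)"
      by (intro cinner.tendsto tendsto_const poisson_sum_tendsto f)
    moreover have "((\<lambda>r. cinner x (poisson_sum f r v)) \<longlongrightarrow> 0) (at_left 1)"
      using ev by (rule tendsto_eventually)
    ultimately show ?thesis by (intro tendsto_unique[of "at_left (1::real)"]) auto
  qed
  \<comment> \<open>The vanishing on the orthogonal complement is applied to w itself: <x, (f
    \<otimes> I) w> equals <w, w>.\<close>
  from this[OF w1] have "cinner w w = 0" unfolding w_def by (simp add: cinner_cadj_left[OF F])
  then have "w = 0" by (simp add: cinner_eq_0_self)
  then show ?thesis by (simp add: w_def cinner_cadj_left[OF F, symmetric])
qed

section \<open>Row contractions and Poisson kernels\<close>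

lemma cinner_defect_sq:
  assumes "row_contraction T"
  shows "Re (cinner (defect_sq T x) x) = (norm x)\<^sup>2 - (\<Sum>i\<in>UNIV. (norm (cadj (T i) x))\<^sup>2)"
proof -
  have b: "bounded_clinear (T i)" for i using assms by (simp add: row_contraction_def)
  have "Re (cinner (T i (cadj (T i) x)) x) = (norm (cadj (T i) x))\<^sup>2" for i
    unfolding cinner_cadj[OF b] by (rule norm_sq_cinner[symmetric])
  then show ?thesis
    by (simp add: defect_sq_def cinner.diff_left cinner.sum_left norm_sq_cinner[symmetric])
qed

text \<open>The sum subtracted in the squared defect is positive, so the squared defect is at most
  I, as the square root construction requires. The norm formula uses that the root is
  self-adjoint.\<close>

lemma defect_props:
  assumes T: "row_contraction T"
  shows pos_op_defect: "pos_op (defect T)"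
    and norm_sq_defect: "(norm (defect T x))\<^sup>2 = (norm x)\<^sup>2 - (\<Sum>i\<in>UNIV. (norm (cadj (T i) x))\<^sup>2)"
proof -
  have p: "pos_op (defect_sq T)" using T by (simp add: row_contraction_def)
  have le: "Re (cinner (defect_sq T x) x) \<le> (norm x)\<^sup>2" for x
    unfolding cinner_defect_sq[OF T] by (simp add: sum_nonneg)
  show pd: "pos_op (defect T)" unfolding defect_def by (rule op_sqrt_pos[OF p le])
  have "(norm (defect T x))\<^sup>2 = Re (cinner (defect T (defect T x)) x)"
    by (simp add: norm_sq_cinner pos_op_selfadjoint[OF pd])
  also have "defect T (defect T x) = defect_sq T x" unfolding defect_def by (rule op_sqrt_square[OF p le])
  finally show "(norm (defect T x))\<^sup>2 = (norm x)\<^sup>2 - (\<Sum>i\<in>UNIV. (norm (cadj (T i) x))\<^sup>2)"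
    by (simp add: cinner_defect_sq[OF T])
qed

lemma closed_csubspace_defect_space: "row_contraction T \<Longrightarrow> closed_csubspace (defect_space T)"
  unfolding defect_space_def
  by (simp add: closed_csubspace_closure_range pos_op_bounded pos_op_defect closed_csubspace_ccspan)

lemma defect_in_defect_space: "defect T x \<in> defect_space T"
  unfolding defect_space_def by (rule subsetD[OF closure_subset]) simp

lemma opword_append: "opword X (\<alpha> @ \<beta>) = opword X \<alpha> \<circ> opword X \<beta>"
  by (induction \<alpha>) auto

lemma cadj_opword_append:
  "(\<And>i. bounded_clinear (X i)) \<Longrightarrow> cadj (opword X (\<alpha> @ \<beta>)) = cadj (opword X \<beta>) \<circ> cadj (opword X \<alpha>)"
  unfolding opword_append by (intro cadj_compose bounded_clinear_opword)

text \<open>Words grow at the right end: the adjoint of the extended word applies the adjoint of the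
  new letter last, so the defect identity can be used at the vector produced by the shorter
  word.\<close>

lemma sum_words_Suc:
  fixes g :: "'n :: finite list \<Rightarrow> 'a :: comm_monoid_add"
  shows "(\<Sum>\<alpha> | length \<alpha> = Suc k. g \<alpha>) = (\<Sum>\<beta> | length \<beta> = k. \<Sum>i\<in>UNIV. g (\<beta> @ [i]))"
proof -
  have "{\<alpha> :: 'n list. length \<alpha> = Suc k} = (\<lambda>(\<beta>, i). \<beta> @ [i]) ` ({\<beta>. length \<beta> = k} \<times> UNIV)"
  proof (intro set_eqI iffI)
    fix \<alpha> :: "'n list" assume "\<alpha> \<in> {\<alpha>. length \<alpha> = Suc k}"
    then have "\<alpha> = butlast \<alpha> @ [last \<alpha>]" "length (butlast \<alpha>) = k"
      by (auto intro!: append_butlast_last_id[symmetric])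
    then show "\<alpha> \<in> (\<lambda>(\<beta>, i). \<beta> @ [i]) ` ({\<beta>. length \<beta> = k} \<times> UNIV)"
      by (intro image_eqI[of _ _ "(butlast \<alpha>, last \<alpha>)"]) auto
  qed auto
  moreover have "inj_on (\<lambda>(\<beta>, i). \<beta> @ [i]) ({\<beta> :: 'n list. length \<beta> = k} \<times> UNIV)"
    by (auto simp: inj_on_def)
  ultimately show ?thesis by (simp add: sum.reindex sum.cartesian_product split_def)
qed

context
  fixes T :: "'n :: finite \<Rightarrow> 'h :: chilbert_space \<Rightarrow> 'h"
  assumes pure: "pure_row_contraction T"
begin

lemma pure_row_contraction_row: "row_contraction T"
  using pure by (simp add: pure_row_contraction_def)

lemma pure_row_contraction_bounded: "bounded_clinear (T i)"
  using pure_row_contraction_row by (simp add: row_contraction_def)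

lemma bounded_clinear_defect: "bounded_clinear (defect T)"
  by (rule pos_op_bounded[OF pos_op_defect[OF pure_row_contraction_row]])

text \<open>The defect terms of length m are the difference of two consecutive remainders, so the
  sum telescopes.\<close>

lemma sum_defect_words:
  "(\<Sum>\<alpha> | length \<alpha> < m. (norm (defect T (cadj (opword T \<alpha>) h)))\<^sup>2)
    = (norm h)\<^sup>2 - (\<Sum>\<alpha> | length \<alpha> = m. (norm (cadj (opword T \<alpha>) h))\<^sup>2)"
proof (induction m)
  case 0 then show ?case by (simp add: cadj_id)
next
  case (Suc m)
  have "{\<alpha> :: 'n list. length \<alpha> < Suc m} = {\<alpha>. length \<alpha> < m} \<union> {\<alpha>. length \<alpha> = m}" by auto
  moreover have "finite {\<alpha> :: 'n list. length \<alpha> < m}"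
    by (rule finite_subset[OF _ finite_words_length_le[of m]]) auto
  ultimately have "(\<Sum>\<alpha> | length \<alpha> < Suc m. (norm (defect T (cadj (opword T \<alpha>) h)))\<^sup>2)
      = (\<Sum>\<alpha> | length \<alpha> < m. (norm (defect T (cadj (opword T \<alpha>) h)))\<^sup>2)
      + (\<Sum>\<alpha> | length \<alpha> = m. (norm (defect T (cadj (opword T \<alpha>) h)))\<^sup>2)"
    by (simp add: finite_words_length) (rule sum.union_disjoint, auto simp: finite_words_length)
  also have "(\<Sum>\<alpha> | length \<alpha> = m. (norm (defect T (cadj (opword T \<alpha>) h)))\<^sup>2)
      = (\<Sum>\<alpha> | length \<alpha> = m. (norm (cadj (opword T \<alpha>) h))\<^sup>2)
      - (\<Sum>\<alpha> | length \<alpha> = Suc m. (norm (cadj (opword T \<alpha>) h))\<^sup>2)"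
    unfolding norm_sq_defect[OF pure_row_contraction_row] sum_subtractf sum_words_Suc
    by (simp add: cadj_opword_append[OF pure_row_contraction_bounded] cadj_compose bounded_clinear_id
        pure_row_contraction_bounded cadj_id)
  finally show ?case using Suc.IH by simp
qed

lemma sum_words_tendsto_0: "(\<lambda>m. \<Sum>\<alpha> | length \<alpha> = m. (norm (cadj (opword T \<alpha>) h))\<^sup>2) \<longlonglongrightarrow> 0"
proof -
  have "(\<lambda>m. \<Sum>\<alpha> | length \<alpha> = m. opword T \<alpha> (cadj (opword T \<alpha>) h)) \<longlonglongrightarrow> 0"
    using pure by (simp add: pure_row_contraction_def)
  then have "(\<lambda>m. Re (cinner (\<Sum>\<alpha> | length \<alpha> = m. opword T \<alpha> (cadj (opword T \<alpha>) h)) h)) \<longlonglongrightarrow> Re (cinner 0 h)"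
    by (intro tendsto_Re cinner.tendsto tendsto_const)
  moreover have "Re (cinner (opword T \<alpha> (cadj (opword T \<alpha>) h)) h) = (norm (cadj (opword T \<alpha>) h))\<^sup>2" for \<alpha>
    unfolding cinner_cadj[OF bounded_clinear_opword[OF pure_row_contraction_bounded]]
    by (rule norm_sq_cinner[symmetric])
  ultimately show ?thesis by (simp add: cinner.sum_left)
qed

lemma sum_defect_words_le:
  assumes F: "finite F"
  shows "(\<Sum>\<alpha>\<in>F. (norm (defect T (cadj (opword T \<alpha>) h)))\<^sup>2) \<le> (norm h)\<^sup>2"
proof -
  obtain m where m: "\<And>\<alpha>. \<alpha> \<in> F \<Longrightarrow> length \<alpha> < m"
    using finite_nat_set_iff_bounded[of "length ` F"] F by auto
  have "finite {\<alpha> :: 'n list. length \<alpha> < m}"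
    by (rule finite_subset[OF _ finite_words_length_le[of m]]) auto
  then have "(\<Sum>\<alpha>\<in>F. (norm (defect T (cadj (opword T \<alpha>) h)))\<^sup>2)
      \<le> (\<Sum>\<alpha> | length \<alpha> < m. (norm (defect T (cadj (opword T \<alpha>) h)))\<^sup>2)"
    using m by (intro sum_mono2) auto
  also have "\<dots> \<le> (norm h)\<^sup>2" unfolding sum_defect_words by (simp add: sum_nonneg)
  finally show ?thesis .
qed

lemma sqsummable_poisson: "sqsummable (\<lambda>\<alpha>. defect T (cadj (opword T \<alpha>) h))"
  by (rule sqsummable_bound(1)) (rule sum_defect_words_le)

lemma l2_nth_poisson_kernel: "l2_nth (poisson_kernel T h) \<alpha> = defect T (cadj (opword T \<alpha>) h)"
proof -
  define x where "x = Abs_l2 (\<lambda>\<alpha>. defect T (cadj (opword T \<alpha>) h))"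
  have x: "l2_nth x = (\<lambda>\<alpha>. defect T (cadj (opword T \<alpha>) h))"
    unfolding x_def using sqsummable_poisson by (simp add: Abs_l2_inverse)
  have "poisson_kernel T h = x"
    using has_sum_ket_tens[of x] unfolding poisson_kernel_def x by (rule infsumI)
  then show ?thesis by (simp add: x)
qed

text \<open>The telescoped identity bounds the norm from above; purity makes its remainder vanish in
  the limit, which gives the reverse inequality.\<close>

lemma norm_poisson_kernel: "norm (poisson_kernel T h) = norm h"
proof -
  have "(norm (poisson_kernel T h))\<^sup>2 \<le> (norm h)\<^sup>2"
    by (rule norm_l2_sq_leI) (simp add: l2_nth_poisson_kernel sum_defect_words_le)
  moreover have "(norm h)\<^sup>2 \<le> (norm (poisson_kernel T h))\<^sup>2"
  proof (rule LIMSEQ_le_const2)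
    show "(\<lambda>m. (norm h)\<^sup>2 - (\<Sum>\<alpha> | length \<alpha> = m. (norm (cadj (opword T \<alpha>) h))\<^sup>2)) \<longlonglongrightarrow> (norm h)\<^sup>2"
      using tendsto_diff[OF tendsto_const sum_words_tendsto_0, of "(norm h)\<^sup>2"] by simp
    have "(norm h)\<^sup>2 - (\<Sum>\<alpha> | length \<alpha> = m. (norm (cadj (opword T \<alpha>) h))\<^sup>2) \<le> (norm (poisson_kernel T h))\<^sup>2" for m
      using l2_nth_sum_sq_le[OF finite_subset[OF _ finite_words_length_le[of m]], of "{\<alpha>. length \<alpha> < m}" "poisson_kernel T h"]
      by (simp add: l2_nth_poisson_kernel sum_defect_words[symmetric] subset_iff)
    then show "\<exists>N. \<forall>m\<ge>N. (norm h)\<^sup>2 - (\<Sum>\<alpha> | length \<alpha> = m. (norm (cadj (opword T \<alpha>) h))\<^sup>2) \<le> (norm (poisson_kernel T h))\<^sup>2"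
      by blast
  qed
  ultimately have "(norm (poisson_kernel T h))\<^sup>2 = (norm h)\<^sup>2" by simp
  then show ?thesis by simp
qed

lemma isometry_poisson_kernel: "isometry_on UNIV (poisson_kernel T)"
  unfolding isometry_on_def
proof (intro conjI ballI allI)
  fix x y :: 'h and c
  note b = bounded_clinear_cadj[OF bounded_clinear_opword[OF pure_row_contraction_bounded]]
  show "poisson_kernel T (x + y) = poisson_kernel T x + poisson_kernel T y"
    by (rule l2_eqI)
      (simp add: l2_nth_poisson_kernel plus_l2.rep_eq bounded_clinear_add[OF b] bounded_clinear_add[OF bounded_clinear_defect])
  show "poisson_kernel T (c *\<^sub>C x) = c *\<^sub>C poisson_kernel T x"
    by (rule l2_eqI)
      (simp add: l2_nth_poisson_kernel scaleC_l2.rep_eq bounded_clinear_scaleC[OF b] bounded_clinear_scaleC[OF bounded_clinear_defect])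
qed (rule norm_poisson_kernel)

lemma cadj_creation_poisson: "cadj (ampl (creation i)) (poisson_kernel T h) = poisson_kernel T (cadj (T i) h)"
  by (rule l2_eqI)
    (simp add: l2_nth_cadj_ampl_creation l2_nth_poisson_kernel cadj_opword_Cons[OF pure_row_contraction_bounded] del: opword.simps)

lemma cadj_cword_poisson: "cadj (cword \<alpha>) (poisson_kernel T h) = poisson_kernel T (cadj (opword T \<alpha>) h)"
  by (rule l2_eqI)
    (simp add: l2_nth_cadj_cword l2_nth_poisson_kernel cadj_opword_append[OF pure_row_contraction_bounded])

lemma opword_poisson: "opword T \<alpha> h = cadj (poisson_kernel T) (cword \<alpha> (poisson_kernel T h))"
proof (rule cinner_ext)
  fix k
  note K = isometry_UNIV_bounded_clinear[OF isometry_poisson_kernel]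
  have "cinner (cadj (poisson_kernel T) (cword \<alpha> (poisson_kernel T h))) k
      = cinner (poisson_kernel T h) (poisson_kernel T (cadj (opword T \<alpha>) k))"
    by (simp add: cinner_cadj_left[OF K] cinner_cadj[OF bounded_clinear_cword] cadj_cword_poisson)
  also have "\<dots> = cinner (opword T \<alpha> h) k"
    by (simp add: isometry_cinner[OF isometry_poisson_kernel]
        cinner_cadj[OF bounded_clinear_opword[OF pure_row_contraction_bounded]])
  finally show "cinner (opword T \<alpha> h) k = cinner (cadj (poisson_kernel T) (cword \<alpha> (poisson_kernel T h))) k" ..
qed

lemma fcalc_poisson: "f \<in> Finf \<Longrightarrow> fcalc f T h = cadj (poisson_kernel T) (ampl f (poisson_kernel T h))"
  by (rule fcalc_eq)
    (auto simp: opword_poisson bounded_clinear_cadj isometry_UNIV_bounded_clinear[OF isometry_poisson_kernel])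

end

section \<open>The constrained shift\<close>

lemma NJ_ortho: "NJ J = ortho {f \<phi> |f \<phi>. f \<in> J}"
  unfolding NJ_def by (rule ortho_ccspan)

lemma closed_csubspace_NJ: "closed_csubspace (NJ J)"
  unfolding NJ_def by (rule closed_csubspace_ortho)

lemma bounded_clinear_Bop: "bounded_clinear (Bop J i)"
  unfolding Bop_def
  by (intro bounded_clinear_compose bounded_clinear_proj closed_csubspace_NJ bounded_clinear_creation)

lemma bounded_clinear_Bword: "bounded_clinear (Bword J \<alpha>)"
  unfolding Bword_def
  by (intro bounded_clinear_compose bounded_clinear_opword bounded_clinear_Bop bounded_clinear_proj closed_csubspace_NJ)

lemma cadj_Bop: "cadj (Bop J i) = proj (NJ J) \<circ> cadj (creation i) \<circ> proj (NJ J)"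
  unfolding Bop_def
  by (simp only: cadj_compose bounded_clinear_compose bounded_clinear_proj[OF closed_csubspace_NJ]
      bounded_clinear_creation cadj_proj[OF closed_csubspace_NJ] o_assoc)

lemma Bop_in_NJ: "Bop J i x \<in> NJ J"
  by (simp add: Bop_def proj_in closed_csubspace_NJ)

lemma Bword_in_NJ: "Bword J \<alpha> x \<in> NJ J"
  by (cases \<alpha>) (simp_all add: Bword_def Bop_in_NJ proj_in closed_csubspace_NJ)

lemma Bword_Cons: "Bword J (i # \<alpha>) = Bop J i \<circ> Bword J \<alpha>"
  by (simp add: Bword_def o_assoc)

text \<open>The final projection in \<open>Bword\<close> makes the empty word the identity of N_J.
  It passes through \<open>Bop\<close>, whose range lies in N_J and which itself begins with this
  projection.\<close>

lemma Bword_snoc: "Bword J (\<alpha> @ [i]) = Bword J \<alpha> \<circ> Bop J i"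
proof
  fix x
  have "Bop J i (proj (NJ J) x) = proj (NJ J) (Bop J i x)"
    by (simp add: Bop_def proj_id proj_in closed_csubspace_NJ)
  then show "Bword J (\<alpha> @ [i]) x = (Bword J \<alpha> \<circ> Bop J i) x"
    by (simp add: Bword_def opword_append)
qed

text \<open>The tensor product of N_J with the whole coefficient space, described by slices so that
  the condition on N_J separates from the one on D.\<close>

definition NJ_slices :: "('n fock \<Rightarrow> 'n fock) set \<Rightarrow> ('n list, 'd :: chilbert_space) l2 set"
  where "NJ_slices J = {x. \<forall>u. slice u x \<in> NJ J}"

lemma ampl_proj_NJ_slices: "x \<in> NJ_slices J \<Longrightarrow> ampl (proj (NJ J)) x = x"
  by (simp add: NJ_slices_def ampl_proj_fixed closed_csubspace_NJ)

lemma ampl_in_NJ_slices: "bounded_clinear A \<Longrightarrow> range A \<subseteq> NJ J \<Longrightarrow> ampl A x \<in> NJ_slices J"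
  by (auto simp: NJ_slices_def slice_ampl)

lemma htens_NJ_iff:
  "closed_csubspace D \<Longrightarrow> x \<in> htens (NJ J) D \<longleftrightarrow> x \<in> NJ_slices J \<and> (\<forall>i. l2_nth x i \<in> D)"
  by (simp add: htens_iff closed_csubspace_NJ NJ_slices_def)

text \<open>Co-invariance puts the vector into the range of V, and the compression identity, tested
  against the range, identifies its preimage. Both abstract dilations and compressions to subspaces
  are handled by this.\<close>

lemma coinvariant_isometry_cadj:
  assumes X: "bounded_clinear X" and T: "bounded_clinear T" and V: "isometry_on UNIV V"
    and co: "cadj X (V h) \<in> range V" and i: "\<And>k. cinner (V h) (X (V k)) = cinner h (T k)"
  shows "cadj X (V h) = V (cadj T h)"
proof -
  obtain z where z: "cadj X (V h) = V z" using co by (rule rangeE)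
  have "z = cadj T h"
  proof (rule cinner_ext)
    fix k
    have "cinner z k = cinner (V z) (V k)" by (simp add: isometry_cinner[OF V])
    also have "\<dots> = cinner (cadj T h) k"
      unfolding z[symmetric] cinner_cadj_left[OF X] cinner_cadj_left[OF T] by (rule i)
    finally show "cinner z k = cinner (cadj T h) k" .
  qed
  then show ?thesis by (simp add: z)
qed

context
  fixes J :: "('n :: finite fock \<Rightarrow> 'n fock) set"
  assumes J: "wot_closed_ideal J"
begin

lemma ideal_Finf: "f \<in> J \<Longrightarrow> f \<in> Finf"
  using J by (auto simp: wot_closed_ideal_def)

text \<open>J is a left ideal, so left creation maps the range of each of its elements into the
  range of another; taking adjoints, N_J is invariant under the adjoints of the creation
  operators.\<close>

lemma cadj_creation_NJ:
  assumes "x \<in> NJ J" shows "cadj (creation i) x \<in> NJ J"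
  unfolding NJ_ortho ortho_def
proof (clarsimp)
  fix f \<phi> assume f: "f \<in> J"
  have "\<forall>g\<in>Finf. \<forall>f\<in>J. g \<circ> f \<in> J" using J by (simp add: wot_closed_ideal_def)
  from bspec[OF bspec[OF this Finf_creation] f] have "creation i \<circ> f \<in> J" .
  then have "cinner x ((creation i \<circ> f) \<phi>) = 0" using assms unfolding NJ_ortho ortho_def by blast
  then show "cinner (cadj (creation i) x) (f \<phi>) = 0"
    by (simp add: cinner_cadj_left[OF bounded_clinear_creation])
qed

lemma cadj_Bop_NJ: "x \<in> NJ J \<Longrightarrow> cadj (Bop J i) x = cadj (creation i) x"
  by (simp add: cadj_Bop proj_id closed_csubspace_NJ cadj_creation_NJ)

lemma proj_creation_proj: "proj (NJ J) (creation i (proj (NJ J) x)) = proj (NJ J) (creation i x)"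
proof (rule cinner_ext)
  fix z
  note P = closed_csubspace_NJ[of J]
  have "cinner (proj (NJ J) (creation i (proj (NJ J) x))) z = cinner x (proj (NJ J) (cadj (creation i) (proj (NJ J) z)))"
    by (simp add: cinner_proj[OF P] cinner_cadj[OF bounded_clinear_creation])
  also have "proj (NJ J) (cadj (creation i) (proj (NJ J) z)) = cadj (creation i) (proj (NJ J) z)"
    by (rule proj_id[OF P cadj_creation_NJ[OF proj_in[OF P]]])
  also have "cinner x \<dots> = cinner (proj (NJ J) (creation i x)) z"
    by (simp add: cinner_proj[OF P] cinner_cadj[OF bounded_clinear_creation])
  finally show "cinner (proj (NJ J) (creation i (proj (NJ J) x))) z = cinner (proj (NJ J) (creation i x)) z" .
qed

text \<open>Since P S_i P = P S_i for the projection P onto N_J, intermediate projections disappear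
  along a word.\<close>

lemma Bword_vacuum: "Bword J \<alpha> (ket []) = proj (NJ J) (ket \<alpha>)"
proof (induction \<alpha>)
  case Nil then show ?case by (simp add: Bword_def)
next
  case (Cons i \<alpha>)
  then show ?case
    by (simp add: Bword_Cons Bop_def proj_id[OF closed_csubspace_NJ proj_in[OF closed_csubspace_NJ]]
        proj_creation_proj creation_ket)
qed

lemma cadj_creation_NJ_slices: "x \<in> NJ_slices J \<Longrightarrow> cadj (ampl (creation i)) x \<in> NJ_slices J"
  by (simp add: NJ_slices_def cadj_ampl bounded_clinear_creation slice_ampl bounded_clinear_cadj cadj_creation_NJ)

lemma cadj_ampl_Bop_NJ_slices:
  "x \<in> NJ_slices J \<Longrightarrow> cadj (ampl (Bop J i)) x = cadj (ampl (creation i)) x"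
  by (rule slice_ext)
    (simp add: NJ_slices_def cadj_ampl bounded_clinear_creation bounded_clinear_Bop slice_ampl
      bounded_clinear_cadj cadj_Bop_NJ)

text \<open>Testing the annihilation against a simple tensor says that every slice of x is
  orthogonal to the ranges of the elements of J. The Poisson kernel and every constrained piece
  enter N_J \<otimes> D through this lemma.\<close>

lemma coinvariant_constrained_NJ_slices:
  fixes M :: "('n list, 'd :: chilbert_space) l2 set"
  assumes co: "coinvariant M (\<lambda>i. ampl (creation i))"
    and z: "\<And>f x y. f \<in> J \<Longrightarrow> x \<in> M \<Longrightarrow> y \<in> M \<Longrightarrow> cinner (ampl f x) y = 0"
  shows "M \<subseteq> NJ_slices J"
proof
  fix x assume x: "x \<in> M"
  have "cinner (slice u x) (f \<phi>) = 0" if f: "f \<in> J" for u f \<phi>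
  proof -
    have "cinner x (ampl f (\<phi> \<otimes>\<^sub>h u)) = 0"
      by (rule coinvariant_annihilated[OF ideal_Finf[OF f] co z[OF f] x])
    then show ?thesis by (simp add: ampl_tens[OF Finf_bounded[OF ideal_Finf[OF f]]] cinner_slice)
  qed
  then show "x \<in> NJ_slices J" unfolding NJ_slices_def NJ_ortho ortho_def by blast
qed

lemma poisson_kernel_NJ_slices:
  assumes T: "pure_row_contraction T" and c: "constrained_on UNIV J T"
  shows "poisson_kernel T h \<in> NJ_slices J"
proof -
  note K = isometry_UNIV_bounded_clinear[OF isometry_poisson_kernel[OF T]]
  have "range (poisson_kernel T) \<subseteq> NJ_slices J"
  proof (rule coinvariant_constrained_NJ_slices)
    show "coinvariant (range (poisson_kernel T)) (\<lambda>i. ampl (creation i))"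
      by (auto simp: coinvariant_def cadj_creation_poisson[OF T])
    fix f x y assume f: "f \<in> J" and "x \<in> range (poisson_kernel T)" "y \<in> range (poisson_kernel T)"
    then obtain h k where hk: "x = poisson_kernel T h" "y = poisson_kernel T k" by blast
    have "fcalc f T h = 0" using c f by (simp add: constrained_on_def)
    then have "cadj (poisson_kernel T) (ampl f x) = 0"
      unfolding hk fcalc_poisson[OF T ideal_Finf[OF f]] .
    then show "cinner (ampl f x) y = 0"
      unfolding hk(2) cinner_cadj_left[OF K, symmetric] by simp
  qed
  then show ?thesis by blast
qed

text \<open>For a constrained T the Poisson kernel already takes its values in the range of the
  projection, so projecting loses no norm.\<close>

lemma constrained_kernel_eq:
  assumes "pure_row_contraction T" "constrained_on UNIV J T"
  shows "constrained_kernel J T = poisson_kernel T"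
  by (simp add: fun_eq_iff constrained_kernel_def ampl_proj_NJ_slices poisson_kernel_NJ_slices[OF assms])

text \<open>On N_J \<otimes> D the adjoints of the constrained shift and of the creation operators
  agree, so intertwining with the free shift is enough.\<close>

lemma dilationI:
  assumes T: "\<And>i. bounded_clinear (T i)" and D: "closed_csubspace D" and V: "isometry_on UNIV V"
    and r: "\<And>h. V h \<in> htens (NJ J) D"
    and i: "\<And>i h. cadj (ampl (creation i)) (V h) = V (cadj (T i) h)"
  shows "dilation J T D V"
proof -
  note bV = isometry_UNIV_bounded_clinear[OF V]
  have B: "cadj (ampl (Bop J i)) (V h) = V (cadj (T i) h)" for i h
    using r[of h] by (simp add: cadj_ampl_Bop_NJ_slices htens_NJ_iff[OF D] i)
  have "T i h = cadj V (ampl (Bop J i) (V h))" for i h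
    by (rule cinner_ext)
      (simp add: cinner_cadj_left[OF bV] cinner_cadj[OF bounded_clinear_ampl[OF bounded_clinear_Bop]] B
        isometry_cinner[OF V] cinner_cadj[OF T])
  then show ?thesis
    unfolding dilation_def using V r by (auto simp: coinvariant_def B)
qed

lemma dilation_poisson_kernel:
  assumes T: "pure_row_contraction T" "constrained_on UNIV J T"
  shows "dilation J T (defect_space T) (poisson_kernel T)"
proof (rule dilationI)
  note D = closed_csubspace_defect_space[OF pure_row_contraction_row[OF T(1)]]
  show "poisson_kernel T h \<in> htens (NJ J) (defect_space T)" for h
    by (simp add: htens_NJ_iff[OF D] poisson_kernel_NJ_slices[OF T] l2_nth_poisson_kernel[OF T(1)] defect_in_defect_space)
qed (auto simp: pure_row_contraction_bounded[OF T(1)] closed_csubspace_defect_space[OF pure_row_contraction_row[OF T(1)]]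
    isometry_poisson_kernel[OF T(1)] cadj_creation_poisson[OF T(1)])

context
  fixes T :: "'n \<Rightarrow> 'h :: chilbert_space \<Rightarrow> 'h" and D :: "'d :: chilbert_space set" and V :: "'h \<Rightarrow> ('n list, 'd) l2"
  assumes bT: "\<And>i. bounded_clinear (T i)" and D: "closed_csubspace D" and dil: "dilation J T D V"
begin

lemma dilation_isometry: "isometry_on UNIV V"
  using dil by (simp add: dilation_def)

lemma dilation_range: "V h \<in> htens (NJ J) D"
  using dil by (auto simp: dilation_def)

lemma dilation_NJ_slices: "V h \<in> NJ_slices J"
  using dilation_range by (simp add: htens_NJ_iff[OF D])

lemma cadj_Bop_dilation: "cadj (ampl (Bop J i)) (V h) = V (cadj (T i) h)"
proof (rule coinvariant_isometry_cadj[OF bounded_clinear_ampl[OF bounded_clinear_Bop] bT dilation_isometry])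
  show "cadj (ampl (Bop J i)) (V h) \<in> range V" using dil by (auto simp: dilation_def coinvariant_def)
  fix k
  have "T i k = cadj V (ampl (Bop J i) (V k))" using dil by (simp add: dilation_def)
  then show "cinner (V h) (ampl (Bop J i) (V k)) = cinner h (T i k)"
    by (simp add: cinner_cadj[OF isometry_UNIV_bounded_clinear[OF dilation_isometry]])
qed

lemma cadj_creation_dilation: "cadj (ampl (creation i)) (V h) = V (cadj (T i) h)"
  using cadj_Bop_dilation by (simp add: cadj_ampl_Bop_NJ_slices[OF dilation_NJ_slices])

text \<open>The right side involves only T and V, so inner products of such vectors are the same for
  all dilations of T.\<close>

lemma cadj_Bword_dilation: "cadj (ampl (Bword J \<alpha>)) (V h) = V (cadj (opword T \<alpha>) h)"
proof (induction \<alpha> arbitrary: h)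
  case Nil
  have "cadj (ampl (Bword J [])) (V h) = ampl (proj (NJ J)) (V h)"
    by (simp add: cadj_ampl[OF bounded_clinear_Bword])
      (simp add: Bword_def cadj_proj[OF closed_csubspace_NJ])
  then show ?case by (simp add: ampl_proj_NJ_slices[OF dilation_NJ_slices] cadj_id)
next
  case (Cons i \<alpha>)
  note b = bounded_clinear_Bop[of J i] bounded_clinear_Bword[of J \<alpha>]
  have "cadj (ampl (Bword J (i # \<alpha>))) (V h) = ampl (cadj (Bword J \<alpha>)) (ampl (cadj (Bop J i)) (V h))"
    unfolding cadj_ampl[OF bounded_clinear_Bword] unfolding Bword_Cons cadj_compose[OF b]
    by (rule ampl_compose) (intro bounded_clinear_cadj b)+
  also have "\<dots> = V (cadj (opword T \<alpha>) (cadj (T i) h))"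
    using Cons.IH cadj_Bop_dilation[of i h] by (simp add: cadj_ampl b)
  finally show ?case by (simp add: cadj_opword_Cons[OF bT] del: opword.simps)
qed

end

end

section \<open>Defect spaces and the vacuum component\<close>

text \<open>The projection onto the vacuum is I - \<Sum> S_i S_i^* : a word is either empty or has a
  unique first letter.\<close>

lemma vacuum_decomposition:
  fixes x :: "('n :: finite list, 'd :: chilbert_space) l2"
  shows "x = ket [] \<otimes>\<^sub>h l2_nth x [] + (\<Sum>i\<in>UNIV. ampl (creation i) (cadj (ampl (creation i)) x))"
proof (rule l2_eqI)
  fix \<gamma> :: "'n list"
  have c: "l2_nth (ampl (creation i) y) \<gamma> = (if take 1 \<gamma> = [i] then l2_nth y (drop 1 \<gamma>) else 0)"
    for i \<gamma> and y :: "('n list, 'd) l2"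
    using l2_nth_cword[of "[i]" y \<gamma>] by (simp add: cword_def)
  show "l2_nth x \<gamma> = l2_nth (ket [] \<otimes>\<^sub>h l2_nth x []
      + (\<Sum>i\<in>UNIV. ampl (creation i) (cadj (ampl (creation i)) x))) \<gamma>"
    by (cases \<gamma>) (simp_all add: plus_l2.rep_eq l2_nth_sum l2_nth_ket_tens c l2_nth_cadj_ampl_creation)
qed

lemma norm_sq_vacuum:
  fixes x :: "('n :: finite list, 'd :: chilbert_space) l2"
  shows "(norm (l2_nth x []))\<^sup>2 = (norm x)\<^sup>2 - (\<Sum>i\<in>UNIV. (norm (cadj (ampl (creation i)) x))\<^sup>2)"
proof -
  note b = bounded_clinear_ampl[OF bounded_clinear_creation]
  have "(norm x)\<^sup>2 = Re (cinner x (ket [] \<otimes>\<^sub>h l2_nth x []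
      + (\<Sum>i\<in>UNIV. ampl (creation i) (cadj (ampl (creation i)) x))))"
    using vacuum_decomposition[of x] by (simp add: norm_sq_cinner)
  also have "\<dots> = (norm (l2_nth x []))\<^sup>2 + (\<Sum>i\<in>UNIV. (norm (cadj (ampl (creation i)) x))\<^sup>2)"
    by (simp add: cinner.add_right cinner.sum_right cinner_ket_tens cinner_cadj_left[OF b, symmetric] norm_sq_cinner)
  finally show ?thesis by simp
qed

lemma norm_defect_vacuum:
  assumes T: "row_contraction T" and V: "isometry_on UNIV V"
    and i: "\<And>i. cadj (ampl (creation i)) (V h) = V (cadj (T i) h)"
  shows "norm (defect T h) = norm (l2_nth (V h) [])"
proof -
  have "norm (V x) = norm x" for x using V by (simp add: isometry_on_def)
  then have "(norm (defect T h))\<^sup>2 = (norm (l2_nth (V h) []))\<^sup>2"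
    by (simp add: norm_sq_defect[OF T] norm_sq_vacuum i)
  then show ?thesis by simp
qed

text \<open>Coordinates of V h lie in D, in particular the vacuum coordinate, whose norm equals that
  of the defect vector of h. The resulting isometry of the defect space into D is the lower bound
  for the dilation index.\<close>

lemma hdim_defect_space_le:
  assumes J: "wot_closed_ideal J" and T: "row_contraction T" and D: "closed_csubspace D"
    and dil: "dilation J T D V"
  shows "(hdim (defect_space T), hdim D) \<in> ordLeq"
proof -
  have bT: "bounded_clinear (T i)" for i using T by (simp add: row_contraction_def)
  note V = dilation_isometry[OF J bT D dil]
  have "bounded_clinear (\<lambda>h. l2_nth (V h) [])"
    by (rule bounded_clinear_compose2[OF bounded_clinear_l2_nth isometry_UNIV_bounded_clinear[OF V]])
  moreover have "norm (defect T h) = norm (l2_nth (V h) [])" for h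
    by (rule norm_defect_vacuum[OF T V cadj_creation_dilation[OF J bT D dil]])
  ultimately obtain W where W: "unitary_between (closure (range (defect T))) (closure (range (\<lambda>h. l2_nth (V h) []))) W"
    using equal_norm_unitary[OF pos_op_bounded[OF pos_op_defect[OF T]], of "\<lambda>h. l2_nth (V h) []"] by blast
  have "closure (range (\<lambda>h. l2_nth (V h) [])) \<subseteq> D"
    using dilation_range[OF J bT D dil]
    by (intro closure_minimal closed_csubspaceD(4)[OF D]) (auto simp: htens_NJ_iff[OF D])
  then have "isometry_on (defect_space T) W" "W ` defect_space T \<subseteq> D"
    using W unfolding unitary_between_def defect_space_def by auto
  then show ?thesis by (rule hdim_isometry_le[OF closed_csubspace_defect_space[OF T] D])
qed

section \<open>Minimality\<close>

lemma ket_total: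
  assumes M: "closed_csubspace M" and k: "\<And>i. ket i \<in> M" shows "x \<in> M"
proof (rule has_sum_in_closed_csubspace[OF M has_sum_ket_tens])
  show "ket i \<otimes>\<^sub>h l2_nth x i \<in> M" for i
    unfolding ket_tens_complex by (rule closed_csubspaceD(3)[OF M k])
qed

lemma ampl_Bword_in_htens:
  assumes "closed_csubspace D" "x \<in> htens (NJ J) D"
  shows "ampl (Bword J \<alpha>) x \<in> htens (NJ J) D"
  using assms
  by (auto simp: htens_NJ_iff Bword_in_NJ intro!: ampl_in_NJ_slices bounded_clinear_Bword ampl_coeff_in)

text \<open>The span must contain enough simple tensors. Because the vacuum belongs to N_J,
  projecting the vacuum decomposition of K h expresses the tensor of the vacuum with a defect vector
  through B-words applied to the range of K; further words move the vacuum to the projections of all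
  basis vectors.\<close>

lemma minimal_poisson_kernel:
  assumes J: "wot_closed_ideal J" and T: "pure_row_contraction T" "constrained_on UNIV J T"
    and vac: "ket [] \<in> NJ J"
  shows "minimal_for J (defect_space T) (poisson_kernel T)"
proof -
  let ?K = "poisson_kernel T" and ?D = "defect_space T" and ?P = "proj (NJ J)"
  define Y where "Y = ccspan (\<Union>\<alpha>. ampl (Bword J \<alpha>) ` range ?K)"
  have Y: "closed_csubspace Y" unfolding Y_def by (rule closed_csubspace_ccspan)
  have D: "closed_csubspace ?D" by (rule closed_csubspace_defect_space[OF pure_row_contraction_row[OF T(1)]])
  note N = closed_csubspace_NJ[of J]
  note P = bounded_clinear_proj[OF N]
  have gen: "ampl (Bword J \<alpha>) (?K h) \<in> Y" for \<alpha> h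
    unfolding Y_def by (rule subsetD[OF ccspan_superset]) blast
  have K: "?K h \<in> htens (NJ J) ?D" for h
    using dilation_poisson_kernel[OF J T] by (auto simp: dilation_def)
  have "Y \<subseteq> htens (NJ J) ?D"
    unfolding Y_def using ampl_Bword_in_htens[OF D K]
    by (intro ccspan_minimal closed_csubspace_htens) blast
  moreover have "htens (NJ J) ?D \<subseteq> Y"
  proof -
    have 1: "?P (ket \<alpha>) \<otimes>\<^sub>h defect T h \<in> Y" for \<alpha> h
    proof -
      have PK: "ampl ?P (?K k) = ?K k" for k
        by (rule ampl_proj_NJ_slices[OF poisson_kernel_NJ_slices[OF J T]])
      have Bi: "ampl ?P (ampl (creation i) (?K k)) = ampl (Bop J i) (?K k)" for i k
      proof -
        have "ampl (Bop J i) (?K k) = ampl (?P \<circ> creation i) (ampl ?P (?K k))"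
          unfolding Bop_def by (rule ampl_compose) (intro bounded_clinear_compose P bounded_clinear_creation)+
        also have "\<dots> = ampl ?P (ampl (creation i) (?K k))"
          unfolding PK by (rule ampl_compose[OF P bounded_clinear_creation])
        finally show ?thesis ..
      qed
      have d: "l2_nth (?K h) [] = defect T h" by (simp add: l2_nth_poisson_kernel[OF T(1)] cadj_id)
      have "ampl ?P (?K h) = ampl ?P (ket [] \<otimes>\<^sub>h defect T h
          + (\<Sum>i\<in>UNIV. ampl (creation i) (?K (cadj (T i) h))))"
        using vacuum_decomposition[of "?K h"] by (simp add: d cadj_creation_poisson[OF T(1)])
      \<comment> \<open>The projection fixes the vacuum term by the assumption on N_J, fixes
        \<open>?K h\<close>, and turns each creation operator on the range of K into the
        corresponding \<open>Bop J i\<close>.\<close>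
      then have K_eq: "?K h = ket [] \<otimes>\<^sub>h defect T h + (\<Sum>i\<in>UNIV. ampl (Bop J i) (?K (cadj (T i) h)))"
        by (simp add: PK Bi bounded_clinear_add[OF bounded_clinear_ampl[OF P]]
            bounded_clinear_sum[OF bounded_clinear_ampl[OF P]] ampl_tens[OF P] proj_id[OF N vac])
      note bB = bounded_clinear_ampl[OF bounded_clinear_Bword]
      have "ampl (Bword J \<alpha>) (?K h) = ampl (Bword J \<alpha>) (ket [] \<otimes>\<^sub>h defect T h)
          + (\<Sum>i\<in>UNIV. ampl (Bword J (\<alpha> @ [i])) (?K (cadj (T i) h)))"
        using arg_cong[OF K_eq, of "ampl (Bword J \<alpha>)"]
        by (simp add: bounded_clinear_add[OF bB] bounded_clinear_sum[OF bB] Bword_snoc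
            ampl_compose[OF bounded_clinear_Bword bounded_clinear_Bop])
      then have "?P (ket \<alpha>) \<otimes>\<^sub>h defect T h
          = ampl (Bword J \<alpha>) (?K h) - (\<Sum>i\<in>UNIV. ampl (Bword J (\<alpha> @ [i])) (?K (cadj (T i) h)))"
        by (simp add: ampl_tens[OF bounded_clinear_Bword] Bword_vacuum[OF J])
      also have "\<dots> \<in> Y" by (intro closed_csubspaceD(7)[OF Y] closed_csubspace_sum[OF Y] gen)
      finally show ?thesis .
    qed
    \<comment> \<open>Continuity in the second factor passes from the range of the defect operator
      to its closure.\<close>
    have 2: "?P (ket \<alpha>) \<otimes>\<^sub>h d \<in> Y" if "d \<in> ?D" for \<alpha> d
    proof -
      have "?D \<subseteq> {d. ?P (ket \<alpha>) \<otimes>\<^sub>h d \<in> Y}"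
        unfolding defect_space_def
        by (rule closure_minimal[OF _ closed_csubspaceD(4)[OF closed_csubspace_vimage[OF bounded_clinear_tens_right Y]]])
          (use 1 in auto)
      then show ?thesis using that by blast
    qed
    have "x \<otimes>\<^sub>h d \<in> Y" if "x \<in> NJ J" "d \<in> ?D" for x d
    proof -
      have "x \<in> {x. ?P x \<otimes>\<^sub>h d \<in> Y}"
        by (rule ket_total[OF closed_csubspace_vimage[OF bounded_clinear_compose2[OF bounded_clinear_tens_left P] Y]])
          (use 2 that in auto)
      then show ?thesis using that by (simp add: proj_id[OF N])
    qed
    then show ?thesis unfolding htens_def by (intro ccspan_minimal[OF Y]) auto
  qed
  ultimately show ?thesis unfolding minimal_for_def Y_def by blast
qed

section \<open>Uniqueness of the minimal dilation\<close>

lemma ampl_diff: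
  "bounded_clinear A \<Longrightarrow> bounded_clinear B \<Longrightarrow> ampl (\<lambda>x. A x - B x) y = ampl A y - ampl B y"
  by (rule ampl_eqI) (simp_all add: bounded_clinear_minus slice_ampl bounded_clinear_diff[OF bounded_clinear_slice])

lemma ampl_lincomb:
  assumes "\<And>A. A \<in> F \<Longrightarrow> bounded_clinear A"
  shows "ampl (\<lambda>x. \<Sum>A\<in>F. c A *\<^sub>C A x) y = (\<Sum>A\<in>F. c A *\<^sub>C ampl A y)"
  by (rule ampl_eqI)
    (use assms in \<open>auto intro!: bounded_clinear_setsum bounded_clinear_scale sum.cong
      simp: slice_ampl bounded_clinear_sum[OF bounded_clinear_slice] bounded_clinear_scaleC[OF bounded_clinear_slice]\<close>)

context
  fixes J :: "('n :: finite fock \<Rightarrow> 'n fock) set" and T :: "'n \<Rightarrow> 'h :: chilbert_space \<Rightarrow> 'h"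
    and D :: "'d :: chilbert_space set" and D' :: "'e :: chilbert_space set"
    and V :: "'h \<Rightarrow> ('n list, 'd) l2" and V' :: "'h \<Rightarrow> ('n list, 'e) l2"
  assumes J: "wot_closed_ideal J" and bT: "\<And>i. bounded_clinear (T i)"
    and D: "closed_csubspace D" and dil: "dilation J T D V"
    and D': "closed_csubspace D'" and dil': "dilation J T D' V'"
begin

text \<open>On the products generating \<open>span_BB J\<close> the compressed form is <T_\<beta>^*
  h, T_\<alpha>^* k> for either dilation. Linearity and the bound of an amplification by the norm of
  its first factor carry the equality to norm limits.\<close>

lemma span_BB_gram:
  assumes X: "X \<in> span_BB J"
  shows "cinner (ampl X (V h)) (V k) = cinner (ampl X (V' h)) (V' k)"
proof -
  let ?Q = "\<lambda>X. cinner (ampl X (V h)) (V k) - cinner (ampl X (V' h)) (V' k)"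
  note iso = dilation_isometry[OF J bT D dil] and iso' = dilation_isometry[OF J bT D' dil']
  have gen: "bounded_clinear A \<and> ?Q A = 0"
    if "A \<in> {Bword J \<alpha> \<circ> cadj (Bword J \<beta>) |\<alpha> \<beta>. True}" for A
  proof -
    from that obtain \<alpha> \<beta> where A: "A = Bword J \<alpha> \<circ> cadj (Bword J \<beta>)" by auto
    note b = bounded_clinear_Bword[of J \<alpha>] bounded_clinear_cadj[OF bounded_clinear_Bword[of J \<beta>]]
    have "cinner (ampl A (V h)) (V k) = cinner (cadj (opword T \<beta>) h) (cadj (opword T \<alpha>) k)"
      unfolding A ampl_compose[OF b] cinner_cadj[OF bounded_clinear_ampl[OF b(1)]]
      by (simp add: cadj_ampl[OF bounded_clinear_Bword, symmetric] cadj_Bword_dilation[OF J bT D dil] isometry_cinner[OF iso])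
    moreover have "cinner (ampl A (V' h)) (V' k) = cinner (cadj (opword T \<beta>) h) (cadj (opword T \<alpha>) k)"
      unfolding A ampl_compose[OF b] cinner_cadj[OF bounded_clinear_ampl[OF b(1)]]
      by (simp add: cadj_ampl[OF bounded_clinear_Bword, symmetric] cadj_Bword_dilation[OF J bT D' dil'] isometry_cinner[OF iso'])
    ultimately show ?thesis using bounded_clinear_compose[OF b] by (simp add: A)
  qed
  have span: "bounded_clinear A \<and> ?Q A = 0"
    if A: "A \<in> op_cspan {Bword J \<alpha> \<circ> cadj (Bword J \<beta>) |\<alpha> \<beta>. True}" for A
  proof -
    obtain F c where F: "A = (\<lambda>x. \<Sum>A\<in>F. c A *\<^sub>C A x)" "F \<subseteq> {Bword J \<alpha> \<circ> cadj (Bword J \<beta>) |\<alpha> \<beta>. True}"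
      using A unfolding op_cspan_def mem_Collect_eq by (elim exE conjE) (rule that)
    have g: "bounded_clinear B" "cinner (ampl B (V h)) (V k) = cinner (ampl B (V' h)) (V' k)" if "B \<in> F" for B
      using gen[of B] subsetD[OF F(2) that] by auto
    have "ampl A (V h) = (\<Sum>A\<in>F. c A *\<^sub>C ampl A (V h))" "ampl A (V' h) = (\<Sum>A\<in>F. c A *\<^sub>C ampl A (V' h))"
      unfolding F(1) by (rule ampl_lincomb, erule g(1))+
    then have "cinner (ampl A (V h)) (V k) = cinner (ampl A (V' h)) (V' k)"
      using g(2) by (simp add: cinner.sum_left cinner_scaleC_left)
    moreover have "bounded_clinear A"
      unfolding F(1) by (intro bounded_clinear_setsum bounded_clinear_scale g(1))
    ultimately show ?thesis by simp
  qed
  have bX: "bounded_clinear X" using X by (simp add: span_BB_def op_norm_closure_def)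
  have "cmod (?Q X) \<le> e" if e: "e > 0" for e
  proof -
    \<comment> \<open>Each of the two dilations contributes an error of at most the operator
      distance times |h| |k|; the summand 1 keeps C positive.\<close>
    define C where "C = 2 * (norm h * norm k) + 1"
    have "0 \<le> norm h * norm k" by simp
    then have C: "C > 0" unfolding C_def by linarith
    then obtain A where A: "A \<in> op_cspan {Bword J \<alpha> \<circ> cadj (Bword J \<beta>) |\<alpha> \<beta>. True}"
        "onorm (\<lambda>x. X x - A x) < e / C"
      using X divide_pos_pos[OF e C] unfolding span_BB_def op_norm_closure_def by blast
    have bA: "bounded_clinear A" and QA: "?Q A = 0" using span[OF A(1)] by auto
    let ?Z = "\<lambda>x. X x - A x"
    note bZ = bounded_clinear_minus[OF bX bA]
    have nZ: "onorm ?Z \<ge> 0" by (rule onorm_pos_le[OF bounded_clinear_bounded_linear[OF bZ]])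
    have n: "norm (V x) = norm x" "norm (V' x) = norm x" for x using iso iso' by (auto simp: isometry_on_def)
    have "cmod (cinner (ampl ?Z (V h)) (V k)) \<le> norm (ampl ?Z (V h)) * norm (V k)" by (rule cmod_cinner_le)
    also have "\<dots> \<le> (onorm ?Z * norm (V h)) * norm (V k)" by (intro mult_right_mono norm_ampl_le[OF bZ]) auto
    finally have 1: "cmod (cinner (ampl ?Z (V h)) (V k)) \<le> onorm ?Z * (norm h * norm k)" by (simp add: n mult_ac)
    have "cmod (cinner (ampl ?Z (V' h)) (V' k)) \<le> norm (ampl ?Z (V' h)) * norm (V' k)" by (rule cmod_cinner_le)
    also have "\<dots> \<le> (onorm ?Z * norm (V' h)) * norm (V' k)" by (intro mult_right_mono norm_ampl_le[OF bZ]) auto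
    finally have 2: "cmod (cinner (ampl ?Z (V' h)) (V' k)) \<le> onorm ?Z * (norm h * norm k)" by (simp add: n mult_ac)
    have Q_eq: "?Q X = cinner (ampl ?Z (V h)) (V k) - cinner (ampl ?Z (V' h)) (V' k)"
      using QA by (simp add: ampl_diff[OF bX bA] cinner.diff_left)
    have "cmod (?Q X) \<le> onorm ?Z * (norm h * norm k) + onorm ?Z * (norm h * norm k)"
      unfolding Q_eq
      using norm_triangle_ineq4[of "cinner (ampl ?Z (V h)) (V k)" "cinner (ampl ?Z (V' h)) (V' k)"] 1 2 by linarith
    also have "\<dots> \<le> onorm ?Z * C" using nZ by (simp add: C_def algebra_simps)
    also have "\<dots> \<le> e" using A(2) C by (simp add: pos_less_divide_eq less_imp_le)
    finally show ?thesis .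
  qed
  then have "cmod (?Q X) \<le> 0" by (rule field_le_epsilon[where y = 0, simplified])
  then show ?thesis by simp
qed

text \<open>The Gram matrix involves products with the adjoint on the left, opposite to the order in
  which dilations agree automatically. These products still lie in the C*-algebra, and the density
  hypothesis rewrites them as norm limits of products in the good order.\<close>

lemma minimal_dilation_unique:
  assumes gs: "span_BB J = cstar_B J" and m: "minimal_for J D V" and m': "minimal_for J D' V'"
  shows "\<exists>U. unitary_between (htens (NJ J) D) (htens (NJ J) D') U \<and>
    (\<forall>i. \<forall>x\<in>htens (NJ J) D. U (ampl (Bop J i) x) = ampl (Bop J i) (U x)) \<and> (\<forall>h. U (V h) = V' h)"
proof -
  define g where "g = (\<lambda>(\<alpha>, h). ampl (Bword J \<alpha>) (V h))"
  define c where "c = (\<lambda>(\<alpha>, h). ampl (Bword J \<alpha>) (V' h))"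
  have "\<forall>p\<in>UNIV. \<forall>q\<in>UNIV. cinner (g p) (g q) = cinner (c p) (c q)"
  proof (clarify)
    fix \<alpha> \<beta> :: "'n list" and h k
    let ?X = "cadj (Bword J \<beta>) \<circ> Bword J \<alpha>"
    have "?X \<in> cstar_B J"
      unfolding cstar_B_def cstar_generated_def
    proof (rule InterI)
      fix \<A> assume "\<A> \<in> {\<A>. op_algebra \<A> \<and> (\<forall>A\<in>\<A>. cadj A \<in> \<A>) \<and> op_norm_closure \<A> \<subseteq> \<A>
          \<and> insert (proj (NJ J)) (range (Bop J)) \<subseteq> \<A>}"
      then have alg: "op_algebra \<A>" and adj: "\<And>A. A \<in> \<A> \<Longrightarrow> cadj A \<in> \<A>"
        and gens: "proj (NJ J) \<in> \<A>" "\<And>i. Bop J i \<in> \<A>" by auto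
      have comp: "A \<circ> B \<in> \<A>" if "A \<in> \<A>" "B \<in> \<A>" for A B using alg that by (simp add: op_algebra_def)
      have "Bword J \<gamma> \<in> \<A>" for \<gamma>
      proof (induction \<gamma>)
        case Nil then show ?case using gens(1) by (simp add: Bword_def)
      next
        case (Cons i \<gamma>) then show ?case unfolding Bword_Cons by (intro comp gens)
      qed
      then show "?X \<in> \<A>" by (intro comp adj)
    qed
    then have "cinner (ampl ?X (V h)) (V k) = cinner (ampl ?X (V' h)) (V' k)"
      using gs by (intro span_BB_gram) simp
    then show "cinner (g (\<alpha>, h)) (g (\<beta>, k)) = cinner (c (\<alpha>, h)) (c (\<beta>, k))"
      unfolding g_def c_def
      by (simp add: ampl_compose[OF bounded_clinear_cadj[OF bounded_clinear_Bword] bounded_clinear_Bword]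
          cadj_ampl[OF bounded_clinear_Bword, symmetric] cinner_cadj_left[OF bounded_clinear_ampl[OF bounded_clinear_Bword]])
  qed
  from gram_unitary[OF this] obtain W where W: "bounded_clinear W"
    "unitary_between (ccspan (range g)) (ccspan (range c)) W" "\<And>p. W (g p) = c p" by blast
  have "range g = (\<Union>\<alpha>. ampl (Bword J \<alpha>) ` range V)" "range c = (\<Union>\<alpha>. ampl (Bword J \<alpha>) ` range V')"
    unfolding g_def c_def by force+
  then have rg: "ccspan (range g) = htens (NJ J) D" and rc: "ccspan (range c) = htens (NJ J) D'"
    using m m' by (simp_all add: minimal_for_def)
  note bB = bounded_clinear_ampl[OF bounded_clinear_Bop]
  have "W (ampl (Bop J i) x) = ampl (Bop J i) (W x)" if "x \<in> htens (NJ J) D" for i x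
  proof (rule ccspan_eq_on[OF bounded_clinear_compose2[OF W(1) bB] bounded_clinear_compose2[OF bB W(1)]])
    show "x \<in> ccspan (range g)" using that rg by simp
    fix y assume "y \<in> range g"
    then obtain \<alpha> h where y: "y = g (\<alpha>, h)" by auto
    have "ampl (Bop J i) (g (\<alpha>, h)) = g (i # \<alpha>, h)" "ampl (Bop J i) (c (\<alpha>, h)) = c (i # \<alpha>, h)"
      by (simp_all add: g_def c_def Bword_Cons ampl_compose bounded_clinear_Bop bounded_clinear_Bword)
    then show "W (ampl (Bop J i) y) = ampl (Bop J i) (W y)" by (simp add: y W(3))
  qed
  moreover have "W (V h) = V' h" for h
  proof -
    \<comment> \<open>The empty word acts as the projection onto N_J, which fixes the range of a
      dilation, so V and V' are part of the two families.\<close>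
    have "g ([], h) = V h" "c ([], h) = V' h"
      unfolding g_def c_def
      by (simp_all add: Bword_def ampl_proj_NJ_slices dilation_NJ_slices[OF J bT D dil] dilation_NJ_slices[OF J bT D' dil'])
    then show ?thesis using W(3)[of "([], h)"] by simp
  qed
  ultimately show ?thesis using W(2) unfolding rg rc by blast
qed

end

section \<open>The maximal constrained piece\<close>

text \<open>Co-invariance of M means P X_i P = P X_i for the projection P onto M, so compression is
  multiplicative along words.\<close>

lemma opword_compress:
  assumes M: "closed_csubspace M" and X: "\<And>i. bounded_clinear (X i)" and co: "coinvariant M X" and x: "x \<in> M"
  shows "opword (compress M X) \<alpha> x = proj M (opword X \<alpha> x)"
proof (induction \<alpha>)
  case Nil then show ?case by (simp add: proj_id[OF M x])
next
  case (Cons i \<alpha>)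
  have "proj M (X i (proj M y)) = proj M (X i y)" for y
  proof (rule cinner_ext)
    fix z
    have m: "cadj (X i) (proj M z) \<in> M" using co proj_in[OF M] by (simp add: coinvariant_def)
    have "cinner (proj M (X i (proj M y))) z = cinner (proj M y) (cadj (X i) (proj M z))"
      by (simp add: cinner_proj[OF M] cinner_cadj[OF X])
    also have "\<dots> = cinner (proj M (X i y)) z"
      by (simp add: cinner_proj[OF M] cinner_cadj[OF X] proj_id[OF M m])
    finally show "cinner (proj M (X i (proj M y))) z = cinner (proj M (X i y)) z" .
  qed
  then show ?case using Cons.IH by (simp add: compress_def)
qed

lemma fcalc_compress:
  fixes M :: "('n :: finite list, 'd :: chilbert_space) l2 set"
  assumes f: "f \<in> Finf" and M: "closed_csubspace M" and co: "coinvariant M (\<lambda>i. ampl (creation i))" and x: "x \<in> M"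
  shows "fcalc f (compress M (\<lambda>i. ampl (creation i))) x = proj M (ampl f x)"
  by (rule fcalc_eq[OF f bounded_clinear_proj[OF M]])
    (simp add: opword_compress[OF M bounded_clinear_ampl[OF bounded_clinear_creation] co x] cword_def)

text \<open>Every admissible subspace has its slices in N_J and its coordinates in D, which bounds
  the span from above. Equality holds because N_J \<otimes> D is itself admissible.\<close>

lemma max_piece_space_eq:
  assumes J: "wot_closed_ideal J" and D: "closed_csubspace D"
  shows "max_piece_space (htens UNIV D) J (\<lambda>i. ampl (creation i)) = htens (NJ J) D"
proof
  let ?S = "\<lambda>i. ampl (creation i)" and ?M = "htens (NJ J) D"
  note N = closed_csubspace_NJ[of J]
  have E: "x \<in> htens UNIV D \<longleftrightarrow> (\<forall>i. l2_nth x i \<in> D)" for x :: "('a list, 'b) l2"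
    by (simp add: htens_iff[OF closed_csubspace_UNIV D])
  show "max_piece_space (htens UNIV D) J ?S \<subseteq> ?M"
    unfolding max_piece_space_def
  proof (rule ccspan_minimal[OF closed_csubspace_htens], rule Union_least)
    fix M assume "M \<in> {M. closed_csubspace M \<and> M \<subseteq> htens UNIV D \<and> coinvariant M ?S \<and> constrained_on M J (compress M ?S)}"
    then have M: "closed_csubspace M" "M \<subseteq> htens UNIV D" "coinvariant M ?S" "constrained_on M J (compress M ?S)" by auto
    have "M \<subseteq> NJ_slices J"
    proof (rule coinvariant_constrained_NJ_slices[OF J M(3)])
      fix f x y assume f: "f \<in> J" and xy: "x \<in> M" "y \<in> M"
      have "proj M (ampl f x) = 0"
        using M(4) f xy(1) fcalc_compress[OF ideal_Finf[OF J f] M(1,3) xy(1)] by (simp add: constrained_on_def)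
      then have "cinner (ampl f x) (proj M y) = 0" by (simp add: cinner_proj[OF M(1), symmetric])
      then show "cinner (ampl f x) y = 0" by (simp add: proj_id[OF M(1) xy(2)])
    qed
    then show "M \<subseteq> ?M" using M(2) by (auto simp: htens_NJ_iff[OF D] E subset_iff)
  qed
  have co: "coinvariant ?M ?S"
    unfolding coinvariant_def
    by (auto simp: htens_NJ_iff[OF D] cadj_creation_NJ_slices[OF J] l2_nth_cadj_ampl_creation)
  have "constrained_on ?M J (compress ?M ?S)"
    unfolding constrained_on_def
  proof (intro ballI)
    fix f x assume f: "f \<in> J" and x: "x \<in> ?M"
    note F = Finf_bounded[OF ideal_Finf[OF J f]] and P = bounded_clinear_proj[OF N]
    have "fcalc f (compress ?M ?S) x = proj ?M (ampl f x)"
      by (rule fcalc_compress[OF ideal_Finf[OF J f] closed_csubspace_htens co x])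
    also have "\<dots> = ampl (proj (NJ J)) (ampl f x)"
      using x by (intro proj_htens[OF N D] ampl_coeff_in[OF F D]) (auto simp: htens_NJ_iff[OF D])
    \<comment> \<open>Slicewise, f maps into the range of an element of J, which the projection onto
      N_J annihilates.\<close>
    also have "\<dots> = 0"
    proof (rule slice_ext)
      fix u
      have "f (slice u x) \<in> ortho (NJ J)"
        using f by (auto simp: NJ_ortho ortho_def cinner_eq_0_commute)
      then show "slice u (ampl (proj (NJ J)) (ampl f x)) = slice u 0"
        by (simp add: slice_ampl[OF P] slice_ampl[OF F] proj_eq_0[OF N] bounded_clinear_0[OF bounded_clinear_slice])
    qed
    finally show "fcalc f (compress ?M ?S) x = 0" .
  qed
  moreover have "?M \<subseteq> htens UNIV D" by (auto simp: htens_NJ_iff[OF D] E)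
  ultimately show "?M \<subseteq> max_piece_space (htens UNIV D) J ?S"
    unfolding max_piece_space_def using co closed_csubspace_htens
    by (intro order_trans[OF _ ccspan_superset] Union_upper) auto
qed

lemma compress_creation_htens:
  assumes D: "closed_csubspace D" and x: "x \<in> htens (NJ J) D"
  shows "compress (htens (NJ J) D) (\<lambda>i. ampl (creation i)) i x = ampl (Bop J i) x"
proof -
  note N = closed_csubspace_NJ[of J]
  note P = bounded_clinear_proj[OF N]
  have "compress (htens (NJ J) D) (\<lambda>i. ampl (creation i)) i x = ampl (proj (NJ J)) (ampl (creation i) x)"
    unfolding compress_def
    using x by (intro proj_htens[OF N D] ampl_coeff_in[OF bounded_clinear_creation D]) (auto simp: htens_NJ_iff[OF D])
  also have "\<dots> = ampl (proj (NJ J) \<circ> creation i) (ampl (proj (NJ J)) x)"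
    using x by (simp add: ampl_compose[OF P bounded_clinear_creation] ampl_proj_NJ_slices htens_NJ_iff[OF D])
  also have "\<dots> = ampl (Bop J i) x"
    unfolding Bop_def by (rule ampl_compose[symmetric]) (intro bounded_clinear_compose P bounded_clinear_creation)+
  finally show ?thesis .
qed

section \<open>Compressions to co-invariant subspaces\<close>

lemma closed_csubspace_Cm: "closed_csubspace (Cm m)"
proof -
  have "closed_csubspace {x :: (nat, complex) l2. \<forall>i. m \<le> enat i \<longrightarrow> l2_nth x i = 0}"
  proof (rule closed_csubspace_Collect_all)
    fix i
    show "closed_csubspace {x :: (nat, complex) l2. m \<le> enat i \<longrightarrow> l2_nth x i = 0}"
      using closed_csubspace_eq[OF bounded_clinear_l2_nth[of i] bounded_clinear_const_0] closed_csubspace_UNIV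
      by (cases "m \<le> enat i") auto
  qed
  then show ?thesis by (simp add: Cm_def)
qed

lemma norm_ket: "norm (ket i) = 1"
proof -
  have "(norm (ket i))\<^sup>2 = 1\<^sup>2" by (simp add: norm_sq_cinner ket_cinner)
  then show ?thesis by (simp only: power2_eq_iff_nonneg norm_ge_zero zero_le_one)
qed

lemma has_hdim_Cm: "has_hdim (Cm m) m"
proof -
  let ?I = "{i :: nat. enat i < m}"
  have onb: "is_onb (Cm m) (ket ` ?I)"
    unfolding is_onb_iff
  proof
    show "orthonormal (ket ` ?I)" by (auto simp: orthonormal_def ket_cinner norm_ket)
    show "ccspan (ket ` ?I) = Cm m"
    proof
      show "ccspan (ket ` ?I) \<subseteq> Cm m"
        by (rule ccspan_minimal[OF closed_csubspace_Cm]) (auto simp: Cm_def ket.rep_eq)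
      show "Cm m \<subseteq> ccspan (ket ` ?I)"
      proof
        fix x assume x: "x \<in> Cm m"
        show "x \<in> ccspan (ket ` ?I)"
        proof (rule has_sum_in_closed_csubspace[OF closed_csubspace_ccspan has_sum_ket_tens])
          fix i
          show "ket i \<otimes>\<^sub>h l2_nth x i \<in> ccspan (ket ` ?I)"
          proof (cases "enat i < m")
            case True
            then have "ket i \<in> ccspan (ket ` ?I)" by (intro subsetD[OF ccspan_superset]) auto
            then show ?thesis unfolding ket_tens_complex by (rule closed_csubspaceD(3)[OF closed_csubspace_ccspan])
          next
            case False
            then have "l2_nth x i = 0" using x by (simp add: Cm_def)
            then show ?thesis unfolding ket_tens_complex by (simp add: closed_csubspaceD(1)[OF closed_csubspace_ccspan])
          qed
        qed
      qed
    qed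
  qed
  have "inj_on (ket :: nat \<Rightarrow> (nat, complex) l2) ?I"
    by (rule inj_onI) (metis ket_cinner zero_neq_one)
  then have "(card_of ?I, card_of ((ket :: nat \<Rightarrow> (nat, complex) l2) ` ?I)) \<in> ordIso"
    using card_of_ordIso by (auto simp: bij_betw_def)
  then show ?thesis
    unfolding has_hdim_def using hdim_onb[OF onb] ordIso_symmetric ordIso_transitive by meson
qed

text \<open>The range is the fixed-point set of V V^*, hence closed.\<close>

lemma closed_csubspace_range_isometry: "isometry_on UNIV V \<Longrightarrow> closed_csubspace (range V)"
proof -
  assume V: "isometry_on UNIV V"
  note b = isometry_UNIV_bounded_clinear[OF V]
  have "range V = {x. V (cadj V x) = x}" using isometry_cadj[OF V] by (auto simp: image_iff) metis
  then show ?thesis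
    using closed_csubspace_eq[OF bounded_clinear_compose2[OF b bounded_clinear_cadj[OF b]] bounded_clinear_id(2)] by simp
qed

text \<open>\<open>\<langle>\<Delta>\<^sub>X\<^sup>2 h, h\<rangle>\<close> is the squared norm of the vacuum component of \<open>U h\<close>, so \<open>\<Delta>\<^sub>X h \<mapsto> P\<^sub>0 U h\<close> is isometric.\<close>

lemma hdim_defect_space_vacuum:
  fixes X :: "'n :: finite \<Rightarrow> 'k :: chilbert_space \<Rightarrow> 'k" and U :: "'k \<Rightarrow> ('n list, 'd :: chilbert_space) l2"
  assumes X: "row_contraction X" and C: "closed_csubspace C" and U: "isometry_on UNIV U"
    and r: "\<And>h i. l2_nth (U h) i \<in> C" and i: "\<And>i h. cadj (ampl (creation i)) (U h) = U (cadj (X i) h)"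
  shows "(hdim (defect_space X), hdim (closure (proj ((\<lambda>d. ket [] \<otimes>\<^sub>h d) ` C) ` range U))) \<in> ordIso"
proof -
  let ?Q = "(\<lambda>d. ket [] \<otimes>\<^sub>h d) ` C :: ('n list, 'd) l2 set"
  have "?Q = {x. ket [] \<otimes>\<^sub>h l2_nth x [] = x} \<inter> {x. l2_nth x [] \<in> C}"
    by (auto simp: l2_nth_ket_tens image_iff) metis
  also have "closed_csubspace \<dots>"
    by (intro closed_csubspace_Int closed_csubspace_vimage[OF bounded_clinear_l2_nth C]
        closed_csubspace_eq[OF bounded_clinear_compose2[OF bounded_clinear_tens_right bounded_clinear_l2_nth]
          bounded_clinear_id(2)])
  finally have Q: "closed_csubspace ?Q" .
  \<comment> \<open>Subtracting the vacuum term leaves a vector with zero vacuum coordinate, which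
    is orthogonal to all of \<open>?Q\<close>.\<close>
  have pQ: "proj ?Q (U h) = ket [] \<otimes>\<^sub>h l2_nth (U h) []" for h
    by (rule proj_eqI[OF Q]) (use r in \<open>auto simp: ortho_def cinner.diff_left cinner_ket_tens l2_nth_ket_tens minus_l2.rep_eq\<close>)
  define A :: "'k \<Rightarrow> ('n list, 'd) l2" where "A h = ket [] \<otimes>\<^sub>h l2_nth (U h) []" for h
  have bA: "bounded_clinear A"
    unfolding A_def[abs_def]
    by (intro bounded_clinear_compose2[OF bounded_clinear_tens_right]
        bounded_clinear_compose2[OF bounded_clinear_l2_nth] isometry_UNIV_bounded_clinear[OF U])
  have "norm (defect X h) = norm (A h)" for h
    using norm_defect_vacuum[OF X U i] by (simp add: A_def norm_tens norm_ket)
  then obtain W where "unitary_between (closure (range (defect X))) (closure (range A)) W"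
    using equal_norm_unitary[OF pos_op_bounded[OF pos_op_defect[OF X]] bA] by blast
  moreover have "proj ?Q ` range U = range A" by (auto simp: pQ A_def image_iff)
  moreover have "closed_csubspace (closure (range A))"
    by (simp add: closed_csubspace_closure_range[OF bA] closed_csubspace_ccspan)
  ultimately show ?thesis
    using hdim_unitary[OF closed_csubspace_defect_space[OF X]] by (simp add: defect_space_def)
qed

lemma has_hdim_ordIso: "(hdim M, hdim N) \<in> ordIso \<Longrightarrow> has_hdim M m \<longleftrightarrow> has_hdim N m"
  unfolding has_hdim_def using ordIso_symmetric ordIso_transitive by meson

text \<open>Forward, a unitary from the defect space onto the model space moves the Poisson kernel
  into N_J \<otimes> C^m. Backward, the compression identity gives the intertwining of adjoints. In
  both directions the vacuum component then has the dimension of the defect space.\<close>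

lemma has_hdim_defect_iff:
  fixes J :: "('n :: finite fock \<Rightarrow> 'n fock) set" and X :: "'n \<Rightarrow> 'k :: chilbert_space \<Rightarrow> 'k"
  assumes J: "wot_closed_ideal J" and X: "pure_row_contraction X" "constrained_on UNIV J X"
  shows "has_hdim (defect_space X) m \<longleftrightarrow>
    (\<exists>M U. closed_csubspace M \<and> M \<subseteq> htens (NJ J) (Cm m) \<and>
       coinvariant M (\<lambda>i. ampl (Bop J i)) \<and>
       has_hdim (closure (proj ((\<lambda>d. ket [] \<otimes>\<^sub>h d) ` Cm m) ` M)) m \<and>
       unitary_between UNIV M U \<and>
       (\<forall>i h. U (X i h) = compress M (\<lambda>i. ampl (Bop J i)) i (U h)))"
    (is "?L \<longleftrightarrow> ?R")
proof
  note row = pure_row_contraction_row[OF X(1)] and bX = pure_row_contraction_bounded[OF X(1)]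
  note C = closed_csubspace_Cm[of m] and DX = closed_csubspace_defect_space[OF row]
  note bB = bounded_clinear_ampl[OF bounded_clinear_Bop]
  {
    assume ?L
    then have "(hdim (defect_space X), hdim (Cm m)) \<in> ordIso"
      unfolding has_hdim_def using has_hdim_Cm[of m, unfolded has_hdim_def] ordIso_symmetric ordIso_transitive by meson
    then obtain W where W: "bounded_clinear W" "unitary_between (defect_space X) (Cm m) W"
      using hdim_eq_unitary[OF DX C] by blast
    have isoW: "isometry_on (defect_space X) W" and WC: "W ` defect_space X = Cm m"
      using W(2) by (auto simp: unitary_between_def)
    \<comment> \<open>Acting on the coefficient factor commutes with amplified operators, so the
      intertwining with the adjoints of creation is inherited from the Poisson kernel.\<close>
    define U where "U h = l2map W (poisson_kernel X h)" for h
    note K = isometry_UNIV_bounded_clinear[OF isometry_poisson_kernel[OF X(1)]]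
    have cD: "l2_nth (poisson_kernel X h) i \<in> defect_space X" for h i
      by (simp add: l2_nth_poisson_kernel[OF X(1)] defect_in_defect_space)
    have U: "isometry_on UNIV U"
      unfolding isometry_on_def U_def
      by (simp add: bounded_clinear_add[OF K] bounded_clinear_scaleC[OF K] l2map_linear[OF W(1)]
          norm_l2map[OF W(1) isoW cD] norm_poisson_kernel[OF X(1)])
    have cC: "l2_nth (U h) i \<in> Cm m" for h i
      unfolding U_def l2_nth_l2map[OF W(1)] WC[symmetric] by (rule imageI[OF cD])
    have sl: "U h \<in> NJ_slices J" for h
      using poisson_kernel_NJ_slices[OF J X, of h] by (simp add: NJ_slices_def U_def slice_l2map[OF W(1)])
    have adj: "cadj (ampl (creation i)) (U h) = U (cadj (X i) h)" for i h
      unfolding U_def cadj_creation_poisson[OF X(1), symmetric] cadj_ampl[OF bounded_clinear_creation]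
      by (rule l2map_ampl[OF W(1) bounded_clinear_cadj[OF bounded_clinear_creation], symmetric])
    have adjB: "cadj (ampl (Bop J i)) (U h) = U (cadj (X i) h)" for i h
      by (simp add: cadj_ampl_Bop_NJ_slices[OF J sl] adj)
    have M: "closed_csubspace (range U)" by (rule closed_csubspace_range_isometry[OF U])
    have "U (X i h) = compress (range U) (\<lambda>i. ampl (Bop J i)) i (U h)" for i h
      unfolding compress_def
    proof (rule proj_eqI[OF M, symmetric])
      show "ampl (Bop J i) (U h) - U (X i h) \<in> ortho (range U)"
        by (auto simp: ortho_def cinner.diff_left cinner_cadj[OF bB] adjB isometry_cinner[OF U] cinner_cadj[OF bX])
    qed simp
    moreover have "has_hdim (closure (proj ((\<lambda>d. ket [] \<otimes>\<^sub>h d) ` Cm m) ` range U)) m"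
      using has_hdim_ordIso[OF hdim_defect_space_vacuum[OF row C U cC adj]] \<open>?L\<close> by simp
    moreover have "range U \<subseteq> htens (NJ J) (Cm m)" using sl cC by (auto simp: htens_NJ_iff[OF C])
    moreover have "coinvariant (range U) (\<lambda>i. ampl (Bop J i))" by (auto simp: coinvariant_def adjB)
    moreover have "unitary_between UNIV (range U) U" using U by (simp add: unitary_between_def)
    ultimately show ?R using M by blast
  }
  assume ?R
  then obtain M U where M: "closed_csubspace M" "M \<subseteq> htens (NJ J) (Cm m)"
      "coinvariant M (\<lambda>i. ampl (Bop J i))"
      "has_hdim (closure (proj ((\<lambda>d. ket [] \<otimes>\<^sub>h d) ` Cm m) ` M)) m"
      "unitary_between UNIV M U" "\<And>i h. U (X i h) = compress M (\<lambda>i. ampl (Bop J i)) i (U h)"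
    by blast
  have U: "isometry_on UNIV U" and rU: "range U = M" using M(5) by (auto simp: unitary_between_def)
  have UM: "U h \<in> M" for h using rU by blast
  have UH: "U h \<in> htens (NJ J) (Cm m)" for h using UM M(2) by blast
  have adjB: "cadj (ampl (Bop J i)) (U h) = U (cadj (X i) h)" for i h
  proof (rule coinvariant_isometry_cadj[OF bB bX U])
    show "cadj (ampl (Bop J i)) (U h) \<in> range U" using M(3) UM rU by (simp add: coinvariant_def)
    fix k
    have "cinner (U h) (ampl (Bop J i) (U k)) = cinner (U h) (U (X i k))"
      by (simp add: M(6) compress_def cinner_proj_right[OF M(1) UM])
    then show "cinner (U h) (ampl (Bop J i) (U k)) = cinner h (X i k)" by (simp add: isometry_cinner[OF U])
  qed
  have adj: "cadj (ampl (creation i)) (U h) = U (cadj (X i) h)" for i h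
    using UH[of h] adjB[of i h] by (simp add: cadj_ampl_Bop_NJ_slices[OF J] htens_NJ_iff[OF C])
  show ?L
    using has_hdim_ordIso[OF hdim_defect_space_vacuum[OF row C U _ adj]] M(4) UH
    by (simp add: rU htens_NJ_iff[OF C])
qed

theorem theorem2p10:
  fixes J :: "('n :: finite fock \<Rightarrow> 'n fock) set"
    and T :: "'n \<Rightarrow> 'h :: chilbert_space \<Rightarrow> 'h"
  assumes "wot_closed_ideal J" and "J \<noteq> Finf"
    and "pure_row_contraction T"
    and "constrained_on UNIV J T"
  shows
    "dilation J T (defect_space T) (constrained_kernel J T) \<and>
     is_dil_ind TYPE('d :: chilbert_space) J T (hdim (defect_space T)) \<and>
     (ket [] \<in> NJ J \<longrightarrow> minimal_for J (defect_space T) (constrained_kernel J T)) \<and>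
     (ket [] \<in> NJ J \<and> span_BB J = cstar_B J \<longrightarrow>
       (\<forall>(D :: 'd set) V.
          closed_csubspace D \<and> dilation J T D V \<and> minimal_for J D V \<longrightarrow>
          (\<exists>U. unitary_between (htens (NJ J) (defect_space T)) (htens (NJ J) D) U \<and>
               (\<forall>i. \<forall>x\<in>htens (NJ J) (defect_space T).
                  U (ampl (Bop J i) x) = ampl (Bop J i) (U x)) \<and>
               (\<forall>h. U (constrained_kernel J T h) = V h))) \<and>
       (let E = htens UNIV (defect_space T);
            M = max_piece_space E J (\<lambda>i. ampl (creation i))
        in M = htens (NJ J) (defect_space T) \<and>
           (\<forall>i. \<forall>x\<in>M. compress M (\<lambda>i. ampl (creation i)) i x = ampl (Bop J i) x)) \<and>
       (\<forall>(X :: 'n \<Rightarrow> 'k :: chilbert_space \<Rightarrow> 'k) (m :: enat).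
          pure_row_contraction X \<and> constrained_on UNIV J X \<and> 1 \<le> m \<longrightarrow>
          (has_hdim (defect_space X) m \<longleftrightarrow>
            (\<exists>M U. closed_csubspace M \<and> M \<subseteq> htens (NJ J) (Cm m) \<and>
               coinvariant M (\<lambda>i. ampl (Bop J i)) \<and>
               has_hdim (closure (proj ((\<lambda>d. ket [] \<otimes>\<^sub>h d) ` Cm m) ` M)) m \<and>
               unitary_between UNIV M U \<and>
               (\<forall>i h. U (X i h) = compress M (\<lambda>i. ampl (Bop J i)) i (U h))))))"
proof -
  note J = assms(1) and T = assms(3,4)
  note row = pure_row_contraction_row[OF T(1)] and bT = pure_row_contraction_bounded[OF T(1)]
  note D = closed_csubspace_defect_space[OF row]
  note K = constrained_kernel_eq[OF J T]
  have dil: "dilation J T (defect_space T) (constrained_kernel J T)"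
    unfolding K by (rule dilation_poisson_kernel[OF J T])
  have ind: "is_dil_ind TYPE('d) J T (hdim (defect_space T))"
    unfolding is_dil_ind_def
  proof (intro conjI allI impI)
    \<comment> \<open>The minimum is attained at the defect space itself, with the constrained
      Poisson kernel as dilation.\<close>
    show "\<exists>D :: 'h set. closed_csubspace D \<and> (\<exists>V. dilation J T D V) \<and> (hdim D, hdim (defect_space T)) \<in> ordIso"
      using D dil ordIso_refl[OF card_of_Card_order] unfolding hdim_def by blast
    fix D' :: "'d set" assume "closed_csubspace D' \<and> (\<exists>V. dilation J T D' V)"
    then show "(hdim (defect_space T), hdim D') \<in> ordLeq" using hdim_defect_space_le[OF J row] by blast
  qed
  have min: "minimal_for J (defect_space T) (constrained_kernel J T)" if "ket [] \<in> NJ J"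
    unfolding K by (rule minimal_poisson_kernel[OF J T that])
  have uniq: "\<exists>U. unitary_between (htens (NJ J) (defect_space T)) (htens (NJ J) D') U \<and>
      (\<forall>i. \<forall>x\<in>htens (NJ J) (defect_space T). U (ampl (Bop J i) x) = ampl (Bop J i) (U x)) \<and>
      (\<forall>h. U (constrained_kernel J T h) = V h)"
    if "ket [] \<in> NJ J" "span_BB J = cstar_B J" "closed_csubspace D'" "dilation J T D' V" "minimal_for J D' V"
    for D' :: "'d set" and V
    by (rule minimal_dilation_unique[OF J bT D dil that(3,4,2) min[OF that(1)] that(5)])
  have piece: "let E = htens UNIV (defect_space T);
          M = max_piece_space E J (\<lambda>i. ampl (creation i))
      in M = htens (NJ J) (defect_space T) \<and>
         (\<forall>i. \<forall>x\<in>M. compress M (\<lambda>i. ampl (creation i)) i x = ampl (Bop J i) x)"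
    unfolding Let_def max_piece_space_eq[OF J D] by (simp add: compress_creation_htens[OF D])
  show ?thesis
    by (intro conjI impI allI dil ind min piece)
      ((rule uniq; simp) | (rule has_hdim_defect_iff[OF J]; simp) | assumption)+
qed

end
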